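(* Let $A=\{1,\dots,n\}$, let $c:2^A\to\mathbb{R}$ be a monotone submodular function and let $f:2^A\to[0,1]$ be a monotone supermodular function. Then there exists an efficient algorithm (running in time polynomial in $n$, given value oracle access to $f$ and $c$) for computing the optimal contract.
   Context: Contract setting: $A=\{1,\dots,n\}$ is a set of actions, $f$ is the reward (success probability) function and $c$ is the cost function. A contract is a number $\alpha\in[0,1]$. For $S\subseteq A$, the agent's utility is $u_a(\alpha,S)=\alpha f(S)-c(S)$ and the principal's utility is $u_p(\alpha,S)=(1-\alpha)f(S)$. The agent's best response $S_\alpha$ is a set maximizing $u_a(\alpha,\cdot)$ over all $S\subseteq A$, with ties broken in favor of sets with larger $f$, and remaining ties broken by a consistent rule independent of $\alpha$. An optimal contract is an $\alpha\in[0,1]$ maximizing $u_p(\alpha)=(1-\alpha)f(S_\alpha)$. Write $g(a\mid S)=g(S\cup\{a\})-g(S)$. A set function $g:2^A\to\mathbb{R}$ is monotone if $S\subseteq T$ implies $g(S)\le g(T)$; it is supermodular if $g(a\mid S)\le g(a\mid T)$ for all $S\subseteq T\subseteq A$ and $a\in A\setminus T$; it is submodular if $-g$ is supermodular. A value oracle for $g$ takes $S\subseteq A$ and returns $g(S)$. Running time is measured with arithmetic operations, comparisons and value-oracle calls counted as unit-cost steps. *)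

theory Defs
  imports Complex_Main "HOL-Computational_Algebra.Polynomial"
begin

section \<open>Set functions\<close>

definition marginal :: "('a set \<Rightarrow> real) \<Rightarrow> 'a \<Rightarrow> 'a set \<Rightarrow> real" where
  "marginal g a S = g (S \<union> {a}) - g S"

definition supermodular_on :: "'a set \<Rightarrow> ('a set \<Rightarrow> real) \<Rightarrow> bool" where
  "supermodular_on A g \<longleftrightarrow>
     (\<forall>S T a. S \<subseteq> T \<and> T \<subseteq> A \<and> a \<in> A - T \<longrightarrow> marginal g a S \<le> marginal g a T)"

definition submodular_on :: "'a set \<Rightarrow> ('a set \<Rightarrow> real) \<Rightarrow> bool" where
  "submodular_on A g \<longleftrightarrow> supermodular_on A (\<lambda>S. - g S)"


section \<open>Contracts\<close>

definition agent_utility ::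
  "('a set \<Rightarrow> real) \<Rightarrow> ('a set \<Rightarrow> real) \<Rightarrow> real \<Rightarrow> 'a set \<Rightarrow> real" where
  "agent_utility f c \<alpha> S = \<alpha> * f S - c S"

definition principal_utility :: "('a set \<Rightarrow> real) \<Rightarrow> real \<Rightarrow> 'a set \<Rightarrow> real" where
  "principal_utility f \<alpha> S = (1 - \<alpha>) * f S"

definition agent_maximizers ::
  "'a set \<Rightarrow> ('a set \<Rightarrow> real) \<Rightarrow> ('a set \<Rightarrow> real) \<Rightarrow> real \<Rightarrow> 'a set set" where
  "agent_maximizers A f c \<alpha> = {S. is_arg_max (agent_utility f c \<alpha>) (\<lambda>S. S \<subseteq> A) S}"

definition best_responses ::
  "'a set \<Rightarrow> ('a set \<Rightarrow> real) \<Rightarrow> ('a set \<Rightarrow> real) \<Rightarrow> real \<Rightarrow> 'a set set" where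
  "best_responses A f c \<alpha> = {S. is_arg_max f (\<lambda>S. S \<in> agent_maximizers A f c \<alpha>) S}"

text \<open>
  The rule for the ties that remain sees only the family of tied sets, never the contract.
  Picking the first tied set in a fixed linear order on the subsets is the typical instance.
\<close>

definition tie_breaking_rule :: "'a set \<Rightarrow> ('a set set \<Rightarrow> 'a set) \<Rightarrow> bool" where
  "tie_breaking_rule A \<tau> \<longleftrightarrow> (\<forall>F. F \<subseteq> Pow A \<and> F \<noteq> {} \<longrightarrow> \<tau> F \<in> F)"

definition best_response ::
  "('a set set \<Rightarrow> 'a set) \<Rightarrow> 'a set \<Rightarrow> ('a set \<Rightarrow> real) \<Rightarrow> ('a set \<Rightarrow> real) \<Rightarrow> real \<Rightarrow> 'a set" where
  "best_response \<tau> A f c \<alpha> = \<tau> (best_responses A f c \<alpha>)"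

definition optimal_contract ::
  "('a set set \<Rightarrow> 'a set) \<Rightarrow> 'a set \<Rightarrow> ('a set \<Rightarrow> real) \<Rightarrow> ('a set \<Rightarrow> real) \<Rightarrow> real \<Rightarrow> bool" where
  "optimal_contract \<tau> A f c \<alpha> \<longleftrightarrow>
     is_arg_max (\<lambda>\<beta>. principal_utility f \<beta> (best_response \<tau> A f c \<beta>)) (\<lambda>\<beta>. \<beta> \<in> {0..1}) \<alpha>"


section \<open>Algorithms with value oracles\<close>

text \<open>
  Algorithms are programs of a while language over exact reals (a real RAM).  The memory consists
  of two-dimensional arrays of natural numbers and of reals, named by natural numbers.  Natural
  numbers serve as indices, counters and characteristic vectors and are only added and subtracted;
  two-dimensional arrays make index multiplication unnecessary.  Reals are never rounded to
  integers, and the only real constants are natural numbers.  A program is a finite object that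
  does not depend on the number of actions.
\<close>

type_synonym name = nat

datatype iexp =
    INum nat
  | IGet name iexp iexp
  | IAdd iexp iexp
  | ISub iexp iexp

datatype rexp =
    ROf iexp
  | RGet name iexp iexp
  | RAdd rexp rexp
  | RSub rexp rexp
  | RMul rexp rexp
  | RDiv rexp rexp

datatype bexp =
    ILess iexp iexp
  | RLess rexp rexp
  | BNot bexp
  | BAnd bexp bexp

datatype source = Reward | Cost

datatype com =
    Skip
  | IPut name iexp iexp iexp
  | RPut name iexp iexp rexp
  | Query source name iexp iexp name iexp
  | Seq com com
  | Cond bexp com com
  | Loop bexp com

record state =
  ints :: "name \<Rightarrow> nat \<Rightarrow> nat \<Rightarrow> nat"
  reals :: "name \<Rightarrow> nat \<Rightarrow> nat \<Rightarrow> real"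

definition update ::
  "(name \<Rightarrow> nat \<Rightarrow> nat \<Rightarrow> 'v) \<Rightarrow> name \<Rightarrow> nat \<Rightarrow> nat \<Rightarrow> 'v \<Rightarrow> (name \<Rightarrow> nat \<Rightarrow> nat \<Rightarrow> 'v)" where
  "update m x i j v = m(x := (m x)(i := (m x i)(j := v)))"

text \<open>Subtraction of indices is truncated at 0, and a real division by 0 yields 0.\<close>

fun ival :: "iexp \<Rightarrow> state \<Rightarrow> nat" where
  "ival (INum k) s = k"
| "ival (IGet x e1 e2) s = ints s x (ival e1 s) (ival e2 s)"
| "ival (IAdd e1 e2) s = ival e1 s + ival e2 s"
| "ival (ISub e1 e2) s = ival e1 s - ival e2 s"

fun rval :: "rexp \<Rightarrow> state \<Rightarrow> real" where
  "rval (ROf e) s = real (ival e s)"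
| "rval (RGet x e1 e2) s = reals s x (ival e1 s) (ival e2 s)"
| "rval (RAdd e1 e2) s = rval e1 s + rval e2 s"
| "rval (RSub e1 e2) s = rval e1 s - rval e2 s"
| "rval (RMul e1 e2) s = rval e1 s * rval e2 s"
| "rval (RDiv e1 e2) s = rval e1 s / rval e2 s"

fun bval :: "bexp \<Rightarrow> state \<Rightarrow> bool" where
  "bval (ILess e1 e2) s \<longleftrightarrow> ival e1 s < ival e2 s"
| "bval (RLess e1 e2) s \<longleftrightarrow> rval e1 s < rval e2 s"
| "bval (BNot b) s \<longleftrightarrow> \<not> bval b s"
| "bval (BAnd b1 b2) s \<longleftrightarrow> bval b1 s \<and> bval b2 s"

text \<open>Every constant, memory access, arithmetic operation, comparison and connective costs one step.\<close>

fun icost :: "iexp \<Rightarrow> nat" where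
  "icost (INum k) = 1"
| "icost (IGet x e1 e2) = 1 + icost e1 + icost e2"
| "icost (IAdd e1 e2) = 1 + icost e1 + icost e2"
| "icost (ISub e1 e2) = 1 + icost e1 + icost e2"

fun rcost :: "rexp \<Rightarrow> nat" where
  "rcost (ROf e) = 1 + icost e"
| "rcost (RGet x e1 e2) = 1 + icost e1 + icost e2"
| "rcost (RAdd e1 e2) = 1 + rcost e1 + rcost e2"
| "rcost (RSub e1 e2) = 1 + rcost e1 + rcost e2"
| "rcost (RMul e1 e2) = 1 + rcost e1 + rcost e2"
| "rcost (RDiv e1 e2) = 1 + rcost e1 + rcost e2"

fun bcost :: "bexp \<Rightarrow> nat" where
  "bcost (ILess e1 e2) = 1 + icost e1 + icost e2"
| "bcost (RLess e1 e2) = 1 + rcost e1 + rcost e2"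
| "bcost (BNot b) = 1 + bcost b"
| "bcost (BAnd b1 b2) = 1 + bcost b1 + bcost b2"

text \<open>
  The oracles are called on a characteristic vector, stored in row \<open>i\<close> of array \<open>x\<close>.
  Only subsets of \<open>{1..n}\<close> can be queried.
\<close>

definition stored_set :: "nat \<Rightarrow> name \<Rightarrow> nat \<Rightarrow> state \<Rightarrow> nat set" where
  "stored_set n x i s = {a \<in> {1..n}. ints s x i a \<noteq> 0}"

fun answer :: "(nat set \<Rightarrow> real) \<Rightarrow> (nat set \<Rightarrow> real) \<Rightarrow> source \<Rightarrow> nat set \<Rightarrow> real" where
  "answer f c Reward S = f S"
| "answer f c Cost S = c S"

text \<open>
  \<open>exec n f c p s t s'\<close>: with value oracles \<open>f\<close> and \<open>c\<close> for \<open>n\<close> actions, program \<open>p\<close> started in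
  state \<open>s\<close> halts after \<open>t\<close> steps in state \<open>s'\<close>.
\<close>

inductive exec ::
  "nat \<Rightarrow> (nat set \<Rightarrow> real) \<Rightarrow> (nat set \<Rightarrow> real) \<Rightarrow> com \<Rightarrow> state \<Rightarrow> nat \<Rightarrow> state \<Rightarrow> bool"
  for n f c where
  Skip: "exec n f c Skip s 1 s"
| IPut: "exec n f c (IPut x e1 e2 e) s (1 + icost e1 + icost e2 + icost e)
           (s\<lparr>ints := update (ints s) x (ival e1 s) (ival e2 s) (ival e s)\<rparr>)"
| RPut: "exec n f c (RPut x e1 e2 e) s (1 + icost e1 + icost e2 + rcost e)
           (s\<lparr>reals := update (reals s) x (ival e1 s) (ival e2 s) (rval e s)\<rparr>)"
| Query: "exec n f c (Query q x e1 e2 y e) s (1 + icost e1 + icost e2 + icost e)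
           (s\<lparr>reals := update (reals s) x (ival e1 s) (ival e2 s)
                (answer f c q (stored_set n y (ival e s) s))\<rparr>)"
| Seq: "exec n f c p1 s t1 s1 \<Longrightarrow> exec n f c p2 s1 t2 s2 \<Longrightarrow>
          exec n f c (Seq p1 p2) s (1 + t1 + t2) s2"
| Cond_True: "bval b s \<Longrightarrow> exec n f c p1 s t s' \<Longrightarrow>
          exec n f c (Cond b p1 p2) s (1 + bcost b + t) s'"
| Cond_False: "\<not> bval b s \<Longrightarrow> exec n f c p2 s t s' \<Longrightarrow>
          exec n f c (Cond b p1 p2) s (1 + bcost b + t) s'"
| Loop_False: "\<not> bval b s \<Longrightarrow> exec n f c (Loop b p) s (1 + bcost b) s"
| Loop_True: "bval b s \<Longrightarrow> exec n f c p s t1 s1 \<Longrightarrow> exec n f c (Loop b p) s1 t2 s2 \<Longrightarrow>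
          exec n f c (Loop b p) s (1 + bcost b + t1 + t2) s2"

inductive_cases exec_cases:
  "exec n f c Skip s t s'"
  "exec n f c (IPut x e1 e2 e) s t s'"
  "exec n f c (RPut x e1 e2 e) s t s'"
  "exec n f c (Query q x e1 e2 y e) s t s'"
  "exec n f c (Seq p1 p2) s t s'"
  "exec n f c (Cond b p1 p2) s t s'"
  "exec n f c (Loop b p) s t s'"

lemma exec_deterministic:
  "exec n f c p s t s' \<Longrightarrow> exec n f c p s u s'' \<Longrightarrow> u = t \<and> s'' = s'"
proof (induction arbitrary: u s'' rule: exec.induct)
  case (Skip s)
  from Skip.prems show ?case by (rule exec_cases) simp
next
  case (IPut x e1 e2 e s)
  from IPut.prems show ?case by (rule exec_cases) simp
next
  case (RPut x e1 e2 e s)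
  from RPut.prems show ?case by (rule exec_cases) simp
next
  case (Query q x e1 e2 y e s)
  from Query.prems show ?case by (rule exec_cases) simp
next
  case (Seq p1 s t1 s1 p2 t2 s2)
  from Seq.prems show ?case
  proof (rule exec_cases)
    fix u1 v u2
    assume *: "u = Suc (u1 + u2)" "exec n f c p1 s u1 v" "exec n f c p2 v u2 s''"
    from Seq.IH(1)[OF *(2)] have "u1 = t1" "v = s1" by simp_all
    with Seq.IH(2) * show ?thesis by simp
  qed
next
  case (Cond_True b s p1 t s' p2)
  from Cond_True.prems show ?case
  proof (rule exec_cases)
    fix v
    assume *: "u = Suc (bcost b + v)" "exec n f c p1 s v s''"
    from Cond_True.IH[OF *(2)] * show ?thesis by simp
  next
    assume "\<not> bval b s"
    with Cond_True.hyps show ?thesis by simp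
  qed
next
  case (Cond_False b s p2 t s' p1)
  from Cond_False.prems show ?case
  proof (rule exec_cases)
    assume "bval b s"
    with Cond_False.hyps show ?thesis by simp
  next
    fix v
    assume *: "u = Suc (bcost b + v)" "exec n f c p2 s v s''"
    from Cond_False.IH[OF *(2)] * show ?thesis by simp
  qed
next
  case (Loop_False b s p)
  from Loop_False.prems show ?case
  proof (rule exec_cases)
    assume "u = Suc (bcost b)" "s'' = s"
    then show ?thesis by simp
  next
    assume "bval b s"
    with Loop_False.hyps show ?thesis by simp
  qed
next
  case (Loop_True b s p t1 s1 t2 s2)
  from Loop_True.prems show ?case
  proof (rule exec_cases)
    assume "\<not> bval b s"
    with Loop_True.hyps show ?thesis by simp
  next
    fix u1 v u2
    assume *: "u = Suc (bcost b + u1 + u2)" "exec n f c p s u1 v" "exec n f c (Loop b p) v u2 s''"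
    from Loop_True.IH(1)[OF *(2)] have "u1 = t1" "v = s1" by simp_all
    with Loop_True.IH(2) * show ?thesis by simp
  qed
qed

text \<open>The only input held in memory is \<open>n\<close>; the result is read off a fixed real cell.\<close>

definition initial_state :: "nat \<Rightarrow> state" where
  "initial_state n = \<lparr>ints = update (\<lambda>_ _ _. 0) 0 0 0 n, reals = (\<lambda>_ _ _. 0)\<rparr>"

definition result :: "state \<Rightarrow> real" where
  "result s = reals s 0 0 0"

end

theory Submission
  imports Defs
begin

text \<open>
  For fixed \<open>\<alpha>\<close> the best responses are the minimizers of the submodular function \<open>c - \<alpha> f\<close>.
  They are found by the push-relabel form of Schrijver's algorithm: a convex combination \<open>x\<close> of
  greedy base vectors is pushed from elements with positive towards elements with negative value,
  with labels below the distance from the positive elements in the graph of exchanges, and a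
  Caratheodory step keeps the combination short.  An empty label class then cuts out a minimizer.

  The utility of the agent is convex and piecewise linear in \<open>\<alpha>\<close>, and by supermodularity its
  maximal maximizers form a chain, so it has at most \<open>n + 1\<close> slopes.  The principal's optimum lies
  at the left end of a linear piece; these ends are enumerated from right to left, each of them
  located by Newton's method started at \<open>\<alpha> = 0\<close>.

  Every program uses only counting loops whose bounds depend on \<open>n\<close> alone, so that its running
  time is polynomial by its shape; a while loop with a decreasing measure below \<open>(n + 3)\<^sup>k\<close>
  becomes \<open>k\<close> nested counting loops around a body that does nothing once the loop has finished.
\<close>

section \<open>Programs with counting loops\<close>

text \<open>Rewards and costs are arbitrary reals and every operation is one step, so iteration
  counts may depend on \<open>n\<close> alone. Scaling and rounding are thereby excluded, and both
  algorithms have to stop for combinatorial reasons. The minimization has a lexicographic measure of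
  five digits below \<open>(n + 3)\<^sup>2\<close>, hence ten nested loops; the search has a pair of
  slope indices of at most \<open>2 * n + 2\<close>, hence four.

  Left ends suffice because on an interval of contracts with the same reward the principal's utility
  does not increase in \<alpha>, and ties broken in favour of \<open>f\<close> let the left end
  itself attain that reward.

  A single exchange in a ranking may change many coordinates of \<open>x\<close>. Schrijver's remedy
  is to combine all exchanges that move an element behind \<open>s\<close>, up to \<open>t\<close>,
  to the place just before \<open>s\<close>: a nonnegative combination of them shifts value between
  \<open>s\<close> and \<open>t\<close> only. A push thus replaces one vector by up to
  \<open>n\<close> others, which is why the combination has to be shortened.

  Sets never leave the minimization: the search works with pairs of reward and cost.\<close>

datatype prog =
    PSkip
  | PI name iexp iexp iexp
  | PR name iexp iexp rexp
  | PQ source name iexp iexp name iexp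
  | PSeq prog prog (infixr \<open>;;\<close> 60)
  | PIf bexp prog prog
  | PFor name nat nat prog

abbreviation IV :: "name \<Rightarrow> iexp" where "IV x \<equiv> IGet x (INum 0) (INum 0)"
abbreviation RV :: "name \<Rightarrow> rexp" where "RV x \<equiv> RGet x (INum 0) (INum 0)"

text \<open>\<open>PFor i l h p\<close> runs \<open>p\<close> for \<open>i = l, \<dots>, n + h - 1\<close>, where \<open>n\<close> is held in cell \<open>(0, 0)\<close> of array \<open>0\<close>.\<close>

primrec compile :: "prog \<Rightarrow> com" where
  "compile PSkip = Skip"
| "compile (PI x e1 e2 e) = IPut x e1 e2 e"
| "compile (PR x e1 e2 e) = RPut x e1 e2 e"
| "compile (PQ q x e1 e2 y e) = Query q x e1 e2 y e"
| "compile (p1 ;; p2) = Seq (compile p1) (compile p2)"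
| "compile (PIf b p1 p2) = Cond b (compile p1) (compile p2)"
| "compile (PFor i l h p) =
     Seq (IPut i (INum 0) (INum 0) (INum l))
       (Loop (ILess (IV i) (IAdd (IV 0) (INum h)))
         (Seq (compile p) (IPut i (INum 0) (INum 0) (IAdd (IV i) (INum 1)))))"

section \<open>Footprint, well-formedness and time polynomial of a program\<close>

primrec imods :: "prog \<Rightarrow> name set" where
  "imods PSkip = {}"
| "imods (PI x e1 e2 e) = {x}"
| "imods (PR x e1 e2 e) = {}"
| "imods (PQ q x e1 e2 y e) = {}"
| "imods (p1 ;; p2) = imods p1 \<union> imods p2"
| "imods (PIf b p1 p2) = imods p1 \<union> imods p2"
| "imods (PFor i l h p) = insert i (imods p)"

primrec rmods :: "prog \<Rightarrow> name set" where
  "rmods PSkip = {}"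
| "rmods (PI x e1 e2 e) = {}"
| "rmods (PR x e1 e2 e) = {x}"
| "rmods (PQ q x e1 e2 y e) = {x}"
| "rmods (p1 ;; p2) = rmods p1 \<union> rmods p2"
| "rmods (PIf b p1 p2) = rmods p1 \<union> rmods p2"
| "rmods (PFor i l h p) = rmods p"

text \<open>Every loop bound reads \<open>n\<close> from array \<open>0\<close>, and a loop counter
  has to survive its body; together the two exclusions fix the number of rounds on entry.\<close>

primrec wf_prog :: "prog \<Rightarrow> bool" where
  "wf_prog PSkip = True"
| "wf_prog (PI x e1 e2 e) = (x \<noteq> 0)"
| "wf_prog (PR x e1 e2 e) = True"
| "wf_prog (PQ q x e1 e2 y e) = True"
| "wf_prog (p1 ;; p2) = (wf_prog p1 \<and> wf_prog p2)"
| "wf_prog (PIf b p1 p2) = (wf_prog p1 \<and> wf_prog p2)"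
| "wf_prog (PFor i l h p) = (i \<noteq> 0 \<and> i \<notin> imods p \<and> wf_prog p)"

text \<open>An upper bound, hence the sum over both branches. For a loop, 15 covers the sequencing,
  the initial assignment and the last, failing test; 19 covers test, sequencing and increment of one
  round; \<open>[:h, 1:]\<close> is \<open>n + h\<close>.\<close>

primrec time :: "prog \<Rightarrow> nat poly" where
  "time PSkip = 1"
| "time (PI x e1 e2 e) = [:1 + icost e1 + icost e2 + icost e:]"
| "time (PR x e1 e2 e) = [:1 + icost e1 + icost e2 + rcost e:]"
| "time (PQ q x e1 e2 y e) = [:1 + icost e1 + icost e2 + icost e:]"
| "time (p1 ;; p2) = 1 + time p1 + time p2"
| "time (PIf b p1 p2) = [:1 + bcost b:] + time p1 + time p2"
| "time (PFor i l h p) = [:15:] + [:h, 1:] * ([:19:] + time p)"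

definition seti :: "name \<Rightarrow> nat \<Rightarrow> state \<Rightarrow> state" where
  "seti i k s = s\<lparr>ints := update (ints s) i 0 0 k\<rparr>"

text \<open>The state after \<open>k\<close> rounds, with the counter already advanced to
  \<open>l + k\<close>, as the compiled loop leaves it.\<close>

primrec for_iter :: "name \<Rightarrow> nat \<Rightarrow> (state \<Rightarrow> state) \<Rightarrow> nat \<Rightarrow> state \<Rightarrow> state" where
  "for_iter i l F 0 s = seti i l s"
| "for_iter i l F (Suc k) s = seti i (l + Suc k) (F (for_iter i l F k s))"

lemma update_apply: "update m x i j v y a b = (if y = x \<and> a = i \<and> b = j then v else m y a b)"
  by (simp add: update_def)

lemma update_other [simp]: "y \<noteq> x \<Longrightarrow> update m x i j v y = m y"
  by (simp add: update_def)

lemma ints_seti [simp]: "ints (seti i k s) = update (ints s) i 0 0 k"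
  and reals_seti [simp]: "reals (seti i k s) = reals s"
  by (simp_all add: seti_def)

locale oracles =
  fixes n :: nat and f c :: "nat set \<Rightarrow> real"
begin

primrec sem :: "prog \<Rightarrow> state \<Rightarrow> state" where
  "sem PSkip s = s"
| "sem (PI x e1 e2 e) s = s\<lparr>ints := update (ints s) x (ival e1 s) (ival e2 s) (ival e s)\<rparr>"
| "sem (PR x e1 e2 e) s = s\<lparr>reals := update (reals s) x (ival e1 s) (ival e2 s) (rval e s)\<rparr>"
| "sem (PQ q x e1 e2 y e) s = s\<lparr>reals := update (reals s) x (ival e1 s) (ival e2 s)
                (answer f c q (stored_set n y (ival e s) s))\<rparr>"
| "sem (p1 ;; p2) s = sem p2 (sem p1 s)"
| "sem (PIf b p1 p2) s = (if bval b s then sem p1 s else sem p2 s)"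
| "sem (PFor i l h p) s = for_iter i l (sem p) (n + h - l) s"

declare sem.simps(7) [simp del]

lemma ints_sem [simp]: "x \<notin> imods p \<Longrightarrow> ints (sem p s) x = ints s x"
proof (induction p arbitrary: s)
  case (PFor i l h p)
  have "ints (for_iter i l (sem p) k s) x = ints s x" for k
    using PFor by (induction k) auto
  then show ?case by (simp add: sem.simps)
qed auto

lemma reals_sem [simp]: "x \<notin> rmods p \<Longrightarrow> reals (sem p s) x = reals s x"
proof (induction p arbitrary: s)
  case (PFor i l h p)
  have "reals (for_iter i l (sem p) k s) x = reals s x" for k
    using PFor by (induction k) auto
  then show ?case by (simp add: sem.simps)
qed auto

lemma wf_prog_imods: "wf_prog p \<Longrightarrow> 0 \<notin> imods p"
  by (induction p) auto

text \<open>The bridge to \<open>exec\<close>: since the number of rounds of each loop is fixed on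
  entry, execution always halts and follows the function \<open>sem\<close>.\<close>

lemma exec_sem:
  assumes "wf_prog p" "ints s 0 0 0 = n"
  shows "\<exists>t \<le> poly (time p) n. exec n f c (compile p) s t (sem p s)"
  using assms
proof (induction p arbitrary: s)
  case PSkip
  show ?case using exec.Skip[of n f c s] by (intro exI[of _ 1]) simp
next
  case (PI x e1 e2 e)
  show ?case using exec.IPut[of n f c x e1 e2 e s]
    by (intro exI[of _ "1 + icost e1 + icost e2 + icost e"]) simp
next
  case (PR x e1 e2 e)
  show ?case using exec.RPut[of n f c x e1 e2 e s]
    by (intro exI[of _ "1 + icost e1 + icost e2 + rcost e"]) simp
next
  case (PQ q x e1 e2 y e)
  show ?case using exec.Query[of n f c q x e1 e2 y e s]
    by (intro exI[of _ "1 + icost e1 + icost e2 + icost e"]) simp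
next
  case (PSeq p1 p2)
  have "ints (sem p1 s) 0 0 0 = n"
    using PSeq.prems wf_prog_imods[of p1] by simp
  with PSeq.IH(1)[of s] PSeq.IH(2)[of "sem p1 s"] PSeq.prems obtain t1 t2 where "t1 \<le> poly (time p1) n" "t2 \<le> poly (time p2) n"
    "exec n f c (compile p1) s t1 (sem p1 s)" "exec n f c (compile p2) (sem p1 s) t2 (sem p2 (sem p1 s))"
    by auto
  then show ?case
    by (intro exI[of _ "1 + t1 + t2"]) (simp add: exec.Seq[simplified])
next
  case (PIf b p1 p2)
  show ?case
  proof (cases "bval b s")
    case True
    obtain t where "t \<le> poly (time p1) n" "exec n f c (compile p1) s t (sem p1 s)"
      using PIf.IH(1)[of s] PIf.prems by auto
    with True show ?thesis
      by (intro exI[of _ "1 + bcost b + t"]) (simp add: exec.Cond_True[simplified])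
  next
    case False
    obtain t where "t \<le> poly (time p2) n" "exec n f c (compile p2) s t (sem p2 s)"
      using PIf.IH(2)[of s] PIf.prems by auto
    with False show ?thesis
      by (intro exI[of _ "1 + bcost b + t"]) (simp add: exec.Cond_False[simplified])
  qed
next
  case (PFor i l h p)
  let ?b = "ILess (IV i) (IAdd (IV 0) (INum h))"
  let ?inc = "IPut i (INum 0) (INum 0) (IAdd (IV i) (INum 1))"
  let ?body = "Seq (compile p) ?inc"
  let ?T = "poly (time p) n"
  let ?K = "n + h - l"
  let ?it = "\<lambda>k. for_iter i l (sem p) k s"
  have [simp]: "i \<noteq> 0" "i \<notin> imods p" "0 \<notin> imods p"
    using PFor.prems wf_prog_imods[of p] by auto
  have n_it: "ints (?it k) 0 0 0 = n" for k
    using PFor.prems(2) by (induction k) auto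
  have i_it: "ints (?it k) i 0 0 = l + k" for k
    by (cases k) (simp_all add: update_apply)
  \<comment> \<open>Induction on the number \<open>j\<close> of rounds still to come, because
    \<open>Loop_True\<close> peels off the first round.\<close>
  have *: "\<exists>t \<le> 10 + j * (19 + ?T). exec n f c (Loop ?b ?body) (?it (?K - j)) t (?it ?K)" if "j \<le> ?K" for j
    using that
  proof (induction j)
    case 0
    have "\<not> bval ?b (?it ?K)" by (simp add: n_it i_it)
    from exec.Loop_False[OF this, of n f c ?body] show ?case
      by (intro exI[of _ "1 + bcost ?b"]) (simp)
  next
    case (Suc j)
    let ?k = "?K - Suc j"
    have k: "?K - j = Suc ?k" using Suc.prems by simp
    have b: "bval ?b (?it ?k)" using Suc.prems by (auto simp: n_it i_it)
    obtain t1 where t1: "t1 \<le> ?T" "exec n f c (compile p) (?it ?k) t1 (sem p (?it ?k))"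
      using PFor.IH[of "?it ?k"] PFor.prems n_it by auto
    have inc: "exec n f c ?inc (sem p (?it ?k)) 8 (?it (?K - j))"
    proof -
      have "ival (IAdd (IV i) (INum 1)) (sem p (?it ?k)) = l + Suc ?k" by (simp add: i_it)
      with exec.IPut[of n f c i "INum 0" "INum 0" "IAdd (IV i) (INum 1)" "sem p (?it ?k)"]
      show ?thesis unfolding k by (simp add: seti_def eval_nat_numeral)
    qed
    obtain t2 where t2: "t2 \<le> 10 + j * (19 + ?T)" "exec n f c (Loop ?b ?body) (?it (?K - j)) t2 (?it ?K)"
      using Suc by auto
    from exec.Loop_True[OF b exec.Seq[OF t1(2) inc] t2(2)] t1(1) t2(1)
    show ?case by (intro exI[of _ "1 + bcost ?b + (1 + t1 + 8) + t2"]) simp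
  qed
  obtain t where t: "t \<le> 10 + ?K * (19 + ?T)" "exec n f c (Loop ?b ?body) (?it 0) t (?it ?K)"
    using *[of ?K] by auto
  have "exec n f c (IPut i (INum 0) (INum 0) (INum l)) s 4 (?it 0)"
    using exec.IPut[of n f c i "INum 0" "INum 0" "INum l" s] by (simp add: seti_def eval_nat_numeral)
  from exec.Seq[OF this t(2)]
  have "exec n f c (compile (PFor i l h p)) s (1 + 4 + t) (sem (PFor i l h p) s)"
    by (simp add: sem.simps)
  moreover have "?K * (19 + ?T) \<le> (n + h) * (19 + ?T)" by (intro mult_right_mono) auto
  hence "1 + 4 + t \<le> poly (time (PFor i l h p)) n"
    using t(1) by (simp add: algebra_simps)
  ultimately show ?case by blast
qed

text \<open>The frame conditions come for free in every round, so \<open>I\<close> only has to speak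
  of what the body writes.\<close>

lemma sem_For_rule:
  assumes "I l (seti i l s)"
    and "\<And>k s'. l \<le> k \<Longrightarrow> k < n + h \<Longrightarrow> I k s' \<Longrightarrow> ints s' i 0 0 = k \<Longrightarrow>
      (\<And>x. x \<notin> insert i (imods p) \<Longrightarrow> ints s' x = ints s x) \<Longrightarrow>
      (\<And>x. x \<notin> rmods p \<Longrightarrow> reals s' x = reals s x) \<Longrightarrow>
      I (Suc k) (seti i (Suc k) (sem p s'))"
    and "l \<le> n + h"
  shows "I (n + h) (sem (PFor i l h p) s)"
proof -
  let ?it = "\<lambda>k. for_iter i l (sem p) k s"
  have i_it: "ints (?it k) i 0 0 = l + k" for k
    by (cases k) (simp_all add: update_apply)
  have fi: "ints (?it k) x = ints s x" if "x \<notin> insert i (imods p)" for x k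
    using that by (induction k) auto
  have fr: "reals (?it k) x = reals s x" if "x \<notin> rmods p" for x k
    using that by (induction k) auto
  have "I (l + k) (?it k)" if "k \<le> n + h - l" for k
    using that
  proof (induction k)
    case 0
    then show ?case using assms(1) by simp
  next
    case (Suc k)
    have "I (Suc (l + k)) (seti i (Suc (l + k)) (sem p (?it k)))"
      using Suc fi fr by (intro assms(2)) (auto simp: i_it)
    then show ?case by simp
  qed
  from this[of "n + h - l"] assms(3) show ?thesis by (simp add: sem.simps)
qed

end

section \<open>Base vectors and exchanges\<close>

locale submodular_fun =
  fixes n :: nat and g :: "nat set \<Rightarrow> real"
  assumes submodular: "submodular_on {1..n} g"
begin

lemma marginal_mono:
  assumes "S \<subseteq> T" "T \<subseteq> {1..n}" "a \<in> {1..n}" "a \<notin> T"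
  shows "g (insert a T) - g T \<le> g (insert a S) - g S"
proof -
  have "marginal (\<lambda>S. - g S) a S \<le> marginal (\<lambda>S. - g S) a T"
    using submodular assms unfolding submodular_on_def supermodular_on_def by blast
  then show ?thesis by (simp add: marginal_def)
qed

section \<open>Rankings and their greedy base vectors\<close>

definition ranking :: "(nat \<Rightarrow> nat) \<Rightarrow> bool" where
  "ranking R \<longleftrightarrow> inj_on R {1..n} \<and> R ` {1..n} \<subseteq> {1..n}"

definition up_to :: "(nat \<Rightarrow> nat) \<Rightarrow> nat \<Rightarrow> nat set" where
  "up_to R v = {u \<in> {1..n}. R u \<le> R v}"

definition below :: "(nat \<Rightarrow> nat) \<Rightarrow> nat \<Rightarrow> nat set" where
  "below R v = {u \<in> {1..n}. R u < R v}"

text \<open>Edmonds' greedy vertex of the base polytope of \<open>g\<close>, for the order given by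
  \<open>R\<close>.\<close>

definition base :: "(nat \<Rightarrow> nat) \<Rightarrow> nat \<Rightarrow> real" where
  "base R v = g (up_to R v) - g (below R v)"

lemma ranking_D:
  assumes "ranking R"
  shows "u \<in> {1..n} \<Longrightarrow> v \<in> {1..n} \<Longrightarrow> R u = R v \<Longrightarrow> u = v"
    and "v \<in> {1..n} \<Longrightarrow> 1 \<le> R v" "v \<in> {1..n} \<Longrightarrow> R v \<le> n"
proof -
  have i: "inj_on R {1..n}" "R ` {1..n} \<subseteq> {1..n}" using assms by (auto simp: ranking_def)
  show "u \<in> {1..n} \<Longrightarrow> v \<in> {1..n} \<Longrightarrow> R u = R v \<Longrightarrow> u = v" using i(1) by (rule inj_onD)
  have "v \<in> {1..n} \<Longrightarrow> R v \<in> {1..n}" using i(2) by blast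
  then show "v \<in> {1..n} \<Longrightarrow> 1 \<le> R v" "v \<in> {1..n} \<Longrightarrow> R v \<le> n" by simp_all
qed

lemma ranking_cong: "(\<And>v. v \<in> {1..n} \<Longrightarrow> R v = R' v) \<Longrightarrow> ranking R = ranking R'"
  unfolding ranking_def by (metis (no_types, lifting) image_cong inj_on_cong)

lemma base_cong:
  assumes "\<And>v. v \<in> {1..n} \<Longrightarrow> R v = R' v" "v \<in> {1..n}"
  shows "base R v = base R' v"
proof -
  have "up_to R v = up_to R' v" "below R v = below R' v"
    using assms unfolding up_to_def below_def by auto
  then show ?thesis by (simp add: base_def)
qed

lemma up_to_eq_insert_below:
  assumes "ranking R" "v \<in> {1..n}"
  shows "up_to R v = insert v (below R v)"
proof (intro set_eqI iffI)
  fix u assume "u \<in> up_to R v"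
  then show "u \<in> insert v (below R v)"
    using ranking_D(1)[OF assms(1) _ assms(2), of u] by (auto simp: up_to_def below_def le_less)
qed (use assms(2) in \<open>auto simp: up_to_def below_def\<close>)

text \<open>The elements of \<open>X\<close> are added in rank order. The marginal of
  \<open>v\<close> over all its predecessors is at most that over its predecessors in
  \<open>X\<close>, with equality if \<open>X\<close> is closed under predecessors.\<close>

lemma base_sum_aux:
  assumes R: "ranking R" and X: "X \<subseteq> {1..n}"
  shows "sum (base R) X \<le> g X - g {}"
    and "(\<And>u v. u \<in> {1..n} \<Longrightarrow> v \<in> X \<Longrightarrow> R u < R v \<Longrightarrow> u \<in> X) \<Longrightarrow> sum (base R) X = g X - g {}"
proof -
  let ?X = "\<lambda>k. {v \<in> X. R v \<le> k}"
  have fin: "finite X" using X finite_subset by blast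
  have *: "sum (base R) (?X k) \<le> g (?X k) - g {} \<and>
    ((\<forall>u v. u \<in> {1..n} \<longrightarrow> v \<in> X \<longrightarrow> R u < R v \<longrightarrow> u \<in> X) \<longrightarrow>
      sum (base R) (?X k) = g (?X k) - g {})" for k
  proof (induction k)
    case 0
    have "?X 0 = {}" using ranking_D(2)[OF R] X by fastforce
    then show ?case by (simp only:) simp
  next
    case (Suc k)
    show ?case
    proof (cases "\<exists>v\<in>X. R v = Suc k")
      case False
      then have "?X (Suc k) = ?X k" by (auto simp: le_Suc_eq)
      then show ?thesis using Suc by simp
    next
      case True
      then obtain v where v: "v \<in> X" "R v = Suc k" by blast
      have vn: "v \<in> {1..n}" using v X by blast
      have eq: "?X (Suc k) = insert v (?X k)"
      proof (intro set_eqI iffI)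
        fix u assume u: "u \<in> ?X (Suc k)"
        then have "u \<in> {1..n}" using X by blast
        then show "u \<in> insert v (?X k)" using u v ranking_D(1)[OF R _ vn, of u] by (auto simp: le_Suc_eq)
      qed (use v in auto)
      have vk: "v \<notin> ?X k" using v by simp
      have sm: "sum (base R) (?X (Suc k)) = base R v + sum (base R) (?X k)"
        unfolding eq using vk fin by simp
      have sub: "?X k \<subseteq> below R v" using v X by (auto simp: below_def)
      have "g (insert v (below R v)) - g (below R v) \<le> g (insert v (?X k)) - g (?X k)"
        using vn by (intro marginal_mono sub) (auto simp: below_def)
      then have le: "base R v \<le> g (?X (Suc k)) - g (?X k)"
        unfolding base_def up_to_eq_insert_below[OF R vn] eq .
      have "base R v = g (?X (Suc k)) - g (?X k)"
        if "\<forall>u v. u \<in> {1..n} \<longrightarrow> v \<in> X \<longrightarrow> R u < R v \<longrightarrow> u \<in> X"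
      proof -
        have "below R v = ?X k" using that v X by (fastforce simp: below_def)
        then show ?thesis unfolding base_def up_to_eq_insert_below[OF R vn] eq by simp
      qed
      then show ?thesis using sm le Suc by auto
    qed
  qed
  have "?X n = X" using ranking_D(3)[OF R] X by blast
  with *[of n] show "sum (base R) X \<le> g X - g {}"
    and "(\<And>u v. u \<in> {1..n} \<Longrightarrow> v \<in> X \<Longrightarrow> R u < R v \<Longrightarrow> u \<in> X) \<Longrightarrow> sum (base R) X = g X - g {}"
    by auto
qed

lemmas base_sum_le = base_sum_aux(1) and base_sum_eq = base_sum_aux(2)

lemma base_sum_total: "ranking R \<Longrightarrow> sum (base R) {1..n} = g {1..n} - g {}"
  by (rule base_sum_eq) auto

section \<open>Moving one element forward in a ranking\<close>

text \<open>Schrijver's exchange for \<open>R s < R u\<close>: \<open>u\<close> is inserted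
  immediately before \<open>s\<close>, and everything from \<open>s\<close> up to the old place of
  \<open>u\<close> moves back by one.\<close>

definition move :: "nat \<Rightarrow> nat \<Rightarrow> (nat \<Rightarrow> nat) \<Rightarrow> nat \<Rightarrow> nat" where
  "move u s R w = (if w = u then R s else if R s \<le> R w \<and> R w < R u then R w + 1 else R w)"

context
  fixes R u s
  assumes R: "ranking R" and us: "u \<in> {1..n}" "s \<in> {1..n}" "R s < R u"
begin

lemma ranking_move: "ranking (move u s R)"
  unfolding ranking_def
proof
  show "inj_on (move u s R) {1..n}"
  proof (rule inj_onI)
    fix v w
    assume vw: "v \<in> {1..n}" "w \<in> {1..n}" "move u s R v = move u s R w"
    have "R a \<noteq> R u" if "a \<in> {1..n}" "a \<noteq> u" for a
      using ranking_D(1)[OF R that(1) us(1)] that by auto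
    then have "R v = R w \<or> v = w" using vw us by (fastforce simp: move_def split: if_splits)
    then show "v = w" using ranking_D(1)[OF R] vw by blast
  qed
  show "move u s R ` {1..n} \<subseteq> {1..n}"
  proof safe
    fix v assume v: "v \<in> {1..n}"
    show "move u s R v \<in> {1..n}"
      using ranking_D(2,3)[OF R v] ranking_D(2,3)[OF R us(1)] ranking_D(2,3)[OF R us(2)]
      by (simp add: move_def)
  qed
qed

text \<open>\<open>u\<close> loses predecessors, so by diminishing marginals its entry can only
  grow; the elements it overtakes gain \<open>u\<close> as a predecessor, so theirs can only
  shrink.\<close>

lemma base_move_self: "base (move u s R) u \<ge> base R u"
proof -
  have 1: "below (move u s R) u = below R s" "below R s \<subseteq> below R u"
    using us by (auto simp: below_def move_def)
  have "g (insert u (below R u)) - g (below R u) \<le> g (insert u (below R s)) - g (below R s)"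
    using us by (intro marginal_mono 1) (auto simp: below_def)
  then show ?thesis
    unfolding base_def up_to_eq_insert_below[OF R us(1)] up_to_eq_insert_below[OF ranking_move us(1)] 1 .
qed

lemma base_move_between:
  assumes v: "v \<in> {1..n}" "R s \<le> R v" "R v < R u"
  shows "base (move u s R) v \<le> base R v"
proof -
  have 1: "below (move u s R) v = insert u (below R v)" "below R v \<subseteq> insert u (below R v)"
    using us v by (auto simp: below_def move_def)
  have "g (insert v (insert u (below R v))) - g (insert u (below R v)) \<le>
      g (insert v (below R v)) - g (below R v)"
    using us v by (intro marginal_mono 1) (auto simp: below_def)
  then show ?thesis
    unfolding base_def up_to_eq_insert_below[OF R v(1)] up_to_eq_insert_below[OF ranking_move v(1)] 1 .
qed

lemma base_move_outside:
  assumes v: "v \<in> {1..n}" "R v < R s \<or> R u < R v"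
  shows "base (move u s R) v = base R v"
proof -
  have v': "move u s R v = R v" using us v by (auto simp: move_def)
  have w: "move u s R w \<le> R v \<longleftrightarrow> R w \<le> R v" "move u s R w < R v \<longleftrightarrow> R w < R v" for w
    using us(3) v(2) unfolding move_def by (cases "w = u"; simp; linarith)+
  have "up_to (move u s R) v = up_to R v" "below (move u s R) v = below R v"
    unfolding below_def up_to_def v' w by simp_all
  then show ?thesis by (simp add: base_def)
qed

lemma base_move_sum: "(\<Sum>v\<in>{1..n}. base (move u s R) v - base R v) = 0"
  unfolding sum_subtractf base_sum_total[OF R] base_sum_total[OF ranking_move] by simp

text \<open>Only the entry of \<open>u\<close> can grow and the total is fixed, so without growth at
  \<open>u\<close> no other entry can shrink.\<close>

lemma base_move_degenerate:
  assumes "base (move u s R) u = base R u" "v \<in> {1..n}"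
  shows "base (move u s R) v = base R v"
proof -
  have le: "0 \<le> base R w - base (move u s R) w" if "w \<in> {1..n}" for w
  proof (cases "w = u")
    case False
    then have "R w \<noteq> R u" using ranking_D(1)[OF R that us(1)] by auto
    then show ?thesis using base_move_between[OF that] base_move_outside[OF that] by linarith
  qed (use assms in simp)
  have "(\<Sum>v\<in>{1..n}. base R v - base (move u s R) v) = 0"
    using base_move_sum unfolding sum_subtractf by simp
  then have "base R v - base (move u s R) v = 0"
    using sum_nonneg_eq_0_iff[of "{1..n}" "\<lambda>w. base R w - base (move u s R) w"] le assms(2) by auto
  then show ?thesis by simp
qed

end

text \<open>
  \<open>triangular R s t r \<kappa> y\<close>: the combination \<open>y\<close> of the exchange directions with coefficients \<open>\<kappa>\<close>
  vanishes at all elements of rank above \<open>r\<close>, except at \<open>t\<close>.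
\<close>

definition triangular ::
  "(nat \<Rightarrow> nat) \<Rightarrow> nat \<Rightarrow> nat \<Rightarrow> nat \<Rightarrow> (nat \<Rightarrow> real) \<Rightarrow> (nat \<Rightarrow> real) \<Rightarrow> bool" where
  "triangular R s t r \<kappa> y \<longleftrightarrow>
     (\<forall>u\<in>{1..n}. 0 \<le> \<kappa> u \<and> (\<kappa> u \<noteq> 0 \<longrightarrow> r < R u \<and> R s < R u \<and> R u \<le> R t)) \<and> \<kappa> t = 1 \<and>
     (\<forall>v\<in>{1..n}. y v = (\<Sum>u\<in>{1..n}. \<kappa> u * (base (move u s R) v - base R v))) \<and>
     (\<forall>v\<in>{1..n}. v \<noteq> t \<longrightarrow> y v \<le> 0 \<and> (R v < R s \<or> r < R v \<longrightarrow> y v = 0)) \<and> 0 < y t"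

context
  fixes R s t
  assumes R: "ranking R" and st: "s \<in> {1..n}" "t \<in> {1..n}" "R s < R t"
    and nondeg: "\<And>u. u \<in> {1..n} \<Longrightarrow> R s < R u \<Longrightarrow> R u \<le> R t \<Longrightarrow> base R u < base (move u s R) u"
begin

text \<open>The start is the direction that moves \<open>t\<close> itself, the only one among those
  considered that changes the entry at \<open>t\<close>.\<close>

lemma triangular_init:
  assumes "R t = Suc r"
    and "\<And>u. u \<in> {1..n} \<Longrightarrow> \<kappa> u = (if u = t then 1 else 0)"
    and "\<And>v. v \<in> {1..n} \<Longrightarrow> y v = base (move t s R) v - base R v"
  shows "triangular R s t r \<kappa> y"
  unfolding triangular_def
proof (intro conjI ballI impI)
  fix v assume v: "v \<in> {1..n}"
  have "(\<Sum>u\<in>{1..n}. \<kappa> u * (base (move u s R) v - base R v)) =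
      (\<Sum>u\<in>{1..n}. if u = t then base (move u s R) v - base R v else 0)"
    using assms(2) by (intro sum.cong) auto
  then show "y v = (\<Sum>u\<in>{1..n}. \<kappa> u * (base (move u s R) v - base R v))"
    using assms(3)[OF v] st by simp
  assume "v \<noteq> t"
  then have ne: "R v \<noteq> R t" using ranking_D(1)[OF R v st(2)] by auto
  show "y v \<le> 0"
    using assms(3)[OF v] base_move_between[OF R st(2,1,3) v] base_move_outside[OF R st(2,1,3) v] ne
    by linarith
  assume "R v < R s \<or> r < R v"
  with ne assms(1) show "y v = 0"
    using assms(3)[OF v] base_move_outside[OF R st(2,1,3) v] by fastforce
qed (use assms st nondeg[of t] in \<open>auto split: if_splits\<close>)

text \<open>The direction of \<open>w\<close> is positive at \<open>w\<close> and vanishes above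
  rank \<open>R w\<close>. Added with this coefficient it clears the entry at \<open>w\<close> and
  leaves alone both the entry at \<open>t\<close> and those already cleared. The coefficient is
  nonnegative because \<open>y w\<close> is at most 0.\<close>

lemma triangular_step:
  assumes tri: "triangular R s t r \<kappa> y" and w: "w \<in> {1..n}" "R w = r" and r: "R s < r" "r < R t"
    and \<kappa>': "\<And>u. u \<in> {1..n} \<Longrightarrow>
      \<kappa>' u = (if u = w then - y w / (base (move w s R) w - base R w) else \<kappa> u)"
    and y': "\<And>v. v \<in> {1..n} \<Longrightarrow> y' v = y v + \<kappa>' w * (base (move w s R) v - base R v)"
  shows "triangular R s t (r - 1) \<kappa>' y'"
  unfolding triangular_def
proof (intro conjI ballI impI)
  let ?D = "\<lambda>u v. base (move u s R) v - base R v"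
  have wt: "w \<noteq> t" and sw: "R s < R w" using w r by auto
  have pos: "0 < ?D w w" using nondeg[of w] w r by simp
  have yw: "y w \<le> 0" using tri w wt by (auto simp: triangular_def)
  have \<kappa>w0: "\<kappa> w = 0" using tri w by (auto simp: triangular_def)
  have \<kappa>w: "0 \<le> \<kappa>' w" using \<kappa>' w pos yw by (simp add: divide_nonpos_pos)
  show "\<kappa>' t = 1" using \<kappa>' st wt tri by (simp add: triangular_def)
  show "0 < y' t"
    using y'[OF st(2)] base_move_outside[OF R w(1) st(1) sw st(2)] tri r w
    by (simp add: triangular_def)
  { fix u assume u: "u \<in> {1..n}"
    show "0 \<le> \<kappa>' u" using \<kappa>w \<kappa>'[OF u] tri u by (auto simp: triangular_def)
    assume *: "\<kappa>' u \<noteq> 0"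
    have "r - 1 < R u \<and> R s < R u \<and> R u \<le> R t"
    proof (cases "u = w")
      case False
      then show ?thesis using tri u \<kappa>'[OF u] * unfolding triangular_def by fastforce
    qed (use w r in auto)
    then show "r - 1 < R u" "R s < R u" "R u \<le> R t" by auto }
  fix v assume v: "v \<in> {1..n}"
  have "(\<Sum>u\<in>{1..n}. \<kappa>' u * ?D u v) = (\<Sum>u\<in>{1..n}. \<kappa> u * ?D u v + (if u = w then \<kappa>' w * ?D w v else 0))"
    using \<kappa>' \<kappa>w0 by (intro sum.cong) auto
  also have "\<dots> = (\<Sum>u\<in>{1..n}. \<kappa> u * ?D u v) + \<kappa>' w * ?D w v"
    using w by (simp add: sum.distrib)
  finally show "y' v = (\<Sum>u\<in>{1..n}. \<kappa>' u * ?D u v)" using y'[OF v] tri v by (simp add: triangular_def)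
  assume vt: "v \<noteq> t"
  have y'w: "y' w = 0" using y'[OF w(1)] \<kappa>'[OF w(1)] pos by simp
  have y_v: "y v \<le> 0" "R v < R s \<or> r < R v \<Longrightarrow> y v = 0"
    using tri v vt unfolding triangular_def by blast+
  have ne: "v \<noteq> w \<Longrightarrow> R v \<noteq> R w" using ranking_D(1)[OF R v w(1)] by auto
  show "y' v \<le> 0"
  proof (cases "v = w")
    case False
    then have "?D w v \<le> 0"
      using base_move_between[OF R w(1) st(1) sw v] base_move_outside[OF R w(1) st(1) sw v] ne by linarith
    then show ?thesis using y'[OF v] y_v \<kappa>w by (simp add: add_nonpos_nonpos mult_nonneg_nonpos)
  qed (use y'w in simp)
  assume *: "R v < R s \<or> r - 1 < R v"
  show "y' v = 0"
  proof (cases "v = w")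
    case False
    have "R v < R s \<or> r < R v" using * ne[OF False] w(2) by linarith
    moreover from this have "base (move w s R) v = base R v"
      using base_move_outside[OF R w(1) st(1) sw v] w(2) by blast
    ultimately show ?thesis using y'[OF v] y_v(2) by simp
  qed (use y'w in simp)
qed

text \<open>Every direction is a difference of two base vectors and so has coordinate sum 0; the two
  entries that remain are therefore opposite.\<close>

lemma triangular_final:
  assumes "triangular R s t (R s) \<kappa> y" "v \<in> {1..n}"
  shows "y v = y t * ((if v = t then 1 else 0) - (if v = s then 1 else 0))"
proof -
  let ?D = "\<lambda>u v. base (move u s R) v - base R v"
  have ne: "R v \<noteq> R s" if "v \<in> {1..n}" "v \<noteq> s" for v using ranking_D(1)[OF R that(1) st(1)] that by auto
  have 0: "y v = 0" if "v \<in> {1..n}" "v \<noteq> s" "v \<noteq> t" for v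
  proof -
    have "R v < R s \<or> R s < R v" using ne[OF that(1,2)] by linarith
    then show ?thesis using assms(1) that unfolding triangular_def by blast
  qed
  have "(\<Sum>v\<in>{1..n}. y v) = (\<Sum>v\<in>{1..n}. \<Sum>u\<in>{1..n}. \<kappa> u * ?D u v)"
    using assms(1) unfolding triangular_def by (intro sum.cong) blast+
  also have "\<dots> = (\<Sum>u\<in>{1..n}. \<kappa> u * (\<Sum>v\<in>{1..n}. ?D u v))"
    by (subst sum.swap) (simp add: sum_distrib_left)
  also have "\<dots> = 0"
  proof (intro sum.neutral ballI)
    fix u assume u: "u \<in> {1..n}"
    show "\<kappa> u * (\<Sum>v\<in>{1..n}. ?D u v) = 0"
    proof (cases "\<kappa> u = 0")
      case False
      then have "R s < R u" using assms(1) u by (auto simp: triangular_def)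
      then show ?thesis using base_move_sum[OF R u st(1)] by simp
    qed simp
  qed
  finally have "(\<Sum>v\<in>{1..n}. y v) = 0" .
  moreover have "(\<Sum>v\<in>{1..n}. y v) = (\<Sum>v\<in>{s, t}. y v)"
    using st 0 by (intro sum.mono_neutral_right) auto
  moreover have "s \<noteq> t" using st by auto
  ultimately have "y s = - y t" by simp
  then show ?thesis using 0[OF assms(2)] \<open>s \<noteq> t\<close> by auto
qed

end

text \<open>\<open>r\<close> runs through numbers rather than elements; a rank without an element
  calls for no elimination.\<close>

lemma triangular_skip:
  assumes "triangular R s t r \<kappa> y" "\<And>w. w \<in> {1..n} \<Longrightarrow> R w \<noteq> r"
  shows "triangular R s t (r - 1) \<kappa> y"
proof -
  show ?thesis
  proof (cases "r = 0")
    case False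
    then have *: "r - 1 < R v \<longleftrightarrow> r < R v" if "v \<in> {1..n}" for v using assms(2)[OF that] by auto
    have tri: "\<forall>u\<in>{1..n}. 0 \<le> \<kappa> u \<and> (\<kappa> u \<noteq> 0 \<longrightarrow> r < R u \<and> R s < R u \<and> R u \<le> R t)" "\<kappa> t = 1"
      "\<forall>v\<in>{1..n}. y v = (\<Sum>u\<in>{1..n}. \<kappa> u * (base (move u s R) v - base R v))"
      "\<forall>v\<in>{1..n}. v \<noteq> t \<longrightarrow> y v \<le> 0 \<and> (R v < R s \<or> r < R v \<longrightarrow> y v = 0)" "0 < y t"
      using assms(1) unfolding triangular_def by blast+
    show ?thesis unfolding triangular_def using tri(2,3,5)
      by (intro conjI) (use tri(1,4) * in blast)+
  qed (use assms(1) in simp)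
qed

end

section \<open>Labels and termination of the push-relabel algorithm\<close>

text \<open>
  Elimination on coefficient vectors: an unused row \<open>r\<close> of \<open>C\<close> is a linear relation between the
  rows of \<open>B\<close> as far as the first \<open>k\<close> columns are concerned, and \<open>C r r = 1\<close> makes it nontrivial.
\<close>

definition null_rows ::
  "nat \<Rightarrow> (nat \<Rightarrow> nat \<Rightarrow> real) \<Rightarrow> nat \<Rightarrow> (nat \<Rightarrow> nat \<Rightarrow> real) \<Rightarrow> (nat \<Rightarrow> bool) \<Rightarrow> bool" where
  "null_rows m B k C used \<longleftrightarrow> card {r. r < m \<and> used r} \<le> k \<and>
     (\<forall>r<m. \<not> used r \<longrightarrow> C r r = 1 \<and> (\<forall>p<m. p \<noteq> r \<longrightarrow> C p r = 0) \<and>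
        (\<forall>i<k. (\<Sum>j<m. C r j * B j i) = 0))"

lemma null_rows_pivot:
  assumes "null_rows m B k C used" and p: "p < m" "\<not> used p" "L p \<noteq> 0"
    and L: "\<And>r. r < m \<Longrightarrow> L r = (\<Sum>j<m. C r j * B j k)"
    and used': "\<And>r. r < m \<Longrightarrow> used' r \<longleftrightarrow> used r \<or> r = p"
    and C': "\<And>r j. r < m \<Longrightarrow> j < m \<Longrightarrow> C' r j = (if used' r then C r j else C r j - L r / L p * C p j)"
  shows "null_rows m B (Suc k) C' used'"
  unfolding null_rows_def
proof (intro conjI allI impI)
  have inv: "card {r. r < m \<and> used r} \<le> k" "\<And>r. r < m \<Longrightarrow> \<not> used r \<Longrightarrow> C r r = 1"
    "\<And>r q. r < m \<Longrightarrow> \<not> used r \<Longrightarrow> q < m \<Longrightarrow> q \<noteq> r \<Longrightarrow> C q r = 0"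
    "\<And>r i. r < m \<Longrightarrow> \<not> used r \<Longrightarrow> i < k \<Longrightarrow> (\<Sum>j<m. C r j * B j i) = 0"
    using assms(1) unfolding null_rows_def by blast+
  have "{r. r < m \<and> used' r} = insert p {r. r < m \<and> used r}" using used' p by auto
  then show "card {r. r < m \<and> used' r} \<le> Suc k"
    using inv(1) p by (simp add: card_insert_if)
  fix r assume r: "r < m" "\<not> used' r"
  then have u: "\<not> used r" "r \<noteq> p" using used' by auto
  show "C' r r = 1" using C'[OF r(1) r(1)] r u inv p by simp
  { fix q assume "q < m" "q \<noteq> r"
    then show "C' q r = 0" using C'[OF \<open>q < m\<close> r(1)] r u inv p by simp }
  fix i assume i: "i < Suc k"
  have "(\<Sum>j<m. C' r j * B j i) = (\<Sum>j<m. C r j * B j i - L r / L p * (C p j * B j i))"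
    using C' r by (intro sum.cong) (auto simp: algebra_simps)
  also have "\<dots> = (\<Sum>j<m. C r j * B j i) - L r / L p * (\<Sum>j<m. C p j * B j i)"
    by (simp add: sum_subtractf sum_distrib_left)
  also have "\<dots> = 0"
  proof (cases "i = k")
    case True
    then show ?thesis using L[OF r(1)] L[OF p(1)] p(3) by simp
  next
    case False
    then have "i < k" using i by simp
    then show ?thesis using inv(4) r(1) u(1) p by simp
  qed
  finally show "(\<Sum>j<m. C' r j * B j i) = 0" .
qed

lemma null_rows_skip:
  assumes "null_rows m B k C used"
    and "\<And>r. r < m \<Longrightarrow> \<not> used r \<Longrightarrow> (\<Sum>j<m. C r j * B j k) = 0"
  shows "null_rows m B (Suc k) C used"
  using assms unfolding null_rows_def by (auto simp: less_Suc_eq)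

text \<open>Each column uses up at most one row, so more rows than columns leave a linear
  dependence.\<close>

lemma null_rows_unused:
  assumes "null_rows m B k C used" "k < m"
  obtains r where "r < m" "\<not> used r"
proof -
  have "{r. r < m \<and> used r} \<noteq> {..<m}"
    using assms unfolding null_rows_def by (metis card_lessThan not_le)
  then show thesis using that by blast
qed

lemma lex_less: "a < a' \<Longrightarrow> b < (Q::nat) \<Longrightarrow> a * Q + b < a' * Q + b'"
proof -
  assume "a < a'" "b < Q"
  then have "a * Q + b < Suc a * Q" by simp
  also have "\<dots> \<le> a' * Q" using \<open>a < a'\<close> by (intro mult_right_mono) auto
  finally show ?thesis by simp
qed

context submodular_fun
begin

declare One_nat_def [simp del]

section \<open>Convex combinations and distance labels\<close>

definition xval :: "(nat \<Rightarrow> real) \<Rightarrow> (nat \<Rightarrow> nat \<Rightarrow> nat) \<Rightarrow> nat \<Rightarrow> real" where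
  "xval \<omega> R v = (\<Sum>i<n+2. \<omega> i * base (R i) v)"

definition convex_comb :: "(nat \<Rightarrow> real) \<Rightarrow> (nat \<Rightarrow> nat \<Rightarrow> nat) \<Rightarrow> bool" where
  "convex_comb \<omega> R \<longleftrightarrow> (\<forall>i<n+2. 0 \<le> \<omega> i \<and> (0 < \<omega> i \<longrightarrow> ranking (R i))) \<and> (\<Sum>i<n+2. \<omega> i) = 1"

text \<open>Such labels are lower bounds for the distance from the elements with positive value.\<close>

definition labelling :: "(nat \<Rightarrow> nat) \<Rightarrow> (nat \<Rightarrow> real) \<Rightarrow> (nat \<Rightarrow> nat \<Rightarrow> nat) \<Rightarrow> bool" where
  "labelling d \<omega> R \<longleftrightarrow> convex_comb \<omega> R \<and> (\<forall>v\<in>{1..n}. d v \<le> n \<and> (0 < xval \<omega> R v \<longrightarrow> d v = 0)) \<and>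
     (\<forall>i<n+2. 0 < \<omega> i \<longrightarrow> (\<forall>u\<in>{1..n}. \<forall>v\<in>{1..n}. R i u < R i v \<longrightarrow> d v \<le> d u + 1))"

text \<open>A path visits at most \<open>n\<close> elements and has fewer than \<open>n\<close>
  arcs, so a label \<open>n\<close> means that no element with positive value leads there.\<close>

definition active :: "(nat \<Rightarrow> nat) \<Rightarrow> (nat \<Rightarrow> real) \<Rightarrow> (nat \<Rightarrow> nat \<Rightarrow> nat) \<Rightarrow> nat set" where
  "active d \<omega> R = {v \<in> {1..n}. xval \<omega> R v < 0 \<and> d v < n}"

text \<open>\<open>x\<close> inherits membership in the base polytope from its vectors; a set that
  is an initial segment of every ranking with positive weight is tight for all of them, hence for
  \<open>x\<close>.\<close>

lemma convex_comb_sum: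
  assumes "convex_comb \<omega> R" "Y \<subseteq> {1..n}"
  shows "(\<Sum>v\<in>Y. xval \<omega> R v) \<le> g Y - g {}"
    and "(\<And>i u v. i < n + 2 \<Longrightarrow> 0 < \<omega> i \<Longrightarrow> u \<in> {1..n} \<Longrightarrow> v \<in> Y \<Longrightarrow> R i u < R i v \<Longrightarrow> u \<in> Y) \<Longrightarrow>
      (\<Sum>v\<in>Y. xval \<omega> R v) = g Y - g {}"
proof -
  have eq: "(\<Sum>v\<in>Y. xval \<omega> R v) = (\<Sum>i<n+2. \<omega> i * (\<Sum>v\<in>Y. base (R i) v))"
    unfolding xval_def sum_distrib_left by (rule sum.swap)
  have one: "(\<Sum>i<n+2. \<omega> i * (g Y - g {})) = g Y - g {}"
    using assms(1) unfolding convex_comb_def sum_distrib_right[symmetric] by simp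
  have nn: "0 \<le> \<omega> i" "0 < \<omega> i \<Longrightarrow> ranking (R i)" if "i < n + 2" for i
    using assms(1) that unfolding convex_comb_def by blast+
  have "(\<Sum>i<n+2. \<omega> i * (\<Sum>v\<in>Y. base (R i) v)) \<le> (\<Sum>i<n+2. \<omega> i * (g Y - g {}))"
  proof (intro sum_mono)
    fix i assume "i \<in> {..<n+2}"
    then show "\<omega> i * (\<Sum>v\<in>Y. base (R i) v) \<le> \<omega> i * (g Y - g {})"
      using nn[of i] base_sum_le[OF _ assms(2), of "R i"] by (cases "\<omega> i = 0") (auto intro: mult_left_mono)
  qed
  then show "(\<Sum>v\<in>Y. xval \<omega> R v) \<le> g Y - g {}" using eq one by simp
  assume cl: "\<And>i u v. i < n + 2 \<Longrightarrow> 0 < \<omega> i \<Longrightarrow> u \<in> {1..n} \<Longrightarrow> v \<in> Y \<Longrightarrow> R i u < R i v \<Longrightarrow> u \<in> Y"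
  have "(\<Sum>i<n+2. \<omega> i * (\<Sum>v\<in>Y. base (R i) v)) = (\<Sum>i<n+2. \<omega> i * (g Y - g {}))"
  proof (intro sum.cong refl)
    fix i assume i: "i \<in> {..<n+2}"
    show "\<omega> i * (\<Sum>v\<in>Y. base (R i) v) = \<omega> i * (g Y - g {})"
    proof (cases "\<omega> i = 0")
      case False
      then have "0 < \<omega> i" using nn[of i] i by simp
      then show ?thesis using base_sum_eq[of "R i", OF _ assms(2) cl[of i]] nn(2)[of i] i by simp
    qed simp
  qed
  then show "(\<Sum>v\<in>Y. xval \<omega> R v) = g Y - g {}" using eq one by simp
qed

text \<open>
  An empty label class separates the elements labelled \<open>n\<close> from those with positive \<open>x\<close>-value:
  the labels have \<open>n + 1\<close> possible values and there are only \<open>n\<close> elements.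
\<close>

lemma minimizer_level_set:
  assumes lab: "labelling d \<omega> R" and act: "active d \<omega> R = {}"
  shows "\<exists>l\<le>n. \<forall>Y\<subseteq>{1..n}. g {v \<in> {1..n}. l < d v} \<le> g Y"
proof -
  let ?x = "xval \<omega> R"
  have cc: "convex_comb \<omega> R" and dn: "\<And>v. v \<in> {1..n} \<Longrightarrow> d v \<le> n"
    and pos: "\<And>v. v \<in> {1..n} \<Longrightarrow> 0 < ?x v \<Longrightarrow> d v = 0"
    and arc: "\<And>i u v. i < n + 2 \<Longrightarrow> 0 < \<omega> i \<Longrightarrow> u \<in> {1..n} \<Longrightarrow> v \<in> {1..n} \<Longrightarrow> R i u < R i v \<Longrightarrow> d v \<le> d u + 1"
    using lab unfolding labelling_def by blast+
  have neg: "d v = n" if "v \<in> {1..n}" "?x v < 0" for v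
    using act that dn[OF that(1)] unfolding active_def by fastforce
  show ?thesis
  proof (cases "\<exists>v\<in>{1..n}. ?x v < 0")
    \<comment> \<open>Without negative values the empty set is a minimizer; it is the level set for
      \<open>l = n\<close>.\<close>
    case False
    have *: "{v \<in> {1..n}. n < d v} = {}" using dn by fastforce
    have "g {} \<le> g Y" if "Y \<subseteq> {1..n}" for Y
    proof -
      have "0 \<le> (\<Sum>v\<in>Y. ?x v)" using False that by (intro sum_nonneg) (meson not_le subsetD)
      then show ?thesis using convex_comb_sum(1)[OF cc that] by simp
    qed
    then show ?thesis by (intro exI[of _ n] conjI allI impI) (simp_all only: * order_refl)
  next
    case True
    then have nd: "n \<in> d ` {1..n}" using neg by force
    have "card (d ` {1..n}) \<le> n" using card_image_le[of "{1..n}" d] by simp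
    then have "\<not> {0..n} \<subseteq> d ` {1..n}"
      using card_mono[of "d ` {1..n}" "{0..n}"] by fastforce
    then obtain l where l: "l \<le> n" "l \<notin> d ` {1..n}"
      unfolding subset_iff atLeastAtMost_iff[of _ 0] by blast
    then have ln: "l < n" using nd by (cases "l = n") auto
    let ?X = "{v \<in> {1..n}. l < d v}"
    have X: "?X \<subseteq> {1..n}" by blast
    \<comment> \<open>An arc raises the label by at most 1 and no label equals \<open>l\<close>, so
      predecessors of elements of \<open>?X\<close> stay in \<open>?X\<close>, which makes it
      tight.\<close>
    have eq: "(\<Sum>v\<in>?X. ?x v) = g ?X - g {}"
    proof (rule convex_comb_sum(2)[OF cc X])
      fix i u v assume *: "i < n + 2" "0 < \<omega> i" "u \<in> {1..n}" "v \<in> ?X" "R i u < R i v"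
      then have "l < d u + 1" using arc[of i u v] by auto
      moreover have "d u \<noteq> l" using l * by blast
      ultimately show "u \<in> ?X" using * by simp
    qed
    \<comment> \<open>Positive values occur only outside \<open>?X\<close> and negative ones only
      inside, so \<open>?X\<close> minimizes \<open>x\<close>; tightness carries this over to
      \<open>g\<close>.\<close>
    have "g ?X \<le> g Y" if Y: "Y \<subseteq> {1..n}" for Y
    proof -
      have fin: "finite Y" "finite ?X" using Y finite_subset by auto
      have "(\<Sum>v\<in>?X. ?x v) = (\<Sum>v\<in>?X \<inter> Y. ?x v) + (\<Sum>v\<in>?X - Y. ?x v)"
        using fin by (simp add: sum.Int_Diff)
      also have "(\<Sum>v\<in>?X - Y. ?x v) \<le> 0"
      proof (rule sum_nonpos)
        fix v assume "v \<in> ?X - Y"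
        then show "?x v \<le> 0" using pos[of v] by fastforce
      qed
      also have "(\<Sum>v\<in>?X \<inter> Y. ?x v) + 0 \<le> (\<Sum>v\<in>Y. ?x v)"
      proof -
        have "(\<Sum>v\<in>?X \<inter> Y. ?x v) \<le> (\<Sum>v\<in>Y. ?x v)"
        proof (rule sum_mono2[OF fin(1)])
          fix v assume "v \<in> Y - ?X \<inter> Y"
          then show "0 \<le> ?x v" using neg[of v] ln Y by (cases "?x v < 0") auto
        qed auto
        then show ?thesis by simp
      qed
      finally have "(\<Sum>v\<in>?X. ?x v) \<le> (\<Sum>v\<in>Y. ?x v)" by simp
      then show ?thesis using eq convex_comb_sum(1)[OF cc Y] by simp
    qed
    then show ?thesis using l(1) by blast
  qed
qed

section \<open>The termination measure\<close>

text \<open>Encodes the lexicographic order by label, then by index; as \<open>v \<le> n\<close>,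
  the element is recovered modulo \<open>n + 1\<close>.\<close>

definition key :: "(nat \<Rightarrow> nat) \<Rightarrow> nat \<Rightarrow> nat" where
  "key d v = d v * (n + 1) + v"

text \<open>The admissible arcs of push-relabel into \<open>t\<close>: those on which the label
  rises by exactly 1.\<close>

definition tails :: "(nat \<Rightarrow> nat) \<Rightarrow> (nat \<Rightarrow> real) \<Rightarrow> (nat \<Rightarrow> nat \<Rightarrow> nat) \<Rightarrow> nat \<Rightarrow> nat set" where
  "tails d \<omega> R t = {v \<in> {1..n}. d v + 1 = d t \<and> (\<exists>i<n+2. 0 < \<omega> i \<and> R i v < R i t)}"

text \<open>The inserted 0 stands for an empty set; genuine keys and elements are positive.\<close>

definition max_key :: "(nat \<Rightarrow> nat) \<Rightarrow> (nat \<Rightarrow> real) \<Rightarrow> (nat \<Rightarrow> nat \<Rightarrow> nat) \<Rightarrow> nat" where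
  "max_key d \<omega> R = Max (insert 0 (key d ` active d \<omega> R))"

definition max_tail :: "(nat \<Rightarrow> nat) \<Rightarrow> (nat \<Rightarrow> real) \<Rightarrow> (nat \<Rightarrow> nat \<Rightarrow> nat) \<Rightarrow> nat \<Rightarrow> nat" where
  "max_tail d \<omega> R t = Max (insert 0 (tails d \<omega> R t))"

text \<open>The bound \<open>k \<le> n\<close>, satisfied by all gaps of rankings, makes the set
  visibly finite; truncated subtraction turns reversed pairs into 0.\<close>

definition max_gap :: "(nat \<Rightarrow> real) \<Rightarrow> (nat \<Rightarrow> nat \<Rightarrow> nat) \<Rightarrow> nat \<Rightarrow> nat \<Rightarrow> nat" where
  "max_gap \<omega> R t s = Max (insert 0 {k. k \<le> n \<and> (\<exists>i<n+2. 0 < \<omega> i \<and> k = R i t - R i s)})"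

definition gap_count :: "(nat \<Rightarrow> real) \<Rightarrow> (nat \<Rightarrow> nat \<Rightarrow> nat) \<Rightarrow> nat \<Rightarrow> nat \<Rightarrow> nat \<Rightarrow> nat" where
  "gap_count \<omega> R t s k = card {i. i < n + 2 \<and> 0 < \<omega> i \<and> R i t - R i s = k}"

text \<open>
  A lexicographic measure, written in base \<open>(n + 3)\<^sup>2\<close>.  The selected \<open>t\<close> is the maximal key modulo
  \<open>n + 1\<close>; if no element is active, the last three digits carry no meaning.
\<close>

definition potential :: "(nat \<Rightarrow> nat) \<Rightarrow> (nat \<Rightarrow> real) \<Rightarrow> (nat \<Rightarrow> nat \<Rightarrow> nat) \<Rightarrow> nat" where
  "potential d \<omega> R = (let Q = (n + 3)\<^sup>2; m = max_key d \<omega> R; t = m mod (n + 1);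
       s = max_tail d \<omega> R t; k = max_gap \<omega> R t s in
     ((((\<Sum>v\<in>{1..n}. n - d v) * Q + m) * Q + s) * Q + k) * Q + gap_count \<omega> R t s k)"

lemma finite_active [simp]: "finite (active d \<omega> R)"
  unfolding active_def by simp

lemma finite_tails [simp]: "finite (tails d \<omega> R t)"
  unfolding tails_def by simp

lemma key_mod: "v \<in> {1..n} \<Longrightarrow> key d v mod (n + 1) = v"
  unfolding key_def by simp

lemma key_le:
  assumes "v \<in> {1..n}" "d v < d t \<or> d v = d t \<and> v \<le> t"
  shows "key d v \<le> key d t" "d v < d t \<Longrightarrow> key d v < key d t"
proof -
  show *: "key d v < key d t" if "d v < d t"
    unfolding key_def using that assms(1) by (intro lex_less) auto
  show "key d v \<le> key d t" using * assms(2) by (auto simp: key_def)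
qed

lemma max_key_eq:
  assumes "t \<in> active d \<omega> R" "\<And>v. v \<in> active d \<omega> R \<Longrightarrow> d v < d t \<or> d v = d t \<and> v \<le> t"
  shows "max_key d \<omega> R = key d t" "max_key d \<omega> R mod (n + 1) = t"
proof -
  show 1: "max_key d \<omega> R = key d t"
    unfolding max_key_def using assms key_le(1)[of _ d t] by (intro Max_eqI) (auto simp: active_def)
  show "max_key d \<omega> R mod (n + 1) = t"
    unfolding 1 using assms(1) by (intro key_mod) (simp add: active_def)
qed

lemma digit_bounds:
  shows "max_key d \<omega> R < (n + 3)\<^sup>2" "max_tail d \<omega> R t < (n + 3)\<^sup>2"
    "max_gap \<omega> R t s < (n + 3)\<^sup>2" "gap_count \<omega> R t s k < (n + 3)\<^sup>2" "(\<Sum>v\<in>{1..n}. n - d v) < (n + 3)\<^sup>2"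
proof -
  have n: "n < (n + 3)\<^sup>2" "n + 2 < (n + 3)\<^sup>2" "n * n < (n + 3)\<^sup>2" "n * (n + 1) + n < (n + 3)\<^sup>2"
    by (simp_all add: power2_eq_square algebra_simps)
  have "key d v \<le> n * (n + 1) + n" if "v \<in> active d \<omega> R" for v
  proof -
    have "d v * (n + 1) \<le> n * (n + 1)" "v \<le> n" using that by (auto simp: active_def intro!: mult_right_mono)
    then show ?thesis unfolding key_def by (rule add_mono)
  qed
  then have "max_key d \<omega> R \<le> n * (n + 1) + n" unfolding max_key_def by (intro Max.boundedI) auto
  with n show "max_key d \<omega> R < (n + 3)\<^sup>2" by linarith
  have "max_tail d \<omega> R t \<le> n" unfolding max_tail_def by (intro Max.boundedI) (auto simp: tails_def)
  with n show "max_tail d \<omega> R t < (n + 3)\<^sup>2" by linarith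
  have "max_gap \<omega> R t s \<le> n" unfolding max_gap_def by (intro Max.boundedI) auto
  with n show "max_gap \<omega> R t s < (n + 3)\<^sup>2" by linarith
  have "gap_count \<omega> R t s k \<le> card {..<n + 2}" unfolding gap_count_def by (intro card_mono) auto
  with n show "gap_count \<omega> R t s k < (n + 3)\<^sup>2" by simp
  have "(\<Sum>v\<in>{1..n}. n - d v) \<le> of_nat (card {1..n}) * n" by (intro sum_bounded_above) auto
  with n show "(\<Sum>v\<in>{1..n}. n - d v) < (n + 3)\<^sup>2" by simp
qed

text \<open>Five digits in base \<open>(n + 3)\<^sup>2\<close>; the exponent 10 returns as the
  nesting depth in \<open>p_sfm\<close>.\<close>

lemma potential_bound: "potential d \<omega> R < (n + 3) ^ 10"
proof -
  let ?Q = "(n + 3)\<^sup>2"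
  have step: "a * ?Q + b < Q' * ?Q" if "a < Q'" "b < ?Q" for a b Q' :: nat
    using lex_less[OF that, of 0] by simp
  have "potential d \<omega> R < ?Q * ?Q * ?Q * ?Q * ?Q"
    unfolding potential_def Let_def by (intro step digit_bounds)
  also have "\<dots> = (n + 3) ^ 10" by (simp flip: power_add power_mult)
  finally show ?thesis .
qed

lemma potential_less:
  assumes "t = max_key d \<omega> R mod (n + 1)" "s = max_tail d \<omega> R t" "k = max_gap \<omega> R t s"
    "t' = max_key d' \<omega>' R' mod (n + 1)" "s' = max_tail d' \<omega>' R' t'" "k' = max_gap \<omega>' R' t' s'"
    and sum: "(\<Sum>v\<in>{1..n}. n - d' v) \<le> (\<Sum>v\<in>{1..n}. n - d v)"
    and "(\<Sum>v\<in>{1..n}. n - d' v) = (\<Sum>v\<in>{1..n}. n - d v) \<Longrightarrow> max_key d' \<omega>' R' < max_key d \<omega> R \<or>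
      max_key d' \<omega>' R' = max_key d \<omega> R \<and> (s' < s \<or> s' = s \<and> (k' < k \<or> k' = k \<and>
        gap_count \<omega>' R' t' s' k' < gap_count \<omega> R t s k))"
  shows "potential d' \<omega>' R' < potential d \<omega> R"
proof -
  let ?Q = "(n + 3)\<^sup>2"
  let ?m = "\<Sum>v\<in>{1..n}. n - d v" and ?m' = "\<Sum>v\<in>{1..n}. n - d' v"
  note b = digit_bounds
  have lt: "s' < ?Q" "k' < ?Q" "gap_count \<omega>' R' t' s' k' < ?Q" "max_key d' \<omega>' R' < ?Q"
    unfolding assms(5,6) by (rule b)+
  consider "?m' < ?m" | "?m' = ?m" "max_key d' \<omega>' R' < max_key d \<omega> R"
    | "?m' = ?m" "max_key d' \<omega>' R' = max_key d \<omega> R" "s' < s"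
    | "?m' = ?m" "max_key d' \<omega>' R' = max_key d \<omega> R" "s' = s" "k' < k"
    | "?m' = ?m" "max_key d' \<omega>' R' = max_key d \<omega> R" "s' = s" "k' = k"
      "gap_count \<omega>' R' t' s' k' < gap_count \<omega> R t s k"
    using sum assms(8) by (meson le_neq_implies_less)
  then have "(((?m' * ?Q + max_key d' \<omega>' R') * ?Q + s') * ?Q + k') * ?Q + gap_count \<omega>' R' t' s' k'
      < (((?m * ?Q + max_key d \<omega> R) * ?Q + s) * ?Q + k) * ?Q + gap_count \<omega> R t s k"
  proof cases
    case 1
    then show ?thesis by (intro lex_less lt)
  next
    case 2
    show ?thesis using 2 by (intro lex_less[OF lex_less[OF lex_less[OF _ lt(1)] lt(2)] lt(3)]) simp
  next
    case 3
    show ?thesis using 3 by (intro lex_less[OF lex_less[OF _ lt(2)] lt(3)]) simp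
  next
    case 4
    show ?thesis using 4 by (intro lex_less[OF _ lt(3)]) simp
  next
    case 5
    show ?thesis using 5 by simp
  qed
  then show ?thesis unfolding potential_def Let_def assms(1-6)[symmetric] .
qed

section \<open>Relabelling and pushing\<close>

text \<open>No admissible arc enters \<open>t\<close>, so every arc into \<open>t\<close> tolerates
  one more unit, and the leading digit of the measure drops.\<close>

lemma relabel:
  assumes lab: "labelling d \<omega> R" and t: "t \<in> active d \<omega> R" and "tails d \<omega> R t = {}"
    and d': "d' = d(t := d t + 1)"
  shows "labelling d' \<omega> R" "potential d' \<omega> R < potential d \<omega> R"
proof -
  have tn: "t \<in> {1..n}" "d t < n" "xval \<omega> R t < 0" using t by (auto simp: active_def)
  show "labelling d' \<omega> R"
    unfolding labelling_def
  proof (intro conjI ballI allI impI)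
    fix v assume v: "v \<in> {1..n}"
    show "d' v \<le> n" using lab v tn unfolding labelling_def d' by auto
    assume "0 < xval \<omega> R v"
    then show "d' v = 0" using lab v tn unfolding labelling_def d' by auto
  next
    fix i u v assume *: "i < n + 2" "0 < \<omega> i" "u \<in> {1..n}" "v \<in> {1..n}" "R i u < R i v"
    have "d v \<le> d u + 1" using lab * unfolding labelling_def by blast
    moreover have "d u + 1 \<noteq> d t" if "v = t" using assms(3) * that unfolding tails_def by blast
    moreover have "u \<noteq> v" using * by auto
    ultimately show "d' v \<le> d' u + 1" unfolding d' by (auto simp: le_less)
  qed (use lab in \<open>simp add: labelling_def\<close>)
  have "(\<Sum>v\<in>{1..n}. n - d' v) < (\<Sum>v\<in>{1..n}. n - d v)"
    using tn unfolding d' by (intro sum_strict_mono_ex1) (auto intro!: bexI[of _ t])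
  then show "potential d' \<omega> R < potential d \<omega> R" by (intro potential_less) auto
qed

lemma max_gapI:
  assumes "convex_comb \<omega> R" "t \<in> {1..n}" "i < n + 2" "0 < \<omega> i"
    and "\<And>j. j < n + 2 \<Longrightarrow> 0 < \<omega> j \<Longrightarrow> R j t - R j s \<le> R i t - R i s"
  shows "max_gap \<omega> R t s = R i t - R i s"
  unfolding max_gap_def
proof (intro Max_eqI)
  have "ranking (R i)" using assms unfolding convex_comb_def by blast
  then have "R i t \<le> n" using ranking_D(3) assms(2) by blast
  then show "R i t - R i s \<in> insert 0 {k. k \<le> n \<and> (\<exists>i<n+2. 0 < \<omega> i \<and> k = R i t - R i s)}"
    using assms(3,4) by auto
qed (use assms(5) in auto)

text \<open>A new ranking reverses only pairs in which \<open>u\<close> overtakes some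
  \<open>b\<close> at or behind \<open>s\<close>, and then
  \<open>d b \<le> d s + 1 = d t \<le> d u + 1\<close>. The top key cannot rise, since
  \<open>s\<close> has a smaller label than \<open>t\<close>. If it stays, \<open>t\<close> is still
  negative, so slot \<open>i\<close> has given up its old ranking. No new tails arise, and if
  \<open>s\<close> remains the largest one, all moved rankings have a smaller gap between
  \<open>s\<close> and \<open>t\<close> than slot \<open>i\<close> had: either the maximal gap falls
  or fewer slots attain it.\<close>

lemma push:
  assumes lab: "labelling d \<omega> R" and t: "t \<in> active d \<omega> R"
    and tmax: "\<And>v. v \<in> active d \<omega> R \<Longrightarrow> d v < d t \<or> d v = d t \<and> v \<le> t"
    and s: "s \<in> tails d \<omega> R t" and smax: "\<And>v. v \<in> tails d \<omega> R t \<Longrightarrow> v \<le> s"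
    and i: "i < n + 2" "0 < \<omega> i" "R i s < R i t"
    and imax: "\<And>j. j < n + 2 \<Longrightarrow> 0 < \<omega> j \<Longrightarrow> R j t - R j s \<le> R i t - R i s"
    and nn: "\<And>j. j < n + 2 \<Longrightarrow> 0 \<le> \<omega>' j" and one: "(\<Sum>j<n+2. \<omega>' j) = 1"
    and new: "\<And>j. j < n + 2 \<Longrightarrow> 0 < \<omega>' j \<Longrightarrow>
      0 < \<omega> j \<and> (j = i \<longrightarrow> 0 \<le> xval \<omega>' R' t) \<and> (\<forall>v\<in>{1..n}. R' j v = R j v) \<or>
      (\<exists>u\<in>{1..n}. R i s < R i u \<and> R i u \<le> R i t \<and> (\<forall>v\<in>{1..n}. R' j v = move u s (R i) v))"
    and x': "\<And>v. v \<in> {1..n} \<Longrightarrow>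
      xval \<omega>' R' v = xval \<omega> R v + \<epsilon> * ((if v = t then 1 else 0) - (if v = s then 1 else 0))"
    and eps: "0 \<le> \<epsilon>" and x't: "xval \<omega>' R' t \<le> 0"
  shows "labelling d \<omega>' R'" "potential d \<omega>' R' < potential d \<omega> R"
proof -
  have cc: "convex_comb \<omega> R" and pos: "\<And>v. v \<in> {1..n} \<Longrightarrow> 0 < xval \<omega> R v \<Longrightarrow> d v = 0"
    and dn: "\<And>v. v \<in> {1..n} \<Longrightarrow> d v \<le> n"
    and arc: "\<And>i u v. i < n + 2 \<Longrightarrow> 0 < \<omega> i \<Longrightarrow> u \<in> {1..n} \<Longrightarrow> v \<in> {1..n} \<Longrightarrow> R i u < R i v \<Longrightarrow> d v \<le> d u + 1"
    using lab unfolding labelling_def by blast+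
  have tn: "t \<in> {1..n}" "d t < n" and sn: "s \<in> {1..n}" "d s + 1 = d t"
    using t s by (auto simp: active_def tails_def)
  have st: "s \<noteq> t" using sn by auto
  have Ri: "ranking (R i)" using cc i unfolding convex_comb_def by blast
  have Reqs: "R i u = R i v \<Longrightarrow> u = v" if "u \<in> {1..n}" "v \<in> {1..n}" for u v
    using ranking_D(1)[OF Ri that] .
  have cases' [consumes 2, case_names 1 2]: thesis
    if "j < n + 2" "0 < \<omega>' j"
      and "0 < \<omega> j \<Longrightarrow> (j = i \<Longrightarrow> 0 \<le> xval \<omega>' R' t) \<Longrightarrow> (\<And>v. v \<in> {1..n} \<Longrightarrow> R' j v = R j v) \<Longrightarrow> thesis"
      and "\<And>u. u \<in> {1..n} \<Longrightarrow> R i s < R i u \<Longrightarrow> R i u \<le> R i t \<Longrightarrow>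
        (\<And>v. v \<in> {1..n} \<Longrightarrow> R' j v = move u s (R i) v) \<Longrightarrow> thesis" for j thesis
    using new[OF that(1,2)] that(3,4) by blast
  show "labelling d \<omega>' R'"
    unfolding labelling_def
  proof (intro conjI ballI allI impI)
    show "convex_comb \<omega>' R'"
      unfolding convex_comb_def
    proof (intro conjI allI impI one nn)
      fix j assume j: "j < n + 2" "0 < \<omega>' j"
      from j show "ranking (R' j)"
      proof (cases rule: cases')
        case 1
        have "ranking (R j)" using cc j 1 unfolding convex_comb_def by blast
        then show ?thesis using ranking_cong[of "R' j" "R j"] 1 by blast
      next
        case (2 u)
        show ?thesis using ranking_cong[of "R' j" "move u s (R i)"] 2 ranking_move[OF Ri _ sn(1)] by blast
      qed
    qed
  next
    fix v assume v: "v \<in> {1..n}"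
    show "d v \<le> n" using dn[OF v] .
    assume "0 < xval \<omega>' R' v"
    then show "d v = 0" using x'[OF v] x't pos[OF v] eps by (cases "v = t"; cases "v = s") auto
  next
    fix j a b assume j: "j < n + 2" "0 < \<omega>' j" and ab: "a \<in> {1..n}" "b \<in> {1..n}" "R' j a < R' j b"
    from j show "d b \<le> d a + 1"
    proof (cases rule: cases')
      case 1
      then show ?thesis using arc[of j a b] j ab by simp
    next
      case (2 u)
      show ?thesis
      proof (cases "R i a < R i b")
        case True
        then show ?thesis using arc[of i a b] i ab by simp
      next
        case False
        have mv: "move u s (R i) a < move u s (R i) b" using ab 2(4) by simp
        then have au: "a = u" and sb: "R i s \<le> R i b"
          using False 2(2) by (auto simp: move_def split: if_splits)
        have "d b \<le> d s + 1"
          using sb Reqs[of s b] arc[of i s b] i ab sn by (cases "R i s = R i b") auto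
        moreover have "d t \<le> d u + 1"
          using 2 Reqs[of u t] arc[of i u t] i tn by (cases "R i u = R i t") auto
        ultimately show ?thesis using sn au by simp
      qed
    qed
  qed
  let ?t' = "max_key d \<omega>' R' mod (n + 1)"
  let ?s' = "max_tail d \<omega>' R' ?t'"
  have mk: "max_key d \<omega> R = key d t" "max_key d \<omega> R mod (n + 1) = t"
    using max_key_eq[OF t tmax] by auto
  have mt: "max_tail d \<omega> R t = s"
    unfolding max_tail_def using s smax by (intro Max_eqI) auto
  have mg: "max_gap \<omega> R t s = R i t - R i s"
    using max_gapI[OF cc tn(1) i(1,2) imax] .
  have keys: "key d v \<le> key d t" if "v \<in> active d \<omega>' R'" for v
  proof (cases "v = s")
    case True
    then show ?thesis using key_le(2)[OF sn(1), of d t] sn by auto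
  next
    case False
    have "v \<in> active d \<omega> R" using that x'[of v] eps False t unfolding active_def by (cases "v = t") auto
    then show ?thesis using key_le(1) tmax unfolding active_def by blast
  qed
  have mk': "max_key d \<omega>' R' \<le> key d t"
    unfolding max_key_def using keys by (intro Max.boundedI) auto
  show "potential d \<omega>' R' < potential d \<omega> R"
  proof (cases "max_key d \<omega>' R' = key d t")
    case False
    then show ?thesis using mk mk' by (intro potential_less refl) auto
  next
    case True
    then have t': "?t' = t" using key_mod[OF tn(1)] by simp
    have "max_key d \<omega>' R' \<in> insert 0 (key d ` active d \<omega>' R')"
      unfolding max_key_def by (intro Max_in) auto
    moreover have "key d t \<noteq> 0" using tn unfolding key_def by simp
    ultimately obtain v where v: "v \<in> active d \<omega>' R'" "key d t = key d v" using True by auto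
    then have "v = t" using key_mod[of v d] key_mod[OF tn(1), of d] by (simp add: active_def)
    then have x't0: "xval \<omega>' R' t < 0" using v by (simp add: active_def)
    \<comment> \<open>A moved \<open>u\<close> lies at or before \<open>t\<close> already, so
      nothing behind \<open>t\<close> in \<open>R i\<close> can come to precede it.\<close>
    have "tails d \<omega>' R' t \<subseteq> tails d \<omega> R t"
    proof
      fix v assume "v \<in> tails d \<omega>' R' t"
      then obtain j where v: "v \<in> {1..n}" "d v + 1 = d t" and j: "j < n + 2" "0 < \<omega>' j" "R' j v < R' j t"
        by (auto simp: tails_def)
      from j(1,2) show "v \<in> tails d \<omega> R t"
      proof (cases rule: cases')
        case 1
        then show ?thesis using v j tn by (auto simp: tails_def)
      next
        case (2 u)
        then have "move u s (R i) v < move u s (R i) t" using v j tn by simp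
        moreover have "R i u < R i t" if "t \<noteq> u" using 2(1,3) Reqs[of u t] tn(1) that by (auto simp: le_less)
        ultimately have "R i v < R i t" using 2(2) i(3) by (auto simp: move_def split: if_splits)
        then show ?thesis using v i by (auto simp: tails_def)
      qed
    qed
    then have "max_tail d \<omega>' R' t \<le> s"
      unfolding max_tail_def using smax by (intro Max.boundedI) auto
    then consider "?s' < s" | "?s' = s" unfolding t' by linarith
    then show ?thesis
    proof cases
      case 1
      then show ?thesis using mk mt True by (intro potential_less refl) auto
    next
      case 2
      have gap: "R' j t - R' j s \<le> R i t - R i s"
        "R' j t - R' j s = R i t - R i s \<Longrightarrow> 0 < \<omega> j \<and> R j t - R j s = R i t - R i s \<and> j \<noteq> i"
        if j: "j < n + 2" "0 < \<omega>' j" for j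
      proof -
        have "R' j t - R' j s \<le> R i t - R i s \<and>
          (R' j t - R' j s = R i t - R i s \<longrightarrow> 0 < \<omega> j \<and> R j t - R j s = R i t - R i s \<and> j \<noteq> i)"
          using j
        proof (cases rule: cases')
          case 1
          then show ?thesis using imax[OF j(1)] x't0 tn sn by auto
        next
          case (2 u)
          have "move u s (R i) t - move u s (R i) s < R i t - R i s"
            using 2 i Reqs[of u t] tn by (auto simp: move_def)
          then show ?thesis using 2 tn sn by simp
        qed
        then show "R' j t - R' j s \<le> R i t - R i s"
          "R' j t - R' j s = R i t - R i s \<Longrightarrow> 0 < \<omega> j \<and> R j t - R j s = R i t - R i s \<and> j \<noteq> i"
          by blast+
      qed
      have "max_gap \<omega>' R' t s \<le> R i t - R i s"
        unfolding max_gap_def using gap(1) by (intro Max.boundedI) auto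
      moreover have "gap_count \<omega>' R' t s (R i t - R i s) < gap_count \<omega> R t s (R i t - R i s)"
        unfolding gap_count_def
      proof (intro psubset_card_mono psubsetI)
        show "{j. j < n + 2 \<and> 0 < \<omega>' j \<and> R' j t - R' j s = R i t - R i s} \<subseteq>
          {j. j < n + 2 \<and> 0 < \<omega> j \<and> R j t - R j s = R i t - R i s}" using gap(2) by auto
        have "i \<in> {j. j < n + 2 \<and> 0 < \<omega> j \<and> R j t - R j s = R i t - R i s}" using i by auto
        then show "{j. j < n + 2 \<and> 0 < \<omega>' j \<and> R' j t - R' j s = R i t - R i s} \<noteq>
          {j. j < n + 2 \<and> 0 < \<omega> j \<and> R j t - R j s = R i t - R i s}" using gap(2)[of i] by auto
      qed auto
      ultimately show ?thesis
        using mk mt mg t' 2 True by (intro potential_less refl) (auto simp: le_less)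
    qed
  qed
qed

end

section \<open>Breakpoints of the agent's utility\<close>

text \<open>The elements of \<open>S - T\<close> are added one by one both to
  \<open>S \<inter> T\<close> and to \<open>T\<close>, and the marginals are compared.\<close>

lemma supermodular_lattice:
  assumes "supermodular_on A h" "finite A" "S \<subseteq> A" "T \<subseteq> A"
  shows "h S + h T \<le> h (S \<union> T) + h (S \<inter> T)"
proof -
  have "h (S \<inter> T \<union> D) + h T \<le> h (T \<union> D) + h (S \<inter> T)" if "finite D" "D \<subseteq> S - T" for D
    using that
  proof (induction D)
    case (insert a D)
    have "S \<inter> T \<union> D \<subseteq> T \<union> D" "T \<union> D \<subseteq> A" "a \<in> A - (T \<union> D)"
      using insert.hyps insert.prems assms by auto
    then have "marginal h a (S \<inter> T \<union> D) \<le> marginal h a (T \<union> D)"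
      using assms(1) unfolding supermodular_on_def by blast
    then show ?case using insert by (simp add: marginal_def)
  qed simp
  moreover have "finite (S - T)" using assms(2,3) by (meson finite_Diff finite_subset)
  moreover have "S \<inter> T \<union> (S - T) = S" "T \<union> (S - T) = S \<union> T" by auto
  ultimately show ?thesis by (metis order_refl)
qed

locale contract =
  fixes n :: nat and f c :: "nat set \<Rightarrow> real"
  assumes f_range: "f ` Pow {1..n} \<subseteq> {0..1}"
    and f_mono: "mono_on (Pow {1..n}) f"
    and f_super: "supermodular_on {1..n} f"
    and c_sub: "submodular_on {1..n} c"
begin

abbreviation optimal_for :: "real \<Rightarrow> nat set \<Rightarrow> bool" where
  "optimal_for \<alpha> S \<equiv> S \<in> agent_maximizers {1..n} f c \<alpha>"

lemma optimal_for_iff: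
  "optimal_for \<alpha> S \<longleftrightarrow> S \<subseteq> {1..n} \<and> (\<forall>T\<subseteq>{1..n}. \<alpha> * f T - c T \<le> \<alpha> * f S - c S)"
  by (auto simp: agent_maximizers_def is_arg_max_def agent_utility_def not_less)

lemma optimal_for_exists: "\<exists>S. optimal_for \<alpha> S"
proof -
  let ?U = "(\<lambda>S. \<alpha> * f S - c S) ` Pow {1..n}"
  have U: "finite ?U" "?U \<noteq> {}" by auto
  obtain S where "S \<in> Pow {1..n}" "Max ?U = \<alpha> * f S - c S" using Max_in[OF U] by blast
  moreover have "\<alpha> * f T - c T \<le> Max ?U" if "T \<subseteq> {1..n}" for T using that U(1) by (intro Max_ge) auto
  ultimately show ?thesis unfolding optimal_for_iff by (metis PowD)
qed

lemma utility_supermodular: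
  assumes "0 \<le> \<alpha>"
  shows "supermodular_on {1..n} (\<lambda>S. \<alpha> * f S - c S)"
  unfolding supermodular_on_def
proof (intro allI impI)
  fix S T a assume *: "S \<subseteq> T \<and> T \<subseteq> {1..n} \<and> a \<in> {1..n} - T"
  then have "marginal f a S \<le> marginal f a T" "marginal (\<lambda>S. - c S) a S \<le> marginal (\<lambda>S. - c S) a T"
    using f_super c_sub unfolding submodular_on_def supermodular_on_def by blast+
  then have "\<alpha> * marginal f a S + marginal (\<lambda>S. - c S) a S \<le> \<alpha> * marginal f a T + marginal (\<lambda>S. - c S) a T"
    using assms by (intro add_mono mult_left_mono)
  then show "marginal (\<lambda>S. \<alpha> * f S - c S) a S \<le> marginal (\<lambda>S. \<alpha> * f S - c S) a T"
    by (simp add: marginal_def algebra_simps)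
qed

text \<open>Adding the two optimality inequalities cancels the costs.\<close>

lemma optimal_for_mono:
  assumes "optimal_for \<alpha> S" "optimal_for \<beta> T" "\<alpha> < \<beta>"
  shows "f S \<le> f T"
proof -
  have "\<alpha> * f T - c T \<le> \<alpha> * f S - c S" "\<beta> * f S - c S \<le> \<beta> * f T - c T"
    using assms(1,2) unfolding optimal_for_iff by blast+
  then have "0 \<le> (\<beta> - \<alpha>) * (f T - f S)" by (simp add: algebra_simps)
  then show ?thesis using assms(3) by (simp add: zero_le_mult_iff)
qed

text \<open>Supermodularity at \<alpha> shows that joining \<open>S\<close> to \<open>T\<close> does
  not hurt at \<alpha>; raising the contract to \<beta> favours the larger set because
  \<open>f\<close> is monotone.\<close>

lemma optimal_for_Un:
  assumes "0 \<le> \<alpha>" "\<alpha> \<le> \<beta>" "optimal_for \<alpha> S" "optimal_for \<beta> T"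
  shows "optimal_for \<beta> (S \<union> T)"
proof -
  let ?h = "\<lambda>\<alpha> S. \<alpha> * f S - c S"
  have sub: "S \<subseteq> {1..n}" "T \<subseteq> {1..n}" using assms unfolding optimal_for_iff by blast+
  have "?h \<alpha> S + ?h \<alpha> T \<le> ?h \<alpha> (S \<union> T) + ?h \<alpha> (S \<inter> T)"
    using supermodular_lattice[OF utility_supermodular[OF assms(1)] _ sub] by simp
  moreover have "?h \<alpha> (S \<inter> T) \<le> ?h \<alpha> S" using assms(3) sub unfolding optimal_for_iff by blast
  ultimately have 1: "?h \<alpha> T \<le> ?h \<alpha> (S \<union> T)" by linarith
  have "f T \<le> f (S \<union> T)" using f_mono sub by (auto intro: mono_onD)
  then have "(\<beta> - \<alpha>) * f T \<le> (\<beta> - \<alpha>) * f (S \<union> T)" using assms(2) by (intro mult_left_mono) auto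
  with 1 have "?h \<beta> T \<le> ?h \<beta> (S \<union> T)" by (simp add: algebra_simps)
  then show ?thesis using assms(4) sub unfolding optimal_for_iff by (meson Un_least order_trans)
qed

text \<open>By \<open>optimal_for_Un\<close> with equal contracts this union is itself a maximizer
  when 0 \<le> \<alpha>.\<close>

definition largest :: "real \<Rightarrow> nat set" where
  "largest \<alpha> = \<Union>(agent_maximizers {1..n} f c \<alpha>)"

lemma optimal_for_largest:
  assumes "0 \<le> \<alpha>"
  shows "optimal_for \<alpha> (largest \<alpha>)"
proof -
  have fin: "finite (agent_maximizers {1..n} f c \<alpha>)"
    by (rule finite_subset[of _ "Pow {1..n}"]) (use optimal_for_iff in auto)
  have "optimal_for \<alpha> (\<Union>F)" if "finite F" "F \<noteq> {}" "F \<subseteq> agent_maximizers {1..n} f c \<alpha>" for F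
    using that
  proof (induction F rule: finite_ne_induct)
    case (insert S F)
    then show ?case using optimal_for_Un[OF assms order_refl, of S "\<Union>F"] by simp
  qed simp
  then show ?thesis using fin optimal_for_exists[of \<alpha>] unfolding largest_def by blast
qed

lemma largest_mono:
  assumes "0 \<le> \<alpha>" "\<alpha> \<le> \<beta>"
  shows "largest \<alpha> \<subseteq> largest \<beta>"
proof -
  have "optimal_for \<beta> (largest \<alpha> \<union> largest \<beta>)"
    using assms optimal_for_largest by (intro optimal_for_Un[OF assms]) auto
  then show ?thesis unfolding largest_def by blast
qed

definition slopes :: "real set" where
  "slopes = (\<lambda>\<alpha>. f (largest \<alpha>)) ` {0..1}"

text \<open>Members of a chain in \<open>{1..n}\<close> are told apart by their cardinality, one of
  \<open>n + 1\<close> numbers.\<close>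

lemma card_slopes: "finite slopes" "card slopes \<le> n + 1"
proof -
  let ?L = "largest ` {0..1}"
  have sub: "?L \<subseteq> Pow {1..n}"
  proof (rule image_subsetI)
    fix \<alpha> :: real assume "\<alpha> \<in> {0..1}"
    then show "largest \<alpha> \<in> Pow {1..n}"
      using optimal_for_largest[of \<alpha>] unfolding optimal_for_iff by simp
  qed
  then have fin: "finite ?L" by (rule finite_subset) simp
  have "inj_on card ?L"
  proof (rule inj_onI)
    fix S T assume ST: "S \<in> ?L" "T \<in> ?L" "card S = card T"
    then obtain \<alpha> \<beta> where *: "S = largest \<alpha>" "T = largest \<beta>" "0 \<le> \<alpha>" "0 \<le> \<beta>" by auto
    have "S \<subseteq> T \<or> T \<subseteq> S"
      using largest_mono[of \<alpha> \<beta>] largest_mono[of \<beta> \<alpha>] * by (metis linorder_le_cases)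
    moreover have "S \<subseteq> {1..n}" "T \<subseteq> {1..n}" using ST sub by blast+
    then have "finite S" "finite T" by (simp_all add: finite_subset)
    ultimately show "S = T" using ST(3) by (metis card_subset_eq)
  qed
  moreover have "card ` ?L \<subseteq> {0..n}"
  proof safe
    fix \<alpha> :: real assume "\<alpha> \<in> {0..1}"
    then have "largest \<alpha> \<subseteq> {1..n}" using sub by blast
    then show "card (largest \<alpha>) \<in> {0..n}" using card_mono[of "{1..n}" "largest \<alpha>"] by simp
  qed
  ultimately have "card ?L \<le> n + 1" using card_inj_on_le[of card ?L "{0..n}"] by simp
  moreover have "slopes = f ` ?L" unfolding slopes_def by auto
  ultimately show "finite slopes" "card slopes \<le> n + 1"
    using fin card_image_le[OF fin, of f] by auto
qed

text \<open>
  Between two responses at different contracts lies a slope, which may coincide with the reward of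
  either of them; counting with \<open><\<close> and with \<open>\<le>\<close> makes the index grow strictly in all cases.
\<close>

definition slope_index :: "real \<Rightarrow> nat" where
  "slope_index r = card {a \<in> slopes. a < r} + card {a \<in> slopes. a \<le> r}"

lemma slope_index_le: "slope_index r \<le> 2 * n + 2"
proof -
  have "card {a \<in> slopes. a < r} \<le> card slopes" "card {a \<in> slopes. a \<le> r} \<le> card slopes"
    using card_slopes(1) by (auto intro: card_mono)
  then show ?thesis using card_slopes(2) unfolding slope_index_def by linarith
qed

lemma slope_index_less:
  assumes "optimal_for \<alpha> S" "optimal_for \<beta> T" "0 \<le> \<alpha>" "\<alpha> < \<beta>" "\<beta> \<le> 1" "f S < f T"
  shows "slope_index (f S) < slope_index (f T)"
proof -
  let ?a = "f (largest \<alpha>)"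
  have a: "?a \<in> slopes" using assms unfolding slopes_def by auto
  have "f S \<le> ?a"
  proof (rule mono_onD[OF f_mono])
    show "S \<subseteq> largest \<alpha>" using assms(1) unfolding largest_def by blast
    show "S \<in> Pow {1..n}" "largest \<alpha> \<in> Pow {1..n}"
      using assms(1) optimal_for_largest[OF assms(3)] unfolding optimal_for_iff by blast+
  qed
  moreover have "?a \<le> f T" using optimal_for_mono[OF optimal_for_largest[OF assms(3)] assms(2,4)] .
  ultimately consider "f S = ?a" | "f S < ?a" "?a \<le> f T" by linarith
  then show ?thesis
  proof cases
    case 1
    have "card {a \<in> slopes. a < f S} < card {a \<in> slopes. a < f T}"
      using a assms(6) 1 card_slopes(1) by (intro psubset_card_mono psubsetI) auto
    moreover have "card {a \<in> slopes. a \<le> f S} \<le> card {a \<in> slopes. a \<le> f T}"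
      using assms(6) card_slopes(1) by (intro card_mono) auto
    ultimately show ?thesis unfolding slope_index_def by linarith
  next
    case 2
    have "card {a \<in> slopes. a \<le> f S} < card {a \<in> slopes. a \<le> f T}"
    proof (intro psubset_card_mono psubsetI)
      have "?a \<in> {a \<in> slopes. a \<le> f T}" "?a \<notin> {a \<in> slopes. a \<le> f S}" using a 2 by auto
      then show "{a \<in> slopes. a \<le> f S} \<noteq> {a \<in> slopes. a \<le> f T}" by blast
    qed (use assms(6) card_slopes(1) in auto)
    moreover have "card {a \<in> slopes. a < f S} \<le> card {a \<in> slopes. a < f T}"
      using assms(6) card_slopes(1) by (intro card_mono) auto
    ultimately show ?thesis unfolding slope_index_def by linarith
  qed
qed

section \<open>The breakpoint search by Newton's method\<close>

text \<open>The program keeps the reward and cost of a set but not the set itself; sets with the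
  same pair are interchangeable.\<close>

definition response :: "real \<Rightarrow> real \<Rightarrow> real \<Rightarrow> bool" where
  "response \<alpha> a k \<longleftrightarrow> (\<exists>S. optimal_for \<alpha> S \<and> f S = a \<and> c S = k)"

lemma response_le:
  assumes "response \<alpha> a k" "response \<beta> b l"
  shows "\<alpha> * b - l \<le> \<alpha> * a - k"
  using assms unfolding response_def optimal_for_iff by blast

lemma response_mono: "response \<alpha> a k \<Longrightarrow> response \<beta> b l \<Longrightarrow> \<alpha> < \<beta> \<Longrightarrow> a \<le> b"
  unfolding response_def using optimal_for_mono by blast

text \<open>The set attaining the pair at \<alpha> serves again at \<beta>, where it reaches the
  optimal value.\<close>

lemma response_eq:
  assumes "response \<alpha> a k" "response \<beta> b l" "\<beta> * b - l = \<beta> * a - k"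
  shows "response \<beta> a k"
  using assms unfolding response_def optimal_for_iff by metis

lemma response_index:
  assumes "response \<alpha> a k" "response \<beta> b l" "0 \<le> \<alpha>" "\<alpha> < \<beta>" "\<beta> \<le> 1" "a < b"
  shows "slope_index a < slope_index b"
  using assms slope_index_less unfolding response_def by blast

text \<open>
  Invariant of the breakpoint search.  \<open>(a, k)\<close> and \<open>(a1, k1)\<close> are reward and cost of two responses,
  at contracts \<open>\<gamma>1 < \<gamma>\<close>; Newton's method moves the second one up to the left end of the interval
  of contracts for which the first is a response.  \<open>b\<close> is the best principal's utility so far,
  reached at contract \<open>\<beta>\<close>, and responses with reward above \<open>a\<close> have been dealt with.
\<close>

definition search_inv :: "real \<Rightarrow> real \<Rightarrow> real \<Rightarrow> real \<Rightarrow> real \<Rightarrow> real \<Rightarrow> real \<Rightarrow> real \<Rightarrow> bool" where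
  "search_inv a0 k0 a k a1 k1 b \<beta> \<longleftrightarrow>
     response 0 a0 k0 \<and>
     (\<exists>\<gamma> \<gamma>1. \<gamma> \<in> {0..1} \<and> \<gamma>1 \<in> {0..1} \<and> response \<gamma> a k \<and> response \<gamma>1 a1 k1 \<and>
        (a1 < a \<longrightarrow> \<gamma>1 < \<gamma>) \<and> (a1 = a0 \<or> 0 < \<gamma>1)) \<and> (a1 < a \<or> a1 = a0) \<and>
     \<beta> \<in> {0..1} \<and> (\<exists>e l. response \<beta> e l \<and> b = (1 - \<beta>) * e) \<and> a0 \<le> b \<and>
     (\<forall>\<delta> e l. \<delta> \<in> {0..1} \<and> response \<delta> e l \<and> a < e \<longrightarrow> (1 - \<delta>) * e \<le> b)"

text \<open>Lexicographic: finishing a linear piece lowers the index of \<open>a\<close>, a Newton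
  step raises that of \<open>a1\<close>. Indices are at most \<open>2 * n + 2\<close>, hence the
  base \<open>2 * n + 3\<close>.\<close>

definition search_measure :: "real \<Rightarrow> real \<Rightarrow> nat" where
  "search_measure a a1 = slope_index a * (2 * n + 3) + (2 * n + 2 - slope_index a1)"

lemma response_range: "response \<alpha> a k \<Longrightarrow> a \<in> {0..1}"
  using f_range unfolding response_def optimal_for_iff by blast

text \<open>A reward above \<open>a\<close> can only occur at contract 1, where the principal gets
  nothing.\<close>

lemma search_init:
  assumes "response 0 a0 k0" "response 1 a k"
  shows "search_inv a0 k0 a k a0 k0 a0 0"
proof -
  have "0 \<le> a0" using response_range[OF assms(1)] by simp
  moreover have "(1 - \<delta>) * e \<le> a0" if "\<delta> \<in> {0..1}" "response \<delta> e l" "a < e" for \<delta> e l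
  proof -
    have "\<not> \<delta> < 1" using response_mono[OF that(2) assms(2)] that(3) by auto
    then show ?thesis using that \<open>0 \<le> a0\<close> by simp
  qed
  moreover have "\<exists>e l. response 0 e l \<and> a0 = (1 - 0) * e" using assms(1) by auto
  moreover have "\<exists>\<gamma> \<gamma>1. \<gamma> \<in> {0..1} \<and> \<gamma>1 \<in> {0..1} \<and> response \<gamma> a k \<and> response \<gamma>1 a0 k0 \<and>
        (a0 < a \<longrightarrow> \<gamma>1 < \<gamma>) \<and> (a0 = a0 \<or> 0 < \<gamma>1)"
    using assms by (intro exI[of _ 1] exI[of _ 0]) auto
  moreover have "(0::real) \<in> {0..1}" "a0 \<le> a0" by simp_all
  ultimately show ?thesis unfolding search_inv_def using assms by blast
qed

text \<open>The lines of slopes \<open>a1\<close> and \<open>a\<close> meet at \<alpha>. If the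
  response there beats them, its slope lies strictly in between and its line replaces the left one.
  Otherwise both lines are optimal at \<alpha>; responses with reward above \<open>a1\<close> then
  occur only at contracts \<ge> \<alpha>, and those with reward at most \<open>a\<close> give no
  more than \<open>(1 - \<alpha>) * a\<close>.\<close>

lemma search_newton:
  assumes inv: "search_inv a0 k0 a k a1 k1 b \<beta>" and less: "a1 < a"
    and \<alpha>: "\<alpha> = (k - k1) / (a - a1)" and resp: "response \<alpha> a' k'"
  shows "0 \<le> \<alpha>" "\<alpha> \<le> 1"
    and "\<alpha> * a - k < \<alpha> * a' - k' \<Longrightarrow> search_inv a0 k0 a k a' k' b \<beta>"
    and "\<alpha> * a - k < \<alpha> * a' - k' \<Longrightarrow> search_measure a a' < search_measure a a1"
    and "\<not> \<alpha> * a - k < \<alpha> * a' - k' \<Longrightarrow> b < (1 - \<alpha>) * a \<Longrightarrow> search_inv a0 k0 a1 k1 a0 k0 ((1 - \<alpha>) * a) \<alpha>"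
    and "\<not> \<alpha> * a - k < \<alpha> * a' - k' \<Longrightarrow> \<not> b < (1 - \<alpha>) * a \<Longrightarrow> search_inv a0 k0 a1 k1 a0 k0 b \<beta>"
    and "\<not> \<alpha> * a - k < \<alpha> * a' - k' \<Longrightarrow> search_measure a1 a0 < search_measure a a1"
proof -
  obtain \<gamma> \<gamma>1 where r0: "response 0 a0 k0" and g: "\<gamma> \<in> {0..1}" "\<gamma>1 \<in> {0..1}"
    and r: "response \<gamma> a k" and r1: "response \<gamma>1 a1 k1" and gg: "\<gamma>1 < \<gamma>" and g0: "a1 = a0 \<or> 0 < \<gamma>1"
    and bet: "\<beta> \<in> {0..1}" and wit: "\<exists>e l. response \<beta> e l \<and> b = (1 - \<beta>) * e" and b: "a0 \<le> b"
    and opt: "\<And>\<delta> e l. \<delta> \<in> {0..1} \<Longrightarrow> response \<delta> e l \<Longrightarrow> a < e \<Longrightarrow> (1 - \<delta>) * e \<le> b"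
    using inv less unfolding search_inv_def by blast
  have cross: "\<alpha> * a - k = \<alpha> * a1 - k1" using \<alpha> less by (simp add: field_simps)
  have \<alpha>1: "\<gamma>1 \<le> \<alpha>" using response_le[OF r1 r] less unfolding \<alpha> by (simp add: field_simps)
  have \<alpha>2: "\<alpha> \<le> \<gamma>" using response_le[OF r r1] less unfolding \<alpha> by (simp add: field_simps)
  show \<alpha>01: "0 \<le> \<alpha>" "\<alpha> \<le> 1" using \<alpha>1 \<alpha>2 g by auto
  { assume nt: "\<alpha> * a - k < \<alpha> * a' - k'"
    have "\<alpha> \<noteq> \<gamma>" using nt response_le[OF r resp] by auto
    then have "\<alpha> < \<gamma>" using \<alpha>2 by simp
    have "\<alpha> \<noteq> \<gamma>1" using nt cross response_le[OF r1 resp] by auto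
    then have l1: "\<gamma>1 < \<alpha>" using \<alpha>1 by simp
    have aa: "a' \<le> a" using response_mono[OF resp r \<open>\<alpha> < \<gamma>\<close>] .
    have "a' \<noteq> a"
    proof
      assume "a' = a"
      then have "k' < k" using nt by simp
      then show False using response_le[OF r resp] \<open>a' = a\<close> by simp
    qed
    then have "a' < a" using aa by simp
    have "a1 \<le> a'" using response_mono[OF r1 resp l1] .
    moreover have "a1 \<noteq> a'"
    proof
      assume "a1 = a'"
      then have "k' < k1" using nt cross by simp
      then show False using response_le[OF r1 resp] \<open>a1 = a'\<close> by simp
    qed
    ultimately have "a1 < a'" by simp
    have "0 < \<alpha>" using l1 g by simp
    then have "\<exists>\<gamma> \<gamma>1. \<gamma> \<in> {0..1} \<and> \<gamma>1 \<in> {0..1} \<and> response \<gamma> a k \<and> response \<gamma>1 a' k' \<and>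
        (a' < a \<longrightarrow> \<gamma>1 < \<gamma>) \<and> (a' = a0 \<or> 0 < \<gamma>1)"
      using g r resp \<open>\<alpha> < \<gamma>\<close> \<alpha>01 by (intro exI[of _ \<gamma>] exI[of _ \<alpha>]) simp
    then show "search_inv a0 k0 a k a' k' b \<beta>"
      unfolding search_inv_def using r0 \<open>a' < a\<close> bet wit b opt by blast
    have "slope_index a1 < slope_index a'"
      using response_index[OF r1 resp _ l1 _ \<open>a1 < a'\<close>] g \<alpha>01 by auto
    then show "search_measure a a' < search_measure a a1"
      using slope_index_le[of a'] unfolding search_measure_def by linarith }
  { assume "\<not> \<alpha> * a - k < \<alpha> * a' - k'"
    then have eq: "\<alpha> * a' - k' = \<alpha> * a - k" using response_le[OF resp r] by linarith
    have ra: "response \<alpha> a k" using response_eq[OF r resp eq] .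
    have ra1: "response \<alpha> a1 k1" using response_eq[OF r1 resp] eq cross by simp
    have pos: "0 \<le> a" using response_range[OF ra] by simp
    have *: "(1 - \<delta>) * e \<le> max b ((1 - \<alpha>) * a)" if "\<delta> \<in> {0..1}" "response \<delta> e l" "a1 < e" for \<delta> e l
    proof (cases "a < e")
      case True
      then show ?thesis using opt[OF that(1,2)] by simp
    next
      case False
      have "\<alpha> \<le> \<delta>" using response_mono[OF that(2) ra1] that(3) by (meson not_le)
      then have "(1 - \<delta>) * e \<le> (1 - \<alpha>) * a"
        using False that(1) pos response_range[OF that(2)] by (intro mult_mono) auto
      then show ?thesis by simp
    qed
    \<comment> \<open>This is what the clause \<open>a1 = a0 \<or> 0 < \<gamma>1\<close> of the
      invariant is kept for: the next piece needs a contract to the right of 0.\<close>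
    have z: "a0 < a1 \<Longrightarrow> 0 < \<alpha>" using g0 \<alpha>1 by auto
    have a01: "a0 \<le> a1 \<or> a1 = a0" using response_mono[OF r0 r1] g0 by auto
    have base: "\<exists>\<gamma> \<gamma>1. \<gamma> \<in> {0..1} \<and> \<gamma>1 \<in> {0..1} \<and> response \<gamma> a1 k1 \<and> response \<gamma>1 a0 k0 \<and>
        (a0 < a1 \<longrightarrow> \<gamma>1 < \<gamma>) \<and> (a0 = a0 \<or> 0 < \<gamma>1)"
      using ra1 r0 z \<alpha>01 by (intro exI[of _ \<alpha>] exI[of _ 0]) auto
    { assume bl: "b < (1 - \<alpha>) * a"
      show "search_inv a0 k0 a1 k1 a0 k0 ((1 - \<alpha>) * a) \<alpha>"
        unfolding search_inv_def
      proof (intro conjI base allI impI)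
        show "\<exists>e l. response \<alpha> e l \<and> (1 - \<alpha>) * a = (1 - \<alpha>) * e" using ra by blast
        fix \<delta> e l assume "\<delta> \<in> {0..1} \<and> response \<delta> e l \<and> a1 < e"
        then show "(1 - \<delta>) * e \<le> (1 - \<alpha>) * a" using *[of \<delta> e l] bl by (auto simp: max_def)
      qed (use r0 \<alpha>01 b bl in auto) }
    { assume bl: "\<not> b < (1 - \<alpha>) * a"
      show "search_inv a0 k0 a1 k1 a0 k0 b \<beta>"
        unfolding search_inv_def
      proof (intro conjI base allI impI wit)
        fix \<delta> e l assume "\<delta> \<in> {0..1} \<and> response \<delta> e l \<and> a1 < e"
        then show "(1 - \<delta>) * e \<le> b" using *[of \<delta> e l] bl by (auto simp: max_def)
      qed (use r0 bet b in auto) }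
    have "slope_index a1 < slope_index a"
      using response_index[OF r1 r _ gg _ less] g by auto
    then have "Suc (slope_index a1) * (2 * n + 3) \<le> slope_index a * (2 * n + 3)" by (intro mult_right_mono) auto
    then show "search_measure a1 a0 < search_measure a a1"
      unfolding search_measure_def by simp }
qed

text \<open>The value \<open>b\<close> comes from some response at \<beta>; the tie rule selects one
  of maximal reward there, which yields at least \<open>b\<close>, while every response at every
  contract yields at most \<open>b\<close>.\<close>

lemma search_final:
  assumes inv: "search_inv a0 k0 a k a1 k1 b \<beta>" and "\<not> a1 < a" and \<tau>: "tie_breaking_rule {1..n} \<tau>"
  shows "optimal_contract \<tau> {1..n} f c \<beta>"
proof -
  have "a \<le> a0" and r0: "response 0 a0 k0" and bet: "\<beta> \<in> {0..1}" and b: "a0 \<le> b"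
    and opt: "\<And>\<delta> e l. \<delta> \<in> {0..1} \<Longrightarrow> response \<delta> e l \<Longrightarrow> a < e \<Longrightarrow> (1 - \<delta>) * e \<le> b"
    using assms unfolding search_inv_def by auto
  obtain e l where e: "response \<beta> e l" "b = (1 - \<beta>) * e" using inv unfolding search_inv_def by blast
  have all: "(1 - \<delta>) * f S \<le> b" if "\<delta> \<in> {0..1}" "optimal_for \<delta> S" for \<delta> S
  proof (cases "a < f S")
    case True
    then show ?thesis using opt[OF that(1), of "f S" "c S"] that(2) unfolding response_def by blast
  next
    \<comment> \<open>Rewards up to \<open>a \<le> a0\<close> cannot beat the utility
      \<open>a0\<close> that contract 0 offers, and \<open>a0 \<le> b\<close>.\<close>
    case False
    have "0 \<le> f S" using response_range[of \<delta> "f S" "c S"] that(2) unfolding response_def by auto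
    then have "(1 - \<delta>) * f S \<le> 1 * f S" using that(1) by (intro mult_right_mono) auto
    then show ?thesis using False \<open>a \<le> a0\<close> b by linarith
  qed
  have best: "best_response \<tau> {1..n} f c \<delta> \<in> best_responses {1..n} f c \<delta>" for \<delta>
  proof -
    let ?M = "agent_maximizers {1..n} f c \<delta>"
    have fin: "finite ?M" by (rule finite_subset[of _ "Pow {1..n}"]) (use optimal_for_iff in auto)
    obtain S where "S \<in> ?M" "\<And>T. T \<in> ?M \<Longrightarrow> f T \<le> f S"
      using finite_has_maximal[of "f ` ?M"] fin optimal_for_exists[of \<delta>] by (force simp: not_less)
    then have "S \<in> best_responses {1..n} f c \<delta>"
      unfolding best_responses_def is_arg_max_def by (auto simp: not_less)
    moreover have "best_responses {1..n} f c \<delta> \<subseteq> Pow {1..n}"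
      unfolding best_responses_def is_arg_max_def using optimal_for_iff by auto
    ultimately show ?thesis using \<tau> unfolding tie_breaking_rule_def best_response_def by blast
  qed
  have "e \<le> f (best_response \<tau> {1..n} f c \<beta>)"
    using best[of \<beta>] e(1) unfolding best_responses_def is_arg_max_def response_def by (auto simp: not_less)
  then have "b \<le> (1 - \<beta>) * f (best_response \<tau> {1..n} f c \<beta>)"
    unfolding e(2) using bet by (intro mult_left_mono) auto
  moreover have "(1 - \<delta>) * f (best_response \<tau> {1..n} f c \<delta>) \<le> b" if "\<delta> \<in> {0..1}" for \<delta>
    using all[OF that] best[of \<delta>] unfolding best_responses_def is_arg_max_def by blast
  ultimately show ?thesis
    unfolding optimal_contract_def is_arg_max_def principal_utility_def using bet
    by (auto simp: not_less intro: order_trans)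
qed

text \<open>Since \<open>2 * n + 3 \<le> (n + 3)\<^sup>2\<close>, two digits fit; the exponent 4
  returns as the nesting depth in \<open>p_main\<close>.\<close>

lemma search_measure_bound: "search_measure a a1 < (n + 3) ^ 4"
proof -
  have "search_measure a a1 < (2 * n + 3) * (2 * n + 3)"
    unfolding search_measure_def using lex_less[of "slope_index a" "2 * n + 3" "2 * n + 2 - slope_index a1" "2 * n + 3" 0]
      slope_index_le[of a] by simp
  also have "\<dots> \<le> (n + 3) * (n + 3) * ((n + 3) * (n + 3))"
    by (intro mult_mono) (simp_all add: algebra_simps)
  finally show ?thesis by (simp only: power4_eq_xxxx mult.assoc)
qed

end

section \<open>Reasoning about loops\<close>

context oracles
begin

text \<open>\<open>halt\<close> is the negated guard of the simulated while loop. The conclusion has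
  the form of the first premise with \<open>(n + h) * m\<close> for \<open>m\<close>, so the rule
  can be applied level by level.\<close>

lemma For_measure:
  assumes "\<And>s. Inv s \<Longrightarrow> Inv (sem p s) \<and> (halt (sem p s) \<or> \<mu> (sem p s) + m \<le> (\<mu> s :: nat))"
    and "\<And>s. Inv s \<Longrightarrow> halt s \<Longrightarrow> halt (sem p s)"
    and "\<And>s k. Inv (seti i k s) = Inv s" "\<And>s k. halt (seti i k s) = halt s" "\<And>s k. \<mu> (seti i k s) = \<mu> s"
    and "Inv s"
  shows "Inv (sem (PFor i 0 h p) s) \<and>
    (halt (sem (PFor i 0 h p) s) \<or> \<mu> (sem (PFor i 0 h p) s) + (n + h) * m \<le> \<mu> s)"
proof (rule sem_For_rule[where I = "\<lambda>k s'. Inv s' \<and> (halt s' \<or> \<mu> s' + k * m \<le> \<mu> s)"])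
  fix k s' assume I: "Inv s' \<and> (halt s' \<or> \<mu> s' + k * m \<le> \<mu> s)"
  show "Inv (seti i (Suc k) (sem p s')) \<and>
      (halt (seti i (Suc k) (sem p s')) \<or> \<mu> (seti i (Suc k) (sem p s')) + Suc k * m \<le> \<mu> s)"
    using assms(1)[of s'] assms(2)[of s'] I unfolding assms(3-5) by auto
qed (use assms in auto)

lemma For_done:
  assumes "\<And>s. Inv s \<Longrightarrow> Inv (sem p s)" "\<And>s. Inv s \<Longrightarrow> halt s \<Longrightarrow> halt (sem p s)"
    and "\<And>s k. Inv (seti i k s) = Inv s" "\<And>s k. halt (seti i k s) = halt s"
    and "Inv s" "halt s"
  shows "halt (sem (PFor i 0 h p) s)"
proof -
  have "Inv (sem (PFor i 0 h p) s) \<and> halt (sem (PFor i 0 h p) s)"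
    by (rule sem_For_rule[where I = "\<lambda>k s'. Inv s' \<and> halt s'"]) (use assms in auto)
  then show ?thesis ..
qed

end

section \<open>Nested counting loops in place of a while loop\<close>

text \<open>Each level makes \<open>n + 3\<close> rounds, so \<open>p\<close> is run
  \<open>(n + 3) ^ k\<close> times; each counter has an array of its own, starting at
  \<open>b\<close>.\<close>

primrec nest :: "name \<Rightarrow> nat \<Rightarrow> prog \<Rightarrow> prog" where
  "nest b 0 p = p"
| "nest b (Suc k) p = PFor (b + k) 0 3 (nest b k p)"

lemma mods_nest [simp]:
  "imods (nest b k p) = {b..<b + k} \<union> imods p" "rmods (nest b k p) = rmods p"
  by (induction k) auto

lemma wf_nest:
  assumes "wf_prog p" "0 < b" "\<And>x. x \<in> imods p \<Longrightarrow> x < b"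
  shows "wf_prog (nest b k p)"
proof (induction k)
  case (Suc k)
  have "b + k \<notin> imods p" using assms(3)[of "b + k"] by auto
  with Suc assms show ?case by auto
qed (use assms in auto)

context oracles
begin

text \<open>The measure cannot fall \<open>(n + 3) ^ K\<close> times, so \<open>halt\<close> is
  reached on the way and then persists. The premises on \<open>seti\<close> keep the counters apart
  from the data.\<close>

lemma nest_measure:
  assumes "\<And>s. Inv s \<Longrightarrow> Inv (sem p s) \<and> (halt (sem p s) \<or> \<mu> (sem p s) < (\<mu> s :: nat))"
    and "\<And>s. Inv s \<Longrightarrow> halt s \<Longrightarrow> halt (sem p s)"
    and "\<And>s i k. b \<le> i \<Longrightarrow> Inv (seti i k s) = Inv s"
    and "\<And>s i k. b \<le> i \<Longrightarrow> halt (seti i k s) = halt s"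
    and "\<And>s i k. b \<le> i \<Longrightarrow> \<mu> (seti i k s) = \<mu> s"
    and "Inv s" "\<mu> s < (n + 3) ^ K"
  shows "Inv (sem (nest b K p) s)" "halt (sem (nest b K p) s)"
proof -
  have *: "(Inv s \<longrightarrow> Inv (sem (nest b k p) s) \<and>
      (halt (sem (nest b k p) s) \<or> \<mu> (sem (nest b k p) s) + (n + 3) ^ k \<le> \<mu> s)) \<and>
    (Inv s \<longrightarrow> halt s \<longrightarrow> halt (sem (nest b k p) s))" for k s
  proof (induction k arbitrary: s)
    case 0
    then show ?case using assms(1,2)[of s] by (auto simp: Suc_le_eq)
  next
    case (Suc k)
    let ?p = "nest b k p"
    have 1: "Inv (sem ?p s) \<and> (halt (sem ?p s) \<or> \<mu> (sem ?p s) + (n + 3) ^ k \<le> \<mu> s)"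
      "halt s \<Longrightarrow> halt (sem ?p s)" if "Inv s" for s
      using Suc[of s] that by blast+
    have bk: "b \<le> b + k" by simp
    have "Inv (sem (PFor (b + k) 0 3 ?p) s) \<and> (halt (sem (PFor (b + k) 0 3 ?p) s) \<or>
        \<mu> (sem (PFor (b + k) 0 3 ?p) s) + (n + 3) * (n + 3) ^ k \<le> \<mu> s)" if "Inv s"
      by (rule For_measure[where Inv = Inv and halt = halt and \<mu> = \<mu>,
            OF 1(1) 1(2) assms(3)[OF bk] assms(4)[OF bk] assms(5)[OF bk] that])
    moreover have "halt (sem (PFor (b + k) 0 3 ?p) s)" if "Inv s" "halt s"
      by (rule For_done[where Inv = Inv and halt = halt,
            OF conjunct1[OF 1(1)] 1(2) assms(3)[OF bk] assms(4)[OF bk] that])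
    ultimately show ?case by (simp only: nest.simps power_Suc) blast
  qed
  have "Inv (sem (nest b K p) s)" and
    "halt (sem (nest b K p) s) \<or> \<mu> (sem (nest b K p) s) + (n + 3) ^ K \<le> \<mu> s"
    using *[of s K] assms(6) by blast+
  with assms(7) show "Inv (sem (nest b K p) s)" "halt (sem (nest b K p) s)"
    by (blast, linarith)
qed

text \<open>\<open>own a b\<close> is the iteration that writes cell \<open>(a, b)\<close>; it lies outside the loop for untouched cells.\<close>

lemma For_reals:
  assumes "\<And>k s' a b. l \<le> k \<Longrightarrow> k < n + h \<Longrightarrow> ints s' i 0 0 = k \<Longrightarrow>
      (\<And>x. x \<notin> insert i (imods p) \<Longrightarrow> ints s' x = ints s x) \<Longrightarrow>
      (\<And>x. x \<notin> rmods p \<Longrightarrow> reals s' x = reals s x) \<Longrightarrow>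
      (\<And>a b. k \<le> own a b \<Longrightarrow> reals s' x a b = reals s x a b) \<Longrightarrow>
      reals (sem p s') x a b = (if own a b = k then G a b else reals s' x a b)"
    and "l \<le> n + h"
  shows "reals (sem (PFor i l h p) s) x a b =
    (if l \<le> own a b \<and> own a b < n + h then G a b else reals s x a b)"
proof -
  have "\<forall>a b. reals (sem (PFor i l h p) s) x a b =
    (if l \<le> own a b \<and> own a b < n + h then G a b else reals s x a b)"
    by (rule sem_For_rule[where I = "\<lambda>k s'. \<forall>a b. reals s' x a b =
      (if l \<le> own a b \<and> own a b < k then G a b else reals s x a b)"])
      (use assms in \<open>auto simp: less_Suc_eq\<close>)
  then show ?thesis by simp
qed

lemma For_ints:
  assumes "\<And>k s' a b. l \<le> k \<Longrightarrow> k < n + h \<Longrightarrow> ints s' i 0 0 = k \<Longrightarrow>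
      (\<And>x. x \<notin> insert i (imods p) \<Longrightarrow> ints s' x = ints s x) \<Longrightarrow>
      (\<And>x. x \<notin> rmods p \<Longrightarrow> reals s' x = reals s x) \<Longrightarrow>
      (\<And>a b. k \<le> own a b \<Longrightarrow> ints s' x a b = ints s x a b) \<Longrightarrow>
      ints (sem p s') x a b = (if own a b = k then G a b else ints s' x a b)"
    and "l \<le> n + h" "x \<noteq> i"
  shows "ints (sem (PFor i l h p) s) x a b =
    (if l \<le> own a b \<and> own a b < n + h then G a b else ints s x a b)"
proof -
  have "\<forall>a b. ints (sem (PFor i l h p) s) x a b =
    (if l \<le> own a b \<and> own a b < n + h then G a b else ints s x a b)"
    by (rule sem_For_rule[where I = "\<lambda>k s'. \<forall>a b. ints s' x a b =
      (if l \<le> own a b \<and> own a b < k then G a b else ints s x a b)"])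
      (use assms in \<open>auto simp: less_Suc_eq\<close>)
  then show ?thesis by simp
qed

lemma For_sum:
  assumes "\<And>k s'. l \<le> k \<Longrightarrow> k < n + h \<Longrightarrow> ints s' i 0 0 = k \<Longrightarrow>
      (\<And>x. x \<notin> insert i (imods p) \<Longrightarrow> ints s' x = ints s x) \<Longrightarrow>
      (\<And>x. x \<notin> rmods p \<Longrightarrow> reals s' x = reals s x) \<Longrightarrow>
      (\<And>a b. (a, b) \<noteq> (a0, b0) \<Longrightarrow> reals s' x a b = reals s x a b) \<Longrightarrow>
      reals (sem p s') x = update (reals s') x a0 b0 (reals s' x a0 b0 + G k) x"
    and "l \<le> n + h"
  shows "reals (sem (PFor i l h p) s) x a b =
    (if a = a0 \<and> b = b0 then reals s x a b + (\<Sum>k\<in>{l..<n + h}. G k) else reals s x a b)"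
proof -
  have "\<forall>a b. reals (sem (PFor i l h p) s) x a b =
    (if a = a0 \<and> b = b0 then reals s x a b + (\<Sum>k\<in>{l..<n + h}. G k) else reals s x a b)"
  proof (rule sem_For_rule[where I = "\<lambda>k s'. \<forall>a b. reals s' x a b =
      (if a = a0 \<and> b = b0 then reals s x a b + (\<Sum>k\<in>{l..<k}. G k) else reals s x a b)"])
    fix k :: nat and s' :: state
    assume k: "l \<le> k" "k < n + h" and I: "\<forall>a b. reals s' x a b =
        (if a = a0 \<and> b = b0 then reals s x a b + (\<Sum>k\<in>{l..<k}. G k) else reals s x a b)"
      and fr: "ints s' i 0 0 = k" "\<And>x. x \<notin> insert i (imods p) \<Longrightarrow> ints s' x = ints s x"
      "\<And>x. x \<notin> rmods p \<Longrightarrow> reals s' x = reals s x"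
    have "reals (sem p s') x = update (reals s') x a0 b0 (reals s' x a0 b0 + G k) x"
      by (rule assms(1)[OF k fr]) (use I in auto)
    then show "\<forall>a b. reals (seti i (Suc k) (sem p s')) x a b =
        (if a = a0 \<and> b = b0 then reals s x a b + (\<Sum>k\<in>{l..<Suc k}. G k) else reals s x a b)"
      using k(1) I by (simp add: update_apply)
  qed (use assms(2) in auto)
  then show ?thesis by simp
qed

text \<open>\<open>v\<close> maps an index to the value that records it, e.g. the successor when \<open>0\<close> means none.\<close>

lemma For_search:
  assumes "\<And>k s'. l \<le> k \<Longrightarrow> k < n + h \<Longrightarrow> ints s' i 0 0 = k \<Longrightarrow>
      (\<And>x. x \<notin> insert i (imods p) \<Longrightarrow> ints s' x = ints s x) \<Longrightarrow>
      (\<And>x. x \<notin> rmods p \<Longrightarrow> reals s' x = reals s x) \<Longrightarrow>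
      ints (sem p s') y 0 0 = (if P k then v k else ints s' y 0 0)"
    and "l \<le> n + h" "y \<noteq> i"
  shows "(\<exists>k. l \<le> k \<and> k < n + h \<and> P k \<and> (\<forall>j. k < j \<and> j < n + h \<longrightarrow> \<not> P j) \<and>
      ints (sem (PFor i l h p) s) y 0 0 = v k) \<or>
    (\<forall>k. l \<le> k \<and> k < n + h \<longrightarrow> \<not> P k) \<and> ints (sem (PFor i l h p) s) y 0 0 = ints s y 0 0"
proof (rule sem_For_rule[where I = "\<lambda>m s'. (\<exists>k. l \<le> k \<and> k < m \<and> P k \<and> (\<forall>j. k < j \<and> j < m \<longrightarrow> \<not> P j) \<and>
      ints s' y 0 0 = v k) \<or> (\<forall>k. l \<le> k \<and> k < m \<longrightarrow> \<not> P k) \<and> ints s' y 0 0 = ints s y 0 0"])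
  fix k :: nat and s' :: state
  assume *: "l \<le> k" "k < n + h" "(\<exists>k'. l \<le> k' \<and> k' < k \<and> P k' \<and> (\<forall>j. k' < j \<and> j < k \<longrightarrow> \<not> P j) \<and>
      ints s' y 0 0 = v k') \<or> (\<forall>k'. l \<le> k' \<and> k' < k \<longrightarrow> \<not> P k') \<and> ints s' y 0 0 = ints s y 0 0"
    "ints s' i 0 0 = k" "(\<And>x. x \<notin> insert i (imods p) \<Longrightarrow> ints s' x = ints s x)"
      "(\<And>x. x \<notin> rmods p \<Longrightarrow> reals s' x = reals s x)"
  have eq: "ints (seti i (Suc k) (sem p s')) y 0 0 = (if P k then v k else ints s' y 0 0)"
    using assms(1)[OF *(1,2,4-6)] assms(3) by simp
  show "(\<exists>k'. l \<le> k' \<and> k' < Suc k \<and> P k' \<and> (\<forall>j. k' < j \<and> j < Suc k \<longrightarrow> \<not> P j) \<and>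
      ints (seti i (Suc k) (sem p s')) y 0 0 = v k') \<or>
    (\<forall>k'. l \<le> k' \<and> k' < Suc k \<longrightarrow> \<not> P k') \<and> ints (seti i (Suc k) (sem p s')) y 0 0 = ints s y 0 0"
  proof (cases "P k")
    case True
    then show ?thesis using eq *(1) by (intro disjI1 exI[of _ k]) auto
  next
    case False
    then show ?thesis using eq *(3) by (auto simp: less_Suc_eq)
  qed
qed (use assms in auto)

end

section \<open>The algorithm\<close>

text \<open>
  Integer arrays: \<open>iR\<close> holds a ranking in each of the slots \<open>0, \<dots>, n + 1\<close>, \<open>iD\<close> the labels, \<open>iCH\<close> two
  characteristic vectors, \<open>iM\<close> the modified rankings, \<open>iUS\<close> the used rows of the elimination, \<open>iT\<close>
  and \<open>iS\<close> the head and tail of the push, \<open>iI\<close> the slot of the modified ranking.  Real arrays: \<open>rA\<close>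
  holds the contract, \<open>rLAM\<close> the weights of the slots (\<open>0\<close> for a free slot), \<open>rB\<close> their base vectors,
  \<open>rX\<close> the convex combination, \<open>rE\<close> the base vectors of the rankings in \<open>iM\<close>, \<open>rK\<close> their coefficients,
  \<open>rW\<close> their new weights.  Column \<open>0\<close> of \<open>rB\<close> and \<open>rE\<close> is constantly \<open>1\<close>, which turns the total
  weight into one more coordinate.
\<close>

abbreviation (input) "iR \<equiv> 14 :: name"
abbreviation (input) "iD \<equiv> 2 :: name"
abbreviation (input) "iCH \<equiv> 3 :: name"
abbreviation (input) "iT \<equiv> 4 :: name"
abbreviation (input) "iS \<equiv> 5 :: name"
abbreviation (input) "iI \<equiv> 6 :: name"
abbreviation (input) "iJ \<equiv> 7 :: name"
abbreviation (input) "iP \<equiv> 8 :: name"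
abbreviation (input) "iUS \<equiv> 9 :: name"
abbreviation (input) "iM \<equiv> 10 :: name"
abbreviation (input) "iDG \<equiv> 11 :: name"
abbreviation (input) "iAL \<equiv> 12 :: name"
abbreviation (input) "iU \<equiv> 13 :: name"
abbreviation (input) "l1 \<equiv> 20 :: name"
abbreviation (input) "l2 \<equiv> 21 :: name"
abbreviation (input) "l3 \<equiv> 22 :: name"

abbreviation (input) "rA \<equiv> 21 :: name"
abbreviation (input) "rLAM \<equiv> 2 :: name"
abbreviation (input) "rB \<equiv> 3 :: name"
abbreviation (input) "rX \<equiv> 4 :: name"
abbreviation (input) "rE \<equiv> 5 :: name"
abbreviation (input) "rK \<equiv> 6 :: name"
abbreviation (input) "rY \<equiv> 7 :: name"
abbreviation (input) "rC \<equiv> 8 :: name"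
abbreviation (input) "rL \<equiv> 9 :: name"
abbreviation (input) "rTH \<equiv> 10 :: name"
abbreviation (input) "rQ1 \<equiv> 11 :: name"
abbreviation (input) "rQ2 \<equiv> 12 :: name"
abbreviation (input) "rQ3 \<equiv> 13 :: name"
abbreviation (input) "rQ4 \<equiv> 14 :: name"
abbreviation (input) "rDL \<equiv> 15 :: name"
abbreviation (input) "rKT \<equiv> 16 :: name"
abbreviation (input) "rW \<equiv> 17 :: name"
abbreviation (input) "rFV \<equiv> 18 :: name"
abbreviation (input) "rCV \<equiv> 19 :: name"
abbreviation (input) "rPH \<equiv> 20 :: name"

abbreviation (input) "IA x e \<equiv> IGet x e (INum 0)"
abbreviation (input) "RA x e \<equiv> RGet x e (INum 0)"
abbreviation (input) "SetI x e \<equiv> PI x (INum 0) (INum 0) e"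
abbreviation (input) "SetR x e \<equiv> PR x (INum 0) (INum 0) e"
abbreviation (input) "IPos e \<equiv> ILess (INum 0) e"
abbreviation (input) "RPos e \<equiv> RLess (ROf (INum 0)) e"
abbreviation (input) "IEq e1 e2 \<equiv> BAnd (BNot (ILess e1 e2)) (BNot (ILess e2 e1))"

text \<open>By truncated subtraction the two vectors describe \<open>{w. R w \<le> R v}\<close> and \<open>{w. R w < R v}\<close>.\<close>

definition p_chi :: prog where
  "p_chi =
   PFor l2 1 1 (
     PI iCH (INum 0) (IV l2) (ISub (IAdd (IGet iM (IV iU) (IV l1)) (INum 1)) (IGet iM (IV iU) (IV l2))) ;;
     PI iCH (INum 1) (IV l2) (ISub (IGet iM (IV iU) (IV l1)) (IGet iM (IV iU) (IV l2))))"

section \<open>Programs for base vectors, elimination and insertion\<close>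

definition p_base :: prog where
  "p_base =
   PFor l1 1 1 (
     p_chi ;;
     PQ Cost rQ1 (INum 0) (INum 0) iCH (INum 0) ;;
     PQ Reward rQ2 (INum 0) (INum 0) iCH (INum 0) ;;
     PQ Cost rQ3 (INum 0) (INum 0) iCH (INum 1) ;;
     PQ Reward rQ4 (INum 0) (INum 0) iCH (INum 1) ;;
     PR rE (IV iU) (IV l1)
       (RSub (RSub (RV rQ1) (RMul (RV rA) (RV rQ2))) (RSub (RV rQ3) (RMul (RV rA) (RV rQ4))))) ;;
   PR rE (IV iU) (INum 0) (ROf (INum 1))"

text \<open>The index found is stored as its successor; \<open>0\<close> means that every slot is occupied.\<close>

definition p_find_free :: prog where
  "p_find_free =
   SetI iJ (INum 0) ;;
   PFor l1 0 2 (PIf (RPos (RA rLAM (IV l1))) PSkip (SetI iJ (IAdd (IV l1) (INum 1))))"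

definition p_sums :: "name \<Rightarrow> nat \<Rightarrow> nat \<Rightarrow> name \<Rightarrow> nat \<Rightarrow> nat \<Rightarrow> name \<Rightarrow> rexp \<Rightarrow> prog" where
  "p_sums i l h j l' h' x e =
   PFor i l h (
     PR x (IV i) (INum 0) (ROf (INum 0)) ;;
     PFor j l' h' (PR x (IV i) (INum 0) (RAdd (RA x (IV i)) e)))"

text \<open>The pivot row is flagged as used beforehand and hence skipped, so its original entries
  can be read throughout.\<close>

definition p_eliminate :: prog where
  "p_eliminate =
   PFor l1 0 2 (PIf (IPos (IA iUS (IV l1))) PSkip (
     PFor l2 0 2 (PR rC (IV l1) (IV l2) (RSub (RGet rC (IV l1) (IV l2))
       (RMul (RDiv (RA rL (IV l1)) (RA rL (IV iP))) (RGet rC (IV iP) (IV l2)))))))"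

text \<open>Reals can only be compared by \<open><\<close>, so a nonzero entry is recognized by its
  positive square.\<close>

definition p_pivot :: prog where
  "p_pivot =
   p_sums l1 0 2 l2 0 2 rL (RMul (RGet rC (IV l1) (IV l2)) (RGet rB (IV l2) (IV l3))) ;;
   SetI iP (INum 0) ;;
   PFor l1 0 2 (PIf (BAnd (BNot (IPos (IA iUS (IV l1)))) (RPos (RMul (RA rL (IV l1)) (RA rL (IV l1)))))
     (SetI iP (IAdd (IV l1) (INum 1))) PSkip) ;;
   PIf (IPos (IV iP)) (
     SetI iP (ISub (IV iP) (INum 1)) ;;
     PI iUS (IV iP) (INum 0) (INum 1) ;;
     p_eliminate) PSkip"

text \<open>The coefficient matrix starts as the identity, written as 1 minus the distance of the
  indices in truncated arithmetic; there is one pivot for each of the columns 0 to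
  \<open>n\<close>.\<close>

definition p_null :: prog where
  "p_null =
   PFor l1 0 2 (
     PI iUS (IV l1) (INum 0) (INum 0) ;;
     PFor l2 0 2 (PR rC (IV l1) (IV l2)
       (ROf (ISub (INum 1) (IAdd (ISub (IV l1) (IV l2)) (ISub (IV l2) (IV l1))))))) ;;
   PFor l3 0 1 p_pivot"

definition p_reduce :: prog where
  "p_reduce =
   p_null ;;
   SetI iP (INum 0) ;;
   PFor l1 0 2 (PIf (IPos (IA iUS (IV l1))) PSkip (SetI iP (IV l1))) ;;
   SetI iJ (IV iP) ;;
   PFor l1 0 2 (PIf (BAnd (RPos (RGet rC (IV iP) (IV l1)))
       (RLess (RDiv (RA rLAM (IV l1)) (RGet rC (IV iP) (IV l1)))
         (RDiv (RA rLAM (IV iJ)) (RGet rC (IV iP) (IV iJ))))) (SetI iJ (IV l1)) PSkip) ;;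
   SetR rTH (RDiv (RA rLAM (IV iJ)) (RGet rC (IV iP) (IV iJ))) ;;
   PFor l1 0 2 (PR rLAM (IV l1) (INum 0) (RSub (RA rLAM (IV l1)) (RMul (RV rTH) (RGet rC (IV iP) (IV l1)))))"

text \<open>
  The new vector enters slot \<open>0\<close> and moves on to a free slot.  If there is none, subtracting a multiple
  of a null vector of the \<open>n + 2\<close> slots clears one, possibly slot \<open>0\<close> itself.
\<close>

definition p_insert :: prog where
  "p_insert =
   PFor l1 0 1 (
     PI iR (INum 0) (IV l1) (IGet iM (IV iU) (IV l1)) ;;
     PR rB (INum 0) (IV l1) (RGet rE (IV iU) (IV l1))) ;;
   PR rLAM (INum 0) (INum 0) (RA rW (IV iU)) ;;
   p_find_free ;;
   PIf (IPos (IV iJ)) (SetI iJ (ISub (IV iJ) (INum 1))) p_reduce ;;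
   PFor l1 0 1 (
     PI iR (IV iJ) (IV l1) (IGet iR (INum 0) (IV l1)) ;;
     PR rB (IV iJ) (IV l1) (RGet rB (INum 0) (IV l1))) ;;
   PR rLAM (IV iJ) (INum 0) (RA rLAM (INum 0)) ;;
   PR rLAM (INum 0) (INum 0) (ROf (INum 0))"

section \<open>Programs for one push-relabel step\<close>

definition p_xval :: prog where
  "p_xval = p_sums l1 0 1 l2 0 2 rX (RMul (RA rLAM (IV l2)) (RGet rB (IV l2) (IV l1)))"

text \<open>Later elements win ties between labels, as in \<open>key\<close>. While nothing is
  chosen, the comparison reads the label of the dummy element 0, which is kept at 0.\<close>

definition p_select_t :: prog where
  "p_select_t =
   SetI iT (INum 0) ;;
   PFor l1 1 1 (PIf (BAnd (RLess (RA rX (IV l1)) (ROf (INum 0)))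
       (BAnd (ILess (IA iD (IV l1)) (IV 0)) (BNot (ILess (IA iD (IV l1)) (IA iD (IV iT))))))
     (SetI iT (IV l1)) PSkip)"

definition p_select_s :: prog where
  "p_select_s =
   SetI iS (INum 0) ;;
   PFor l1 1 1 (PFor l2 0 2 (
     PIf (BAnd (IEq (IAdd (IA iD (IV l1)) (INum 1)) (IA iD (IV iT)))
       (BAnd (RPos (RA rLAM (IV l2))) (ILess (IGet iR (IV l2) (IV l1)) (IGet iR (IV l2) (IV iT)))))
     (SetI iS (IV l1)) PSkip))"

definition p_choose_i :: prog where
  "p_choose_i =
   SetI iAL (INum 0) ;;
   PFor l1 0 2 (
     PIf (BAnd (RPos (RA rLAM (IV l1)))
         (ILess (IV iAL) (ISub (IGet iR (IV l1) (IV iT)) (IGet iR (IV l1) (IV iS)))))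
       (SetI iI (IV l1) ;; SetI iAL (ISub (IGet iR (IV l1) (IV iT)) (IGet iR (IV l1) (IV iS)))) PSkip)"

definition p_moves :: prog where
  "p_moves =
   PFor iU 1 1 (
     PFor l1 1 1 (
       PIf (IEq (IV l1) (IV iU)) (PI iM (IV iU) (IV l1) (IGet iR (IV iI) (IV iS)))
       (PIf (BAnd (BNot (ILess (IGet iR (IV iI) (IV l1)) (IGet iR (IV iI) (IV iS))))
           (ILess (IGet iR (IV iI) (IV l1)) (IGet iR (IV iI) (IV iU))))
         (PI iM (IV iU) (IV l1) (IAdd (IGet iR (IV iI) (IV l1)) (INum 1)))
         (PI iM (IV iU) (IV l1) (IGet iR (IV iI) (IV l1))))) ;;
     p_base)"

text \<open>The outer counter descends through the ranks below that of \<open>t\<close>; the inner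
  loop looks up the element of the current rank, as no inverse ranking is stored.\<close>

definition p_triangular :: prog where
  "p_triangular =
   PR rK (IV iT) (INum 0) (ROf (INum 1)) ;;
   PFor l1 1 1 (PR rY (IV l1) (INum 0) (RSub (RGet rE (IV iT) (IV l1)) (RGet rB (IV iI) (IV l1)))) ;;
   PFor l2 1 1 (PFor l3 1 1 (
     PIf (BAnd (IEq (IAdd (IGet iR (IV iI) (IV l3)) (IV l2)) (IGet iR (IV iI) (IV iT)))
         (ILess (IGet iR (IV iI) (IV iS)) (IGet iR (IV iI) (IV l3)))) (
       PR rK (IV l3) (INum 0) (RDiv (RSub (ROf (INum 0)) (RA rY (IV l3)))
         (RSub (RGet rE (IV l3) (IV l3)) (RGet rB (IV iI) (IV l3)))) ;;
       PFor l1 1 1 (PR rY (IV l1) (INum 0) (RAdd (RA rY (IV l1))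
         (RMul (RA rK (IV l3)) (RSub (RGet rE (IV l3) (IV l1)) (RGet rB (IV iI) (IV l1))))))) PSkip))"

text \<open>
  If some exchange leaves the base vector unchanged, the ranking is replaced without moving \<open>x\<close>.
  Otherwise the exchange directions form a triangular system and combine to a multiple of
  \<open>\<chi>\<^sub>t - \<chi>\<^sub>s\<close>.
\<close>

definition p_kappa :: prog where
  "p_kappa =
   SetI iDG (INum 0) ;;
   PFor l1 1 1 (PIf (BAnd (BAnd (ILess (IGet iR (IV iI) (IV iS)) (IGet iR (IV iI) (IV l1)))
         (BNot (ILess (IGet iR (IV iI) (IV iT)) (IGet iR (IV iI) (IV l1)))))
         (BNot (RLess (RGet rB (IV iI) (IV l1)) (RGet rE (IV l1) (IV l1)))))
       (SetI iDG (IV l1)) PSkip) ;;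
   PFor l1 1 1 (PR rK (IV l1) (INum 0) (ROf (INum 0))) ;;
   PIf (IPos (IV iDG))
     (PR rK (IV iDG) (INum 0) (ROf (INum 1)) ;; SetR rDL (ROf (INum 0)))
     (p_triangular ;; SetR rDL (RA rY (IV iT)))"

text \<open>\<open>rPH\<close> is the amount pushed if slot \<open>i\<close> gave away its whole
  weight; \<open>rTH\<close> is the fraction given away, cut down so that the value of
  \<open>t\<close> does not become positive.\<close>

definition p_push :: prog where
  "p_push =
   p_choose_i ;; p_moves ;; p_kappa ;;
   SetR rKT (ROf (INum 0)) ;;
   PFor l1 1 1 (SetR rKT (RAdd (RV rKT) (RA rK (IV l1)))) ;;
   SetR rPH (RDiv (RMul (RA rLAM (IV iI)) (RV rDL)) (RV rKT)) ;;
   PIf (RLess (RSub (ROf (INum 0)) (RA rX (IV iT))) (RV rPH))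
     (SetR rTH (RDiv (RSub (ROf (INum 0)) (RA rX (IV iT))) (RV rPH)))
     (SetR rTH (ROf (INum 1))) ;;
   PFor l1 1 1 (PR rW (IV l1) (INum 0)
     (RDiv (RMul (RMul (RV rTH) (RA rLAM (IV iI))) (RA rK (IV l1))) (RV rKT))) ;;
   PR rLAM (IV iI) (INum 0) (RSub (RA rLAM (IV iI)) (RMul (RV rTH) (RA rLAM (IV iI)))) ;;
   PFor iU 1 1 p_insert"

definition p_step :: prog where
  "p_step =
   p_xval ;; p_select_t ;;
   PIf (IPos (IV iT))
     (p_select_s ;;
      PIf (IPos (IV iS)) p_push (PI iD (IV iT) (INum 0) (IAdd (IA iD (IV iT)) (INum 1))))
     PSkip"

definition p_init :: prog where
  "p_init =
   PFor l1 0 2 (PR rLAM (IV l1) (INum 0) (ROf (INum 0))) ;;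
   PFor l1 0 1 (PI iD (IV l1) (INum 0) (INum 0) ;; PI iM (INum 0) (IV l1) (IV l1)) ;;
   SetI iU (INum 0) ;; p_base ;;
   PR rW (INum 0) (INum 0) (ROf (INum 1)) ;; p_insert"

text \<open>The empty label class is not looked for: all \<open>n + 1\<close> level sets are tried
  and the best is kept. Round 0 overwrites unconditionally, since \<open>rFV\<close> and
  \<open>rCV\<close> may hold values of an earlier call.\<close>

definition p_extract :: prog where
  "p_extract =
   PFor l1 0 1 (
     PFor l2 1 1 (PI iCH (INum 0) (IV l2) (ISub (IA iD (IV l2)) (IV l1))) ;;
     PQ Cost rQ1 (INum 0) (INum 0) iCH (INum 0) ;;
     PQ Reward rQ2 (INum 0) (INum 0) iCH (INum 0) ;;
     PIf (BAnd (IPos (IV l1)) (BNot (RLess (RSub (RMul (RV rA) (RV rFV)) (RV rCV))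
         (RSub (RMul (RV rA) (RV rQ2)) (RV rQ1)))))
       PSkip (SetR rFV (RV rQ2) ;; SetR rCV (RV rQ1)))"

definition p_sfm :: prog where
  "p_sfm = p_init ;; nest 30 10 p_step ;; p_extract"

section \<open>Frame conditions and well-formedness of the programs\<close>

lemma mods_p_chi [simp]: "imods p_chi = {3, 21}" "rmods p_chi = {}"
  by (auto simp: p_chi_def)

lemma mods_p_sums [simp]: "imods (p_sums i l h j l' h' x e) = {i, j}" "rmods (p_sums i l h j l' h' x e) = {x}"
  by (auto simp: p_sums_def)

lemma mods_p_eliminate [simp]: "imods p_eliminate = {20, 21}" "rmods p_eliminate = {8}"
  by (auto simp: p_eliminate_def)

lemma mods_p_base [simp]: "imods p_base = {3, 20, 21}" "rmods p_base = {5, 11, 12, 13, 14}"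
  by (auto simp: p_base_def)

lemma mods_p_find_free [simp]: "imods p_find_free = {7, 20}" "rmods p_find_free = {}"
  by (auto simp: p_find_free_def)

lemma mods_p_pivot [simp]: "imods p_pivot = {8, 9, 20, 21}" "rmods p_pivot = {8, 9}"
  by (auto simp: p_pivot_def)

lemma mods_p_null [simp]: "imods p_null = {8, 9, 20, 21, 22}" "rmods p_null = {8, 9}"
  by (auto simp: p_null_def)

lemma mods_p_reduce [simp]: "imods p_reduce = {7, 8, 9, 20, 21, 22}" "rmods p_reduce = {2, 8, 9, 10}"
  by (auto simp: p_reduce_def)

lemma mods_p_insert [simp]: "imods p_insert = {14, 7, 8, 9, 20, 21, 22}" "rmods p_insert = {2, 3, 8, 9, 10}"
  by (auto simp: p_insert_def)

lemma mods_p_xval [simp]: "imods p_xval = {20, 21}" "rmods p_xval = {4}"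
  by (auto simp: p_xval_def)

lemma mods_p_select_t [simp]: "imods p_select_t = {4, 20}" "rmods p_select_t = {}"
  by (auto simp: p_select_t_def)

lemma mods_p_select_s [simp]: "imods p_select_s = {5, 20, 21}" "rmods p_select_s = {}"
  by (auto simp: p_select_s_def)

lemma mods_p_choose_i [simp]: "imods p_choose_i = {6, 12, 20}" "rmods p_choose_i = {}"
  by (auto simp: p_choose_i_def)

lemma mods_p_moves [simp]: "imods p_moves = {3, 10, 13, 20, 21}" "rmods p_moves = {5, 11, 12, 13, 14}"
  by (auto simp: p_moves_def)

lemma mods_p_triangular [simp]: "imods p_triangular = {20, 21, 22}" "rmods p_triangular = {6, 7}"
  by (auto simp: p_triangular_def)

lemma mods_p_kappa [simp]: "imods p_kappa = {11, 20, 21, 22}" "rmods p_kappa = {6, 7, 15}"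
  by (auto simp: p_kappa_def)

lemma mods_p_push [simp]: "imods p_push = {14, 3, 6, 7, 8, 9, 10, 11, 12, 13, 20, 21, 22}"
  "rmods p_push = {2, 3, 5, 6, 7, 8, 9, 10, 11, 12, 13, 14, 15, 16, 17, 20}"
  by (auto simp: p_push_def)

lemma mods_p_step [simp]: "imods p_step = {14, 2, 3, 4, 5, 6, 7, 8, 9, 10, 11, 12, 13, 20, 21, 22}"
  "rmods p_step = {2, 3, 4, 5, 6, 7, 8, 9, 10, 11, 12, 13, 14, 15, 16, 17, 20}"
  by (auto simp: p_step_def)

lemma mods_p_init [simp]: "imods p_init = {14, 2, 3, 7, 8, 9, 10, 13, 20, 21, 22}"
  "rmods p_init = {2, 3, 5, 8, 9, 10, 11, 12, 13, 14, 17}"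
  by (auto simp: p_init_def)

lemma mods_p_extract [simp]: "imods p_extract = {3, 20, 21}" "rmods p_extract = {11, 12, 18, 19}"
  by (auto simp: p_extract_def)

lemma wf_p_insert: "wf_prog p_insert"
  by (simp add: p_insert_def p_find_free_def p_reduce_def p_null_def p_pivot_def p_sums_def p_eliminate_def p_chi_def)

lemma wf_p_step: "wf_prog p_step"
  by (simp add: p_step_def p_xval_def p_select_t_def p_select_s_def p_push_def p_choose_i_def p_moves_def
      p_kappa_def p_triangular_def p_base_def p_insert_def p_find_free_def p_reduce_def p_null_def p_pivot_def p_sums_def p_eliminate_def p_chi_def)

lemma wf_p_sfm: "wf_prog p_sfm"
proof -
  have "wf_prog (nest 30 10 p_step)" by (rule wf_nest[OF wf_p_step]) auto
  then show ?thesis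
    by (simp add: p_sfm_def p_init_def p_base_def p_chi_def p_extract_def wf_p_insert)
qed

section \<open>Correctness of the submodular minimization\<close>

context oracles
begin

section \<open>Elimination, Caratheodory step and insertion\<close>

lemma p_sums_spec:
  assumes e: "\<And>s' a b. ints s' i 0 0 = a \<Longrightarrow> ints s' j 0 0 = b \<Longrightarrow>
      (\<And>y. y \<noteq> i \<Longrightarrow> y \<noteq> j \<Longrightarrow> ints s' y = ints s y) \<Longrightarrow>
      (\<And>y. y \<noteq> x \<Longrightarrow> reals s' y = reals s y) \<Longrightarrow> rval e s' = G a b"
    and "i \<noteq> j" "l \<le> n + h" "l' \<le> n + h'"
  shows "reals (sem (p_sums i l h j l' h' x e) s) x a b =
    (if b = 0 \<and> l \<le> a \<and> a < n + h then \<Sum>k\<in>{l'..<n + h'}. G a k else reals s x a b)"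
proof -
  let ?in = "PFor j l' h' (PR x (IV i) (INum 0) (RAdd (RA x (IV i)) e))"
  have "reals (sem (p_sums i l h j l' h' x e) s) x a b =
    (if l \<le> (if b = 0 then a else n + h) \<and> (if b = 0 then a else n + h) < n + h
     then \<Sum>k\<in>{l'..<n + h'}. G a k else reals s x a b)"
    unfolding p_sums_def
  proof (rule For_reals[where own = "\<lambda>a b. if b = 0 then a else n + h" and G = "\<lambda>a b. \<Sum>k\<in>{l'..<n + h'}. G a k"])
    fix k :: nat and s' :: state and a b :: nat
    assume k: "l \<le> k" "k < n + h" "ints s' i 0 0 = k"
      and fi: "\<And>y. y \<notin> insert i (imods (PR x (IV i) (INum 0) (ROf (INum 0)) ;; ?in)) \<Longrightarrow> ints s' y = ints s y"
      and fr: "\<And>y. y \<notin> rmods (PR x (IV i) (INum 0) (ROf (INum 0)) ;; ?in) \<Longrightarrow> reals s' y = reals s y"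
    let ?s = "sem (PR x (IV i) (INum 0) (ROf (INum 0))) s'"
    have "reals (sem ?in ?s) x a b =
      (if a = k \<and> b = 0 then reals ?s x a b + (\<Sum>k'\<in>{l'..<n + h'}. G k k') else reals ?s x a b)"
    proof (rule For_sum)
      fix k' :: nat and s'' :: state
      assume "ints s'' j 0 0 = k'"
        and fi': "\<And>y. y \<notin> insert j (imods (PR x (IV i) (INum 0) (RAdd (RA x (IV i)) e))) \<Longrightarrow>
          ints s'' y = ints ?s y"
        and fr': "\<And>y. y \<notin> rmods (PR x (IV i) (INum 0) (RAdd (RA x (IV i)) e)) \<Longrightarrow> reals s'' y = reals ?s y"
      have i: "ints s'' i 0 0 = k" using fi'[of i] assms(2) k by simp
      have "rval e s'' = G k k'"
      proof (rule e[OF i \<open>ints s'' j 0 0 = k'\<close>])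
        fix y assume y: "y \<noteq> i" "y \<noteq> j"
        show "ints s'' y = ints s y" using fi'[of y] fi[of y] y by simp
      next
        fix y assume y: "y \<noteq> x"
        show "reals s'' y = reals s y" using fr'[of y] fr[of y] y by simp
      qed
      then show "reals (sem (PR x (IV i) (INum 0) (RAdd (RA x (IV i)) e)) s'') x =
          update (reals s'') x k 0 (reals s'' x k 0 + G k k') x"
        using i by simp
    qed (use assms in auto)
    then show "reals (sem (PR x (IV i) (INum 0) (ROf (INum 0)) ;; ?in) s') x a b =
       (if (if b = 0 then a else n + h) = k then \<Sum>k\<in>{l'..<n + h'}. G a k else reals s' x a b)"
      using k by (simp add: update_apply)
  qed (use assms in auto)
  then show ?thesis by (simp split: if_splits)
qed

lemma p_find_free_spec:
  fixes s
  defines "s' \<equiv> sem p_find_free s"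
  obtains "ints s' iJ 0 0 = 0" "\<And>r. r < n + 2 \<Longrightarrow> 0 < reals s rLAM r 0"
  | "0 < ints s' iJ 0 0" "ints s' iJ 0 0 - 1 < n + 2" "\<not> 0 < reals s rLAM (ints s' iJ 0 0 - 1) 0"
proof -
  have "(\<exists>k. 0 \<le> k \<and> k < n + 2 \<and> \<not> 0 < reals s rLAM k 0 \<and>
      (\<forall>j. k < j \<and> j < n + 2 \<longrightarrow> \<not> \<not> 0 < reals s rLAM j 0) \<and> ints s' iJ 0 0 = Suc k) \<or>
    (\<forall>k. 0 \<le> k \<and> k < n + 2 \<longrightarrow> \<not> \<not> 0 < reals s rLAM k 0) \<and>
      ints s' iJ 0 0 = ints (sem (SetI iJ (INum 0)) s) iJ 0 0"
    unfolding s'_def p_find_free_def sem.simps(5)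
    by (rule For_search) (auto simp: update_apply)
  then show thesis using that by (auto simp: update_apply)
qed

lemma p_eliminate_spec:
  assumes P: "0 < ints s iUS (ints s iP 0 0) 0" "r < n + 2" "j < n + 2"
  shows "reals (sem p_eliminate s) rC r j =
    (if 0 < ints s iUS r 0 then reals s rC r j
     else reals s rC r j - reals s rL r 0 / reals s rL (ints s iP 0 0) 0 * reals s rC (ints s iP 0 0) j)"
proof -
  let ?p = "ints s iP 0 0"
  let ?G = "\<lambda>r j. if 0 < ints s iUS r 0 \<or> n + 2 \<le> j then reals s rC r j
     else reals s rC r j - reals s rL r 0 / reals s rL ?p 0 * reals s rC ?p j"
  let ?upd = "PR rC (IV l1) (IV l2) (RSub (RGet rC (IV l1) (IV l2))
       (RMul (RDiv (RA rL (IV l1)) (RA rL (IV iP))) (RGet rC (IV iP) (IV l2))))"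
  let ?body = "PIf (IPos (IA iUS (IV l1))) PSkip (PFor l2 0 2 ?upd)"
  have "\<forall>a b. reals (sem p_eliminate s) rC a b = (if a < n + 2 then ?G a b else reals s rC a b)"
    unfolding p_eliminate_def
  proof (rule sem_For_rule[where I = "\<lambda>k s'. \<forall>a b. reals s' rC a b = (if a < k then ?G a b else reals s rC a b)"])
    fix k :: nat and s' :: state
    assume k: "k < n + 2" and I: "\<forall>a b. reals s' rC a b = (if a < k then ?G a b else reals s rC a b)"
      and l1: "ints s' l1 0 0 = k"
      and fi: "\<And>x. x \<notin> insert l1 (imods ?body) \<Longrightarrow> ints s' x = ints s x"
      and fr: "\<And>x. x \<notin> rmods ?body \<Longrightarrow> reals s' x = reals s x"
    have US: "ints s' iUS = ints s iUS" "ints s' iP = ints s iP" "reals s' rL = reals s rL"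
      using fi fr by auto
    have p: "reals s' rC ?p b = reals s rC ?p b" for b using I P(1) by auto
    have "reals (sem ?body s') rC a b = (if a = k then ?G a b else reals s' rC a b)" for a b
    proof (cases "0 < ints s iUS k 0")
      case True
      then show ?thesis using I l1 US by auto
    next
      case False
      then have kp: "k \<noteq> ?p" using P by auto
      have "reals (sem (PFor l2 0 2 ?upd) s') rC a b =
        (if 0 \<le> (if a = k then b else n + 2) \<and> (if a = k then b else n + 2) < n + 2 then ?G k b else reals s' rC a b)"
      proof (rule For_reals)
        fix m :: nat and s'' :: state and a b :: nat
        assume m: "ints s'' l2 0 0 = m" "m < n + 2"
          and fi': "\<And>x. x \<notin> insert l2 (imods ?upd) \<Longrightarrow> ints s'' x = ints s' x"
          and fr': "\<And>x. x \<notin> rmods ?upd \<Longrightarrow> reals s'' x = reals s' x"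
          and un: "\<And>a b. m \<le> (if a = k then b else n + 2) \<Longrightarrow> reals s'' rC a b = reals s' rC a b"
        have eqs: "ints s'' l1 0 0 = k" "ints s'' iP = ints s iP" "reals s'' rL = reals s rL"
          using fi' fr' l1 US by auto
        have "reals s'' rC ?p m = reals s rC ?p m" using un[of ?p m] kp p m by simp
        moreover have "reals s'' rC k m = reals s rC k m" using un[of k m] I by simp
        ultimately show "reals (sem ?upd s'') rC a b =
            (if (if a = k then b else n + 2) = m then ?G k b else reals s'' rC a b)"
          using m False eqs by (auto simp: update_apply)
      qed simp
      then show ?thesis using False l1 US I by auto
    qed
    then show "\<forall>a b. reals (seti l1 (Suc k) (sem ?body s')) rC a b =
        (if a < Suc k then ?G a b else reals s rC a b)"
      using I by (auto simp: less_Suc_eq)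
  qed auto
  then show ?thesis using P by auto
qed

lemma p_pivot_spec:
  assumes "null_rows (n + 2) (reals s rB) k (reals s rC) (\<lambda>r. 0 < ints s iUS r 0)" "ints s l3 0 0 = k"
  shows "null_rows (n + 2) (reals s rB) (Suc k) (reals (sem p_pivot s) rC) (\<lambda>r. 0 < ints (sem p_pivot s) iUS r 0)"
proof -
  let ?L = "\<lambda>r. \<Sum>j<n+2. reals s rC r j * reals s rB j k"
  define s1 where "s1 = sem (p_sums l1 0 2 l2 0 2 rL (RMul (RGet rC (IV l1) (IV l2)) (RGet rB (IV l2) (IV l3)))) s"
  define s2 where "s2 = sem (SetI iP (INum 0)) s1"
  let ?b = "BAnd (BNot (IPos (IA iUS (IV l1)))) (RPos (RMul (RA rL (IV l1)) (RA rL (IV l1))))"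
  define s3 where "s3 = sem (PFor l1 0 2 (PIf ?b (SetI iP (IAdd (IV l1) (INum 1))) PSkip)) s2"
  have fr1: "ints s1 iUS = ints s iUS" "reals s1 rC = reals s rC" by (simp_all add: s1_def)
  have L: "reals s1 rL r 0 = ?L r" if "r < n + 2" for r
    unfolding s1_def
    by (subst p_sums_spec[where G = "\<lambda>r j. reals s rC r j * reals s rB j k"])
      (use assms(2) that in \<open>simp_all add: atLeast0LessThan\<close>)
  have fr3: "ints s3 iUS = ints s iUS" "reals s3 rC = reals s rC" "reals s3 rL = reals s1 rL"
    by (simp_all add: s3_def s2_def fr1)
  have "(\<exists>k. 0 \<le> k \<and> k < n + 2 \<and> (\<not> 0 < ints s iUS k 0 \<and> reals s1 rL k 0 \<noteq> 0) \<and>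
      (\<forall>j. k < j \<and> j < n + 2 \<longrightarrow> \<not> (\<not> 0 < ints s iUS j 0 \<and> reals s1 rL j 0 \<noteq> 0)) \<and> ints s3 iP 0 0 = Suc k) \<or>
    (\<forall>k. 0 \<le> k \<and> k < n + 2 \<longrightarrow> \<not> (\<not> 0 < ints s iUS k 0 \<and> reals s1 rL k 0 \<noteq> 0)) \<and> ints s3 iP 0 0 = ints s2 iP 0 0"
    unfolding s3_def
    by (rule For_search) (auto simp: update_apply s2_def fr1 zero_less_mult_iff)
  then consider p where "p < n + 2" "\<not> 0 < ints s iUS p 0" "reals s1 rL p 0 \<noteq> 0" "ints s3 iP 0 0 = Suc p"
    | "\<forall>r<n+2. \<not> (\<not> 0 < ints s iUS r 0 \<and> reals s1 rL r 0 \<noteq> 0)" "ints s3 iP 0 0 = 0"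
    by (auto simp: s2_def update_apply)
  then show ?thesis
  proof cases
    case (1 p)
    define s4 where "s4 = sem (SetI iP (ISub (IV iP) (INum 1)) ;; PI iUS (IV iP) (INum 0) (INum 1)) s3"
    have s4: "sem p_pivot s = sem p_eliminate s4"
      using 1(4) unfolding p_pivot_def sem.simps(5,6) s1_def[symmetric] s2_def[symmetric] s3_def[symmetric]
      by (simp add: s4_def)
    have US: "ints s4 iUS r 0 = (if r = p then 1 else ints s iUS r 0)" "ints s4 iP 0 0 = p"
      "reals s4 rC = reals s rC" "reals s4 rL = reals s1 rL" for r
      using 1(4) by (simp_all add: s4_def fr3 update_apply)
    show ?thesis
      unfolding s4
    proof (rule null_rows_pivot[OF assms(1) 1(1-3) L])
      fix r assume "r < n + 2"
      show "0 < ints (sem p_eliminate s4) iUS r 0 \<longleftrightarrow> 0 < ints s iUS r 0 \<or> r = p"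
        using US by simp
    next
      fix r j assume rj: "r < n + 2" "j < n + 2"
      show "reals (sem p_eliminate s4) rC r j = (if 0 < ints (sem p_eliminate s4) iUS r 0 then reals s rC r j
          else reals s rC r j - reals s1 rL r 0 / reals s1 rL p 0 * reals s rC p j)"
        using p_eliminate_spec[of s4 r j] rj US by simp
    qed
  next
    case 2
    have s4: "sem p_pivot s = s3"
      using 2(2) unfolding p_pivot_def sem.simps(5,6) s1_def[symmetric] s2_def[symmetric] s3_def[symmetric]
      by simp
    show ?thesis unfolding s4 fr3
    proof (rule null_rows_skip[OF assms(1)])
      fix r assume r: "r < n + 2" "\<not> 0 < ints s iUS r 0"
      then have "reals s1 rL r 0 = 0" using 2(1) by blast
      then show "?L r = 0" using L[OF r(1)] by (simp only:)
    qed
  qed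
qed

lemma p_null_spec:
  "null_rows (n + 2) (reals s rB) (n + 1) (reals (sem p_null s) rC) (\<lambda>r. 0 < ints (sem p_null s) iUS r 0)"
proof -
  let ?in = "PFor l2 0 2 (PR rC (IV l1) (IV l2)
       (ROf (ISub (INum 1) (IAdd (ISub (IV l1) (IV l2)) (ISub (IV l2) (IV l1))))))"
  let ?body = "PI iUS (IV l1) (INum 0) (INum 0) ;; ?in"
  let ?s = "sem (PFor l1 0 2 ?body) s"
  have id: "\<forall>a<n+2. ints ?s iUS a 0 = 0 \<and> (\<forall>b<n+2. reals ?s rC a b = (if a = b then 1 else 0))"
  proof (rule sem_For_rule[where I = "\<lambda>k s'. \<forall>a<k. ints s' iUS a 0 = 0 \<and>
      (\<forall>b<n+2. reals s' rC a b = (if a = b then 1 else 0))"])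
    fix k :: nat and s' :: state
    assume k: "k < n + 2" and I: "\<forall>a<k. ints s' iUS a 0 = 0 \<and>
      (\<forall>b<n+2. reals s' rC a b = (if a = b then 1 else 0))" and l1: "ints s' l1 0 0 = k"
    let ?s' = "sem (PI iUS (IV l1) (INum 0) (INum 0)) s'"
    have C: "reals (sem ?in ?s') rC a b = (if 0 \<le> (if a = k then b else n + 2) \<and> (if a = k then b else n + 2) < n + 2
      then (if k = b then 1 else 0) else reals ?s' rC a b)" for a b
      by (rule For_reals) (use l1 in \<open>auto simp: update_apply\<close>)
    then have C': "reals (sem ?body s') rC a b = (if a = k then (if k = b then 1 else 0) else reals s' rC a b)"
      if "b < n + 2" for a b using that by simp
    have "ints (sem ?body s') iUS a 0 = (if a = k then 0 else ints s' iUS a 0)" for a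
      using l1 by (simp add: update_apply)
    with C' I show "\<forall>a<Suc k. ints (seti l1 (Suc k) (sem ?body s')) iUS a 0 = 0 \<and>
        (\<forall>b<n+2. reals (seti l1 (Suc k) (sem ?body s')) rC a b = (if a = b then 1 else 0))"
      by (auto simp: less_Suc_eq simp del: sem.simps)
  qed auto
  have B: "reals ?s rB = reals s rB" by simp
  have "null_rows (n + 2) (reals s rB) (n + 1) (reals (sem (PFor l3 0 1 p_pivot) ?s) rC)
    (\<lambda>r. 0 < ints (sem (PFor l3 0 1 p_pivot) ?s) iUS r 0)"
  proof (rule sem_For_rule[where I = "\<lambda>k s'. null_rows (n + 2) (reals s rB) k (reals s' rC) (\<lambda>r. 0 < ints s' iUS r 0)"])
    have "{r. r < n + 2 \<and> 0 < ints ?s iUS r 0} = {}" using id by auto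
    then show "null_rows (n + 2) (reals s rB) 0 (reals (seti l3 0 ?s) rC) (\<lambda>r. 0 < ints (seti l3 0 ?s) iUS r 0)"
      using id unfolding null_rows_def by simp
  next
    fix k :: nat and s' :: state
    assume "null_rows (n + 2) (reals s rB) k (reals s' rC) (\<lambda>r. 0 < ints s' iUS r 0)" "ints s' l3 0 0 = k"
      "\<And>x. x \<notin> rmods p_pivot \<Longrightarrow> reals s' x = reals ?s x"
    moreover from this(3) have "reals s' rB = reals s rB" by simp
    ultimately show "null_rows (n + 2) (reals s rB) (Suc k) (reals (seti l3 (Suc k) (sem p_pivot s')) rC)
        (\<lambda>r. 0 < ints (seti l3 (Suc k) (sem p_pivot s')) iUS r 0)"
      using p_pivot_spec[of s' k] by simp
  qed simp
  then show ?thesis by (simp add: p_null_def)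
qed

text \<open>The slot of smallest ratio between weight and positive null-vector entry drops to 0 and
  no other becomes negative. The preserved sums include column 0, through which the total weight is
  preserved as well.\<close>

lemma p_reduce_spec:
  assumes pos: "\<And>r. r < n + 2 \<Longrightarrow> 0 < reals s rLAM r 0"
  defines "s' \<equiv> sem p_reduce s"
  shows "\<And>r. r < n + 2 \<Longrightarrow> 0 \<le> reals s' rLAM r 0"
    and "ints s' iJ 0 0 < n + 2" "reals s' rLAM (ints s' iJ 0 0) 0 = 0"
    and "\<And>i. i \<le> n \<Longrightarrow> (\<Sum>r<n+2. reals s' rLAM r 0 * reals s rB r i) = (\<Sum>r<n+2. reals s rLAM r 0 * reals s rB r i)"
proof -
  define s1 where "s1 = sem (SetI iP (INum 0)) (sem p_null s)"
  define s2 where "s2 = sem (PFor l1 0 2 (PIf (IPos (IA iUS (IV l1))) PSkip (SetI iP (IV l1)))) s1"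
  define s3 where "s3 = sem (SetI iJ (IV iP)) s2"
  let ?p = "ints s2 iP 0 0"
  let ?\<mu> = "reals (sem p_null s) rC ?p"
  let ?w = "\<lambda>r. reals s rLAM r 0"
  let ?body = "PIf (BAnd (RPos (RGet rC (IV iP) (IV l1)))
       (RLess (RDiv (RA rLAM (IV l1)) (RGet rC (IV iP) (IV l1)))
         (RDiv (RA rLAM (IV iJ)) (RGet rC (IV iP) (IV iJ))))) (SetI iJ (IV l1)) PSkip"
  define s4 where "s4 = sem (PFor l1 0 2 ?body) s3"
  define s5 where "s5 = sem (SetR rTH (RDiv (RA rLAM (IV iJ)) (RGet rC (IV iP) (IV iJ)))) s4"
  let ?J = "ints s4 iJ 0 0"
  let ?\<theta> = "?w ?J / ?\<mu> ?J"
  have nr: "null_rows (n + 2) (reals s rB) (n + 1) (reals (sem p_null s) rC) (\<lambda>r. 0 < ints (sem p_null s) iUS r 0)"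
    by (rule p_null_spec)
  obtain r0 where r0: "r0 < n + 2" "\<not> 0 < ints (sem p_null s) iUS r0 0"
    using null_rows_unused[OF nr] by auto
  have "(\<exists>k. 0 \<le> k \<and> k < n + 2 \<and> \<not> 0 < ints (sem p_null s) iUS k 0 \<and>
      (\<forall>j. k < j \<and> j < n + 2 \<longrightarrow> \<not> \<not> 0 < ints (sem p_null s) iUS j 0) \<and> ints s2 iP 0 0 = k) \<or>
    (\<forall>k. 0 \<le> k \<and> k < n + 2 \<longrightarrow> \<not> \<not> 0 < ints (sem p_null s) iUS k 0) \<and> ints s2 iP 0 0 = ints s1 iP 0 0"
    unfolding s2_def by (rule For_search) (auto simp: update_apply s1_def)
  then have p: "?p < n + 2" "\<not> 0 < ints (sem p_null s) iUS ?p 0" using r0 by auto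
  have \<mu>: "?\<mu> ?p = 1" "\<And>i. i \<le> n \<Longrightarrow> (\<Sum>j<n+2. ?\<mu> j * reals s rB j i) = 0"
    using nr p unfolding null_rows_def by auto
  have fr3: "reals s3 rC = reals (sem p_null s) rC" "reals s3 rLAM = reals s rLAM" "ints s3 iP = ints s2 iP"
    by (simp_all add: s3_def s2_def s1_def)
  have J: "?J < n + 2 \<and> 0 < ?\<mu> ?J \<and> (\<forall>r<n+2. 0 < ?\<mu> r \<longrightarrow> ?w ?J / ?\<mu> ?J \<le> ?w r / ?\<mu> r)"
    unfolding s4_def
  proof (rule sem_For_rule[where I = "\<lambda>k s'. ints s' iJ 0 0 < n + 2 \<and> 0 < ?\<mu> (ints s' iJ 0 0) \<and>
      (\<forall>r<k. 0 < ?\<mu> r \<longrightarrow> ?w (ints s' iJ 0 0) / ?\<mu> (ints s' iJ 0 0) \<le> ?w r / ?\<mu> r)"])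
    show "ints (seti l1 0 s3) iJ 0 0 < n + 2 \<and> 0 < ?\<mu> (ints (seti l1 0 s3) iJ 0 0) \<and>
      (\<forall>r<0. 0 < ?\<mu> r \<longrightarrow> ?w (ints (seti l1 0 s3) iJ 0 0) / ?\<mu> (ints (seti l1 0 s3) iJ 0 0) \<le> ?w r / ?\<mu> r)"
      using p \<mu>(1) by (simp add: s3_def update_apply)
  next
    fix k :: nat and s' :: state
    assume k: "k < n + 2" and I: "ints s' iJ 0 0 < n + 2 \<and> 0 < ?\<mu> (ints s' iJ 0 0) \<and>
        (\<forall>r<k. 0 < ?\<mu> r \<longrightarrow> ?w (ints s' iJ 0 0) / ?\<mu> (ints s' iJ 0 0) \<le> ?w r / ?\<mu> r)"
      and l1: "ints s' l1 0 0 = k"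
      and fi: "\<And>x. x \<notin> insert l1 (imods ?body) \<Longrightarrow> ints s' x = ints s3 x"
      and fr: "\<And>x. x \<notin> rmods ?body \<Longrightarrow> reals s' x = reals s3 x"
    have eqs: "reals s' rC = reals (sem p_null s) rC" "reals s' rLAM = reals s rLAM" "ints s' iP = ints s2 iP"
      using fi fr fr3 by simp_all
    have "ints (sem ?body s') iJ 0 0 = (if 0 < ?\<mu> k \<and> ?w k / ?\<mu> k < ?w (ints s' iJ 0 0) / ?\<mu> (ints s' iJ 0 0)
        then k else ints s' iJ 0 0)"
      using l1 by (simp add: eqs update_apply)
    then have j: "ints (seti l1 (Suc k) (sem ?body s')) iJ 0 0 =
        (if 0 < ?\<mu> k \<and> ?w k / ?\<mu> k < ?w (ints s' iJ 0 0) / ?\<mu> (ints s' iJ 0 0)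
        then k else ints s' iJ 0 0)" by simp
    show "ints (seti l1 (Suc k) (sem ?body s')) iJ 0 0 < n + 2 \<and>
        0 < ?\<mu> (ints (seti l1 (Suc k) (sem ?body s')) iJ 0 0) \<and>
        (\<forall>r<Suc k. 0 < ?\<mu> r \<longrightarrow> ?w (ints (seti l1 (Suc k) (sem ?body s')) iJ 0 0) /
          ?\<mu> (ints (seti l1 (Suc k) (sem ?body s')) iJ 0 0) \<le> ?w r / ?\<mu> r)"
      unfolding j using I k by (auto simp: less_Suc_eq intro: order_trans[OF less_imp_le])
  qed simp
  have fr5: "reals s5 rC = reals (sem p_null s) rC" "reals s5 rLAM = reals s rLAM" "ints s5 iP = ints s2 iP"
    "ints s5 iJ = ints s4 iJ"
    by (simp_all add: s5_def s4_def fr3)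
  have th: "reals s5 rTH 0 0 = ?\<theta>"
    by (simp add: s5_def s4_def fr3 update_apply)
  have s': "s' = sem (PFor l1 0 2 (PR rLAM (IV l1) (INum 0)
      (RSub (RA rLAM (IV l1)) (RMul (RV rTH) (RGet rC (IV iP) (IV l1)))))) s5"
    unfolding s'_def p_reduce_def by (simp add: s5_def s4_def s3_def s2_def s1_def)
  have "reals s' rLAM r b = (if 0 \<le> (if b = 0 then r else n + 2) \<and> (if b = 0 then r else n + 2) < n + 2
    then ?w r - ?\<theta> * ?\<mu> r else reals s5 rLAM r b)" for r b
    unfolding s' by (rule For_reals) (auto simp: update_apply th fr5)
  then have lam: "reals s' rLAM r 0 = ?w r - ?\<theta> * ?\<mu> r" if "r < n + 2" for r using that by simp
  have J': "ints s' iJ = ints s4 iJ" by (simp add: s' fr5)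
  show "ints s' iJ 0 0 < n + 2" "reals s' rLAM (ints s' iJ 0 0) 0 = 0"
    using J by (auto simp: J' lam)
  have "0 \<le> ?\<theta>" using J pos[of ?J] by simp
  show "0 \<le> reals s' rLAM r 0" if r: "r < n + 2" for r
  proof (cases "0 < ?\<mu> r")
    case True
    then have "?\<theta> * ?\<mu> r \<le> ?w r" using J r by (simp add: pos_le_divide_eq)
    then show ?thesis using lam[OF r] by simp
  next
    case False
    then have "?\<theta> * ?\<mu> r \<le> 0" using \<open>0 \<le> ?\<theta>\<close> by (intro mult_nonneg_nonpos) auto
    then show ?thesis using lam[OF r] pos[OF r] by simp
  qed
  fix i assume i: "i \<le> n"
  have "(\<Sum>r<n+2. reals s' rLAM r 0 * reals s rB r i) =
      (\<Sum>r<n+2. ?w r * reals s rB r i - ?\<theta> * (?\<mu> r * reals s rB r i))"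
    by (intro sum.cong) (auto simp: lam algebra_simps)
  also have "\<dots> = (\<Sum>r<n+2. ?w r * reals s rB r i) - ?\<theta> * (\<Sum>r<n+2. ?\<mu> r * reals s rB r i)"
    by (simp only: sum_subtractf sum_distrib_left)
  finally show "(\<Sum>r<n+2. reals s' rLAM r 0 * reals s rB r i) = (\<Sum>r<n+2. ?w r * reals s rB r i)"
    using \<mu>(2)[OF i] by simp
qed

text \<open>The last claim records where each occupied slot comes from; correct rows and valid
  labels are derived from it later.\<close>

lemma p_insert_spec:
  fixes s
  defines "u \<equiv> ints s iU 0 0"
  defines "s' \<equiv> sem p_insert s"
  assumes nonneg: "\<forall>r<n+2. 0 \<le> reals s rLAM r 0" and z: "reals s rLAM 0 0 = 0"
    and W: "0 \<le> reals s rW u 0"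
  shows "\<And>r. r < n + 2 \<Longrightarrow> 0 \<le> reals s' rLAM r 0" "reals s' rLAM 0 0 = 0"
    and "\<And>i. i \<le> n \<Longrightarrow> (\<Sum>r<n+2. reals s' rLAM r 0 * reals s' rB r i) =
      (\<Sum>r<n+2. reals s rLAM r 0 * reals s rB r i) + reals s rW u 0 * reals s rE u i"
    and "\<And>r. r < n + 2 \<Longrightarrow> 0 < reals s' rLAM r 0 \<Longrightarrow>
      0 < reals s rLAM r 0 \<and> (\<forall>i\<le>n. ints s' iR r i = ints s iR r i \<and> reals s' rB r i = reals s rB r i) \<or>
      0 < reals s rW u 0 \<and> (\<forall>i\<le>n. ints s' iR r i = ints s iM u i \<and> reals s' rB r i = reals s rE u i)"
proof -
  have nn: "\<And>r. r < n + 2 \<Longrightarrow> 0 \<le> reals s rLAM r 0" using nonneg by blast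
  let ?body1 = "PI iR (INum 0) (IV l1) (IGet iM (IV iU) (IV l1)) ;;
     PR rB (INum 0) (IV l1) (RGet rE (IV iU) (IV l1))"
  let ?body2 = "PI iR (IV iJ) (IV l1) (IGet iR (INum 0) (IV l1)) ;;
     PR rB (IV iJ) (IV l1) (RGet rB (INum 0) (IV l1))"
  define s1 where "s1 = sem (PFor l1 0 1 ?body1) s"
  define s2 where "s2 = sem (PR rLAM (INum 0) (INum 0) (RA rW (IV iU))) s1"
  define s3 where "s3 = sem p_find_free s2"
  define s4 where "s4 = sem (PIf (IPos (IV iJ)) (SetI iJ (ISub (IV iJ) (INum 1))) p_reduce) s3"
  define s5 where "s5 = sem (PFor l1 0 1 ?body2) s4"
  have s': "s' = sem (PR rLAM (INum 0) (INum 0) (ROf (INum 0))) (sem (PR rLAM (IV iJ) (INum 0) (RA rLAM (INum 0))) s5)"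
    unfolding s'_def p_insert_def s5_def s4_def s3_def s2_def s1_def sem.simps(5) ..
  have R1: "ints s1 iR a b = (if 0 \<le> (if a = 0 then b else n + 1) \<and> (if a = 0 then b else n + 1) < n + 1
      then ints s iM u b else ints s iR a b)" for a b
    unfolding s1_def by (rule For_ints) (auto simp: update_apply u_def)
  have B1: "reals s1 rB a b = (if 0 \<le> (if a = 0 then b else n + 1) \<and> (if a = 0 then b else n + 1) < n + 1
      then reals s rE u b else reals s rB a b)" for a b
    unfolding s1_def by (rule For_reals) (auto simp: update_apply u_def)
  have R2: "ints s2 iR a b = (if a = 0 \<and> b \<le> n then ints s iM u b else ints s iR a b)" for a b
    using R1[of a b] by (simp add: s2_def)
  have B2: "reals s2 rB a b = (if a = 0 \<and> b \<le> n then reals s rE u b else reals s rB a b)" for a b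
    using B1[of a b] by (simp add: s2_def)
  have L2: "reals s2 rLAM r 0 = (if r = 0 then reals s rW u 0 else reals s rLAM r 0)" for r
    by (simp add: s2_def s1_def update_apply u_def)
  have L2nn: "0 \<le> reals s2 rLAM r 0" if "r < n + 2" for r using nn[OF that] W by (simp add: L2)
  let ?J = "ints s4 iJ 0 0"
  have fr4: "ints s4 iR = ints s2 iR" "reals s4 rB = reals s2 rB"
    by (simp_all add: s4_def s3_def)
  have fr3: "reals s3 rB = reals s2 rB" "reals s3 rLAM = reals s2 rLAM"
    by (simp_all add: s3_def)
  have J: "?J < n + 2 \<and> reals s4 rLAM ?J 0 = 0 \<and> (\<forall>r<n+2. 0 \<le> reals s4 rLAM r 0 \<and>
      (0 < reals s4 rLAM r 0 \<longrightarrow> 0 < reals s2 rLAM r 0)) \<and>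
    (\<forall>i\<le>n. (\<Sum>r<n+2. reals s4 rLAM r 0 * reals s2 rB r i) = (\<Sum>r<n+2. reals s2 rLAM r 0 * reals s2 rB r i))"
  proof (rule p_find_free_spec[of s2])
    assume 1: "ints (sem p_find_free s2) iJ 0 0 = 0" "\<And>r. r < n + 2 \<Longrightarrow> 0 < reals s2 rLAM r 0"
    have s4: "s4 = sem p_reduce s3" using 1(1) by (simp add: s4_def s3_def)
    have pos: "0 < reals s3 rLAM r 0" if "r < n + 2" for r using 1(2)[OF that] by (simp add: fr3)
    show ?thesis
      using p_reduce_spec[of s3, OF pos] 1(2) unfolding s4 fr3 by blast
  next
    assume 2: "0 < ints (sem p_find_free s2) iJ 0 0" "ints (sem p_find_free s2) iJ 0 0 - 1 < n + 2"
      "\<not> 0 < reals s2 rLAM (ints (sem p_find_free s2) iJ 0 0 - 1) 0"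
    have s4: "s4 = sem (SetI iJ (ISub (IV iJ) (INum 1))) s3" using 2(1) by (simp add: s4_def s3_def)
    have J: "?J = ints (sem p_find_free s2) iJ 0 0 - 1" unfolding s4 by (simp add: s3_def update_apply)
    have L: "reals s4 rLAM = reals s2 rLAM" unfolding s4 by (simp add: s3_def)
    show ?thesis using 2 L2nn unfolding L J by (simp add: antisym[OF _ L2nn] not_less)
  qed
  have R5: "ints s5 iR a b = (if 0 \<le> (if a = ?J then b else n + 1) \<and> (if a = ?J then b else n + 1) < n + 1
      then ints s4 iR 0 b else ints s4 iR a b)" for a b
    unfolding s5_def
  proof (rule For_ints)
    fix k a b and t :: state
    assume k: "ints t l1 0 0 = k" "k < n + 1"
      and fi: "\<And>x. x \<notin> insert l1 (imods ?body2) \<Longrightarrow> ints t x = ints s4 x"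
      and un: "\<And>a b. k \<le> (if a = ?J then b else n + 1) \<Longrightarrow> ints t iR a b = ints s4 iR a b"
    have "ints t iR 0 k = ints s4 iR 0 k" using un[of 0 k] k by simp
    moreover have "ints t iJ = ints s4 iJ" using fi by simp
    ultimately show "ints (sem ?body2 t) iR a b =
       (if (if a = ?J then b else n + 1) = k then ints s4 iR 0 b else ints t iR a b)"
      using k by (simp add: update_apply)
  qed auto
  have B5: "reals s5 rB a b = (if 0 \<le> (if a = ?J then b else n + 1) \<and> (if a = ?J then b else n + 1) < n + 1
      then reals s4 rB 0 b else reals s4 rB a b)" for a b
    unfolding s5_def
  proof (rule For_reals)
    fix k a b and t :: state
    assume k: "ints t l1 0 0 = k" "k < n + 1"
      and fi: "\<And>x. x \<notin> insert l1 (imods ?body2) \<Longrightarrow> ints t x = ints s4 x"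
      and un: "\<And>a b. k \<le> (if a = ?J then b else n + 1) \<Longrightarrow> reals t rB a b = reals s4 rB a b"
    have "reals t rB 0 k = reals s4 rB 0 k" using un[of 0 k] k by simp
    moreover have "ints t iJ = ints s4 iJ" using fi by simp
    ultimately show "reals (sem ?body2 t) rB a b =
       (if (if a = ?J then b else n + 1) = k then reals s4 rB 0 b else reals t rB a b)"
      using k by (simp add: update_apply)
  qed auto
  have L5: "reals s5 rLAM = reals s4 rLAM" "ints s5 iJ = ints s4 iJ" by (simp_all add: s5_def)
  have L': "reals s' rLAM r 0 = (if r = 0 then 0 else if r = ?J then reals s4 rLAM 0 0 else reals s4 rLAM r 0)" for r
    by (simp add: s' L5 update_apply)
  have R': "ints s' iR a b = (if a = ?J then ints s2 iR 0 b else ints s2 iR a b)" if "b \<le> n" for a b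
    using R5[of a b] that by (simp add: s' fr4)
  have B': "reals s' rB a b = (if a = ?J then reals s2 rB 0 b else reals s2 rB a b)" if "b \<le> n" for a b
    using B5[of a b] that by (simp add: s' fr4)
  show "0 \<le> reals s' rLAM r 0" if "r < n + 2" for r using J that by (simp add: L')
  show "reals s' rLAM 0 0 = 0" by (simp add: L')
  { fix i assume i: "i \<le> n"
    \<comment> \<open>Slot 0 moves to slot \<open>?J\<close>, whose weight is 0; if
      \<open>?J\<close> is 0 itself, the two corrections cancel.\<close>
    let ?X = "reals s4 rLAM 0 0 * reals s2 rB 0 i"
    have "(\<Sum>r<n+2. reals s' rLAM r 0 * reals s' rB r i) =
      (\<Sum>r<n+2. reals s4 rLAM r 0 * reals s2 rB r i + (if r = ?J then ?X else 0) - (if r = 0 then ?X else 0))"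
      using J by (intro sum.cong) (auto simp: L' B'[OF i])
    also have "\<dots> = (\<Sum>r<n+2. reals s4 rLAM r 0 * reals s2 rB r i)"
      using J by (simp add: sum.distrib sum_subtractf del: sum.lessThan_Suc)
    also have "\<dots> = (\<Sum>r<n+2. reals s2 rLAM r 0 * reals s2 rB r i)" using J i by blast
    also have "\<dots> = (\<Sum>r<n+2. reals s rLAM r 0 * reals s rB r i + (if r = 0 then reals s rW u 0 * reals s rE u i else 0))"
      using i z by (intro sum.cong) (auto simp: L2 B2)
    also have "\<dots> = (\<Sum>r<n+2. reals s rLAM r 0 * reals s rB r i) + reals s rW u 0 * reals s rE u i"
      by (simp add: sum.distrib del: sum.lessThan_Suc)
    finally show "(\<Sum>r<n+2. reals s' rLAM r 0 * reals s' rB r i) =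
      (\<Sum>r<n+2. reals s rLAM r 0 * reals s rB r i) + reals s rW u 0 * reals s rE u i" . }
  fix r assume r: "r < n + 2" "0 < reals s' rLAM r 0"
  then have r0: "r \<noteq> 0" using L'[of 0] by (intro notI) simp
  show "0 < reals s rLAM r 0 \<and> (\<forall>i\<le>n. ints s' iR r i = ints s iR r i \<and> reals s' rB r i = reals s rB r i) \<or>
      0 < reals s rW u 0 \<and> (\<forall>i\<le>n. ints s' iR r i = ints s iM u i \<and> reals s' rB r i = reals s rE u i)"
  proof (cases "r = ?J")
    case True
    then have "0 < reals s4 rLAM 0 0" using r r0 by (simp add: L')
    then have "0 < reals s2 rLAM 0 0" using J by simp
    then show ?thesis using True r0 by (intro disjI2) (simp add: L2 R' B' R2 B2)
  next
    case False
    then have "0 < reals s4 rLAM r 0" using r r0 by (simp add: L')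
    then have "0 < reals s2 rLAM r 0" using J r by simp
    then show ?thesis using False r0 by (intro disjI1) (simp add: L2 R' B' R2 B2)
  qed
qed

end

text \<open>The function to be minimized depends on the contract, which the search changes from call
  to call.\<close>

locale contract_at = contract +
  fixes \<alpha> :: real
  assumes \<alpha>: "0 \<le> \<alpha>"

sublocale contract \<subseteq> oracles n f c .

sublocale contract_at \<subseteq> submodular_fun n "\<lambda>S. c S - \<alpha> * f S"
proof
  show "submodular_on {1..n} (\<lambda>S. c S - \<alpha> * f S)"
    using utility_supermodular[OF \<alpha>] by (simp add: submodular_on_def)
qed

context contract_at
begin

lemma p_chi_spec:
  defines "R \<equiv> \<lambda>s. ints s iM (ints s iU 0 0)"
  shows "stored_set n iCH 0 (sem p_chi s) = up_to (R s) (ints s l1 0 0)"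
    and "stored_set n iCH 1 (sem p_chi s) = below (R s) (ints s l1 0 0)"
proof -
  let ?v = "ints s l1 0 0"
  have CH: "ints (sem p_chi s) iCH a b = (if 1 \<le> (if a \<le> 1 then b else n + 1) \<and> (if a \<le> 1 then b else n + 1) < n + 1
    then if a = 0 then R s ?v + 1 - R s b else R s ?v - R s b else ints s iCH a b)" for a b
    unfolding p_chi_def by (rule For_ints) (auto simp: update_apply R_def)
  show "stored_set n iCH 0 (sem p_chi s) = up_to (R s) ?v"
    unfolding stored_set_def up_to_def by (auto simp: CH)
  show "stored_set n iCH 1 (sem p_chi s) = below (R s) ?v"
    unfolding stored_set_def below_def by (auto simp: CH)
qed

lemma p_base_spec:
  assumes "reals s rA 0 0 = \<alpha>"
  shows "reals (sem p_base s) rE a b =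
    (if a = ints s iU 0 0 \<and> b \<le> n then if b = 0 then 1 else base (ints s iM a) b else reals s rE a b)"
proof -
  let ?u = "ints s iU 0 0"
  let ?q = "PQ Cost rQ1 (INum 0) (INum 0) iCH (INum 0) ;;
     PQ Reward rQ2 (INum 0) (INum 0) iCH (INum 0) ;;
     PQ Cost rQ3 (INum 0) (INum 0) iCH (INum 1) ;;
     PQ Reward rQ4 (INum 0) (INum 0) iCH (INum 1) ;;
     PR rE (IV iU) (IV l1)
       (RSub (RSub (RV rQ1) (RMul (RV rA) (RV rQ2))) (RSub (RV rQ3) (RMul (RV rA) (RV rQ4))))"
  have E: "reals (sem (PFor l1 1 1 (p_chi ;; ?q)) s) rE a b =
    (if 1 \<le> (if a = ?u then b else n + 1) \<and> (if a = ?u then b else n + 1) < n + 1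
     then base (ints s iM ?u) b else reals s rE a b)" for a b
  proof (rule For_reals)
    fix k a b and t :: state
    assume k: "1 \<le> k" "k < n + 1" "ints t l1 0 0 = k"
      and fi: "\<And>x. x \<notin> insert l1 (imods (p_chi ;; ?q)) \<Longrightarrow> ints t x = ints s x"
      and fr: "\<And>x. x \<notin> rmods (p_chi ;; ?q) \<Longrightarrow> reals t x = reals s x"
    have eqs: "ints t iM = ints s iM" "ints t iU = ints s iU" "reals t rA = reals s rA"
      using fi fr by simp_all
    have st: "stored_set n iCH 0 (t'\<lparr>reals := X\<rparr>) = stored_set n iCH 0 t'"
      "stored_set n iCH 1 (t'\<lparr>reals := X\<rparr>) = stored_set n iCH 1 t'" for t' :: state and X
      by (simp_all add: stored_set_def)
    show "reals (sem (p_chi ;; ?q) t) rE a b =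
       (if (if a = ?u then b else n + 1) = k then base (ints s iM ?u) b else reals t rE a b)"
      using k assms
      by (auto simp: update_apply st p_chi_spec eqs base_def)
  qed simp
  show ?thesis unfolding p_base_def sem.simps(5) using E[of a b] by (auto simp: update_apply)
qed

abbreviation weights :: "state \<Rightarrow> nat \<Rightarrow> real" where "weights s \<equiv> \<lambda>r. reals s rLAM r 0"
abbreviation labels :: "state \<Rightarrow> nat \<Rightarrow> nat" where "labels s \<equiv> \<lambda>v. ints s iD v 0"
abbreviation ranks :: "state \<Rightarrow> nat \<Rightarrow> nat \<Rightarrow> nat" where "ranks s \<equiv> ints s iR"

text \<open>Rows of free slots may hold anything: their weight 0 hides them in every sum.\<close>

definition rows_ok :: "state \<Rightarrow> bool" where
  "rows_ok s \<longleftrightarrow> (\<forall>r<n+2. 0 \<le> weights s r \<and> (0 < weights s r \<longrightarrow>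
     reals s rB r 0 = 1 \<and> (\<forall>v\<in>{1..n}. reals s rB r v = base (ranks s r) v)))"

text \<open>Slot 0 stays free as the entry point of \<open>p_insert\<close>; the dummy element 0
  keeps label 0 for \<open>p_select_t\<close>.\<close>

definition sfm_inv :: "state \<Rightarrow> bool" where
  "sfm_inv s \<longleftrightarrow> reals s rA 0 0 = \<alpha> \<and> ints s 0 0 0 = n \<and> labels s 0 = 0 \<and> weights s 0 = 0 \<and>
     rows_ok s \<and> labelling (labels s) (weights s) (ranks s)"

lemma rows_xval:
  assumes "rows_ok s" "v \<in> {1..n}"
  shows "(\<Sum>r<n+2. weights s r * reals s rB r v) = xval (weights s) (ranks s) v"
  unfolding xval_def
proof (intro sum.cong refl)
  fix r assume "r \<in> {..<n+2}"
  then show "weights s r * reals s rB r v = weights s r * base (ranks s r) v"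
    using assms unfolding rows_ok_def by (cases "weights s r = 0") (auto simp: less_le)
qed

lemma rows_total:
  assumes "rows_ok s"
  shows "(\<Sum>r<n+2. weights s r * reals s rB r 0) = (\<Sum>r<n+2. weights s r)"
proof (intro sum.cong refl)
  fix r assume "r \<in> {..<n+2}"
  then show "weights s r * reals s rB r 0 = weights s r"
    using assms unfolding rows_ok_def by (cases "weights s r = 0") (auto simp: less_le)
qed

lemma p_xval_spec:
  assumes "v \<le> n"
  shows "reals (sem p_xval s) rX v 0 = (\<Sum>r<n+2. weights s r * reals s rB r v)"
  unfolding p_xval_def
  by (subst p_sums_spec[where G = "\<lambda>v r. weights s r * reals s rB r v"])
    (use assms in \<open>simp_all add: atLeast0LessThan\<close>)

lemma p_select_t_spec:
  assumes x: "\<And>v. v \<in> {1..n} \<Longrightarrow> reals s rX v 0 = xval (weights s) (ranks s) v"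
    and n: "ints s 0 0 0 = n" and d0: "labels s 0 = 0"
  defines "t \<equiv> ints (sem p_select_t s) iT 0 0"
  defines "act \<equiv> active (labels s) (weights s) (ranks s)"
  shows "t = 0 \<and> act = {} \<or>
    t \<in> act \<and> (\<forall>v\<in>act. labels s v < labels s t \<or> labels s v = labels s t \<and> v \<le> t)"
proof -
  let ?body = "PIf (BAnd (RLess (RA rX (IV l1)) (ROf (INum 0)))
       (BAnd (ILess (IA iD (IV l1)) (IV 0)) (BNot (ILess (IA iD (IV l1)) (IA iD (IV iT))))))
     (SetI iT (IV l1)) PSkip"
  let ?s = "sem (SetI iT (INum 0)) s"
  let ?I = "\<lambda>k t. t = 0 \<and> (\<forall>v\<in>act. \<not> v < k) \<or> t \<in> act \<and> t < k \<and>
      (\<forall>v\<in>act. v < k \<longrightarrow> labels s v < labels s t \<or> labels s v = labels s t \<and> v \<le> t)"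
  have "?I (n + 1) (ints (sem (PFor l1 1 1 ?body) ?s) iT 0 0)"
  proof (rule sem_For_rule[where I = "\<lambda>k s'. ?I k (ints s' iT 0 0)"])
    show "?I 1 (ints (seti l1 1 ?s) iT 0 0)" by (auto simp: update_apply act_def active_def)
  next
    fix k :: nat and s' :: state
    assume k: "1 \<le> k" "k < n + 1" and I: "?I k (ints s' iT 0 0)" and l1: "ints s' l1 0 0 = k"
      and fi: "\<And>x. x \<notin> insert l1 (imods ?body) \<Longrightarrow> ints s' x = ints ?s x"
      and fr: "\<And>x. x \<notin> rmods ?body \<Longrightarrow> reals s' x = reals ?s x"
    have kn: "k \<in> {1..n}" using k by simp
    have eqs: "ints s' iD = ints s iD" "ints s' 0 0 0 = n" "reals s' rX = reals s rX"
      using fi fr n by simp_all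
    let ?t = "ints s' iT 0 0"
    have "ints (seti l1 (Suc k) (sem ?body s')) iT 0 0 =
        (if k \<in> act \<and> labels s ?t \<le> labels s k then k else ?t)"
      using l1 kn x[OF kn] by (auto simp: eqs update_apply act_def active_def not_less)
    moreover have "?I (Suc k) (if k \<in> act \<and> labels s ?t \<le> labels s k then k else ?t)"
    proof (cases "k \<in> act \<and> labels s ?t \<le> labels s k")
      case True
      have "labels s v < labels s k \<or> labels s v = labels s k \<and> v \<le> k" if "v \<in> act" "v < Suc k" for v
      proof (cases "v = k")
        case False
        then have vk: "v < k" using that by simp
        then have "labels s v \<le> labels s ?t" using I that by fastforce
        then show ?thesis using True vk by linarith
      qed simp
      then show ?thesis using True by simp
    next
      case False
      show ?thesis
      proof (cases "k \<in> act")
        case True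
        then have "labels s k < labels s ?t" using False by simp
        \<comment> \<open>The label of \<open>?t\<close> exceeds another label, whereas the dummy
          element has label 0.\<close>
        then have "?t \<noteq> 0" using d0 by (intro notI) simp
        then show ?thesis using I \<open>labels s k < labels s ?t\<close> False by (auto simp: less_Suc_eq)
      next
        case nk: False
        then have "v < Suc k \<longleftrightarrow> v < k" if "v \<in> act" for v using that by (auto simp: less_Suc_eq)
        then show ?thesis using I nk by (auto simp: less_SucI)
      qed
    qed
    ultimately show "?I (Suc k) (ints (seti l1 (Suc k) (sem ?body s')) iT 0 0)" by (simp only:)
  qed simp
  moreover have "v < n + 1" if "v \<in> act" for v using that by (auto simp: act_def active_def)
  ultimately show ?thesis unfolding t_def p_select_t_def sem.simps(5) by blast
qed

lemma p_select_s_spec: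
  fixes s
  defines "S \<equiv> ints (sem p_select_s s) iS 0 0"
  defines "T \<equiv> tails (labels s) (weights s) (ranks s) (ints s iT 0 0)"
  shows "S = 0 \<and> T = {} \<or> S \<in> T \<and> (\<forall>v\<in>T. v \<le> S)"
proof -
  let ?b = "BAnd (IEq (IAdd (IA iD (IV l1)) (INum 1)) (IA iD (IV iT)))
       (BAnd (RPos (RA rLAM (IV l2))) (ILess (IGet iR (IV l2) (IV l1)) (IGet iR (IV l2) (IV iT))))"
  let ?in = "PFor l2 0 2 (PIf ?b (SetI iS (IV l1)) PSkip)"
  let ?s = "sem (SetI iS (INum 0)) s"
  have "(\<exists>v. 1 \<le> v \<and> v < n + 1 \<and> v \<in> T \<and> (\<forall>w. v < w \<and> w < n + 1 \<longrightarrow> w \<notin> T) \<and>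
      ints (sem (PFor l1 1 1 ?in) ?s) iS 0 0 = v) \<or>
    (\<forall>v. 1 \<le> v \<and> v < n + 1 \<longrightarrow> v \<notin> T) \<and> ints (sem (PFor l1 1 1 ?in) ?s) iS 0 0 = ints ?s iS 0 0"
  proof (rule For_search)
    fix k :: nat and s' :: state
    assume k: "1 \<le> k" "k < n + 1" and l1: "ints s' l1 0 0 = k"
      and fi: "\<And>x. x \<notin> insert l1 (imods ?in) \<Longrightarrow> ints s' x = ints ?s x"
      and fr: "\<And>x. x \<notin> rmods ?in \<Longrightarrow> reals s' x = reals ?s x"
    let ?P = "\<lambda>r. labels s k + 1 = labels s (ints s iT 0 0) \<and> 0 < weights s r \<and>
      ranks s r k < ranks s r (ints s iT 0 0)"
    have eqs: "ints s' iD = ints s iD" "ints s' iT = ints s iT" "ints s' iR = ints s iR" "reals s' rLAM = reals s rLAM"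
      using fi fr by simp_all
    \<comment> \<open>For fixed \<open>k\<close> the inner search only decides whether some slot
      makes \<open>k\<close> a tail; the value stored is \<open>k\<close> whichever slot it
      is.\<close>
    have "(\<exists>r. 0 \<le> r \<and> r < n + 2 \<and> ?P r \<and> (\<forall>j. r < j \<and> j < n + 2 \<longrightarrow> \<not> ?P j) \<and> ints (sem ?in s') iS 0 0 = k) \<or>
      (\<forall>r. 0 \<le> r \<and> r < n + 2 \<longrightarrow> \<not> ?P r) \<and> ints (sem ?in s') iS 0 0 = ints s' iS 0 0"
    proof (rule For_search)
      fix r :: nat and s'' :: state
      assume r: "ints s'' l2 0 0 = r"
        and fi': "\<And>x. x \<notin> insert l2 (imods (PIf ?b (SetI iS (IV l1)) PSkip)) \<Longrightarrow> ints s'' x = ints s' x"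
        and fr': "\<And>x. x \<notin> rmods (PIf ?b (SetI iS (IV l1)) PSkip) \<Longrightarrow> reals s'' x = reals s' x"
      have eqs': "ints s'' iD = ints s iD" "ints s'' iT = ints s iT" "ints s'' iR = ints s iR"
        "reals s'' rLAM = reals s rLAM" "ints s'' l1 0 0 = k"
        using fi' fr' eqs l1 by simp_all
      show "ints (sem (PIf ?b (SetI iS (IV l1)) PSkip) s'') iS 0 0 = (if ?P r then k else ints s'' iS 0 0)"
        using r by (auto simp: eqs' update_apply)
    qed auto
    moreover have "k \<in> T \<longleftrightarrow> (\<exists>r<n+2. ?P r)" using k by (auto simp: T_def tails_def)
    ultimately show "ints (sem ?in s') iS 0 0 = (if k \<in> T then k else ints s' iS 0 0)" by auto
  qed auto
  moreover have "1 \<le> v \<and> v < n + 1" if "v \<in> T" for v using that by (auto simp: T_def tails_def)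
  moreover have "S = ints (sem (PFor l1 1 1 ?in) ?s) iS 0 0" "ints ?s iS 0 0 = 0"
    by (simp_all add: S_def p_select_s_def update_apply)
  ultimately show ?thesis by (metis all_not_in_conv not_le)
qed

lemma p_choose_i_spec:
  fixes s
  defines "t \<equiv> ints s iT 0 0" and "S \<equiv> ints s iS 0 0" and "i \<equiv> ints (sem p_choose_i s) iI 0 0"
  assumes ex: "\<exists>r<n+2. 0 < weights s r \<and> ranks s r S < ranks s r t"
  shows "i < n + 2" "0 < weights s i" "ranks s i S < ranks s i t"
    "\<And>r. r < n + 2 \<Longrightarrow> 0 < weights s r \<Longrightarrow> ranks s r t - ranks s r S \<le> ranks s i t - ranks s i S"
proof -
  let ?gap = "ISub (IGet iR (IV l1) (IV iT)) (IGet iR (IV l1) (IV iS))"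
  let ?body = "PIf (BAnd (RPos (RA rLAM (IV l1))) (ILess (IV iAL) ?gap)) (SetI iI (IV l1) ;; SetI iAL ?gap) PSkip"
  let ?s = "sem (SetI iAL (INum 0)) s"
  let ?g = "\<lambda>r. ranks s r t - ranks s r S"
  \<comment> \<open>Until a positive gap is met, \<open>a\<close> is 0 and \<open>i\<close> may be
    any leftover value.\<close>
  let ?I = "\<lambda>k a i. (\<forall>r<k. 0 < weights s r \<longrightarrow> ?g r \<le> a) \<and> (a = 0 \<or> i < k \<and> 0 < weights s i \<and> a = ?g i)"
  let ?s' = "sem (PFor l1 0 2 ?body) ?s"
  have "?I (n + 2) (ints ?s' iAL 0 0) (ints ?s' iI 0 0)"
  proof (rule sem_For_rule[where I = "\<lambda>k s'. ?I k (ints s' iAL 0 0) (ints s' iI 0 0)"])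
    fix k :: nat and s' :: state
    assume k: "k < n + 2" and I: "?I k (ints s' iAL 0 0) (ints s' iI 0 0)" and l1: "ints s' l1 0 0 = k"
      and fi: "\<And>x. x \<notin> insert l1 (imods ?body) \<Longrightarrow> ints s' x = ints ?s x"
      and fr: "\<And>x. x \<notin> rmods ?body \<Longrightarrow> reals s' x = reals ?s x"
    have eqs: "ints s' iR = ints s iR" "ints s' iT = ints s iT" "ints s' iS = ints s iS" "reals s' rLAM = reals s rLAM"
      using fi fr by simp_all
    let ?c = "0 < weights s k \<and> ints s' iAL 0 0 < ?g k"
    have eq: "ints (seti l1 (Suc k) (sem ?body s')) iAL 0 0 = (if ?c then ?g k else ints s' iAL 0 0)"
      "ints (seti l1 (Suc k) (sem ?body s')) iI 0 0 = (if ?c then k else ints s' iI 0 0)"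
      using l1 by (simp_all add: eqs update_apply t_def S_def)
    have "?I (Suc k) (if ?c then ?g k else ints s' iAL 0 0) (if ?c then k else ints s' iI 0 0)"
    proof (cases ?c)
      case True
      then have "?g r \<le> ?g k" if "r < k" "0 < weights s r" for r
        using I that by (meson le_trans less_imp_le)
      then show ?thesis using True by (auto simp: less_Suc_eq)
    next
      case False
      then show ?thesis using I by (auto simp: less_Suc_eq)
    qed
    then show "?I (Suc k) (ints (seti l1 (Suc k) (sem ?body s')) iAL 0 0)
        (ints (seti l1 (Suc k) (sem ?body s')) iI 0 0)" unfolding eq .
  qed (simp_all add: update_apply)
  moreover have i: "i = ints ?s' iI 0 0" by (simp add: i_def p_choose_i_def)
  moreover have "ints ?s' iAL 0 0 \<noteq> 0"
  proof -
    obtain r where "r < n + 2" "0 < weights s r" "0 < ?g r" using ex by auto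
    then show ?thesis using calculation(1) by fastforce
  qed
  ultimately have I: "\<forall>r<n+2. 0 < weights s r \<longrightarrow> ?g r \<le> ?g i" "i < n + 2" "0 < weights s i" "?g i \<noteq> 0"
    by auto
  then show "i < n + 2" "0 < weights s i" "ranks s i S < ranks s i t"
    "\<And>r. r < n + 2 \<Longrightarrow> 0 < weights s r \<Longrightarrow> ?g r \<le> ?g i"
    by auto
qed

section \<open>Exchanged rankings and the combination of their directions\<close>

lemma p_moves_spec:
  fixes s
  defines "R \<equiv> ranks s (ints s iI 0 0)" and "S \<equiv> ints s iS 0 0" and "s' \<equiv> sem p_moves s"
  assumes a: "reals s rA 0 0 = \<alpha>" and u: "u \<in> {1..n}"
  shows "\<And>w. w \<in> {1..n} \<Longrightarrow> ints s' iM u w = move u S R w"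
    and "\<And>v. v \<in> {1..n} \<Longrightarrow> reals s' rE u v = base (move u S R) v"
    and "reals s' rE u 0 = 1"
proof -
  let ?in = "PFor l1 1 1 (
       PIf (IEq (IV l1) (IV iU)) (PI iM (IV iU) (IV l1) (IGet iR (IV iI) (IV iS)))
       (PIf (BAnd (BNot (ILess (IGet iR (IV iI) (IV l1)) (IGet iR (IV iI) (IV iS))))
           (ILess (IGet iR (IV iI) (IV l1)) (IGet iR (IV iI) (IV iU))))
         (PI iM (IV iU) (IV l1) (IAdd (IGet iR (IV iI) (IV l1)) (INum 1)))
         (PI iM (IV iU) (IV l1) (IGet iR (IV iI) (IV l1)))))"
  let ?I = "\<lambda>k s'. \<forall>u. 1 \<le> u \<and> u < k \<longrightarrow> (\<forall>w\<in>{1..n}. ints s' iM u w = move u S R w) \<and>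
      (\<forall>v\<in>{1..n}. reals s' rE u v = base (move u S R) v) \<and> reals s' rE u 0 = 1"
  have "?I (n + 1) s'"
    unfolding s'_def p_moves_def
  proof (rule sem_For_rule[where I = ?I])
    fix k :: nat and t :: state
    assume k: "1 \<le> k" "k < n + 1" and I: "?I k t" and U: "ints t iU 0 0 = k"
      and fi: "\<And>x. x \<notin> insert iU (imods (?in ;; p_base)) \<Longrightarrow> ints t x = ints s x"
      and fr: "\<And>x. x \<notin> rmods (?in ;; p_base) \<Longrightarrow> reals t x = reals s x"
    have eqs: "ints t iR = ints s iR" "ints t iI = ints s iI" "ints t iS = ints s iS" "reals t rA = reals s rA"
      using fi fr by simp_all
    have M: "ints (sem ?in t) iM a b = (if 1 \<le> (if a = k then b else n + 1) \<and> (if a = k then b else n + 1) < n + 1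
        then move k S R b else ints t iM a b)" for a b
      by (rule For_ints) (use U in \<open>auto simp: eqs update_apply move_def R_def S_def\<close>)
    let ?t = "sem ?in t"
    have E: "reals (sem p_base ?t) rE a b = (if a = k \<and> b \<le> n then if b = 0 then 1 else base (ints ?t iM a) b
        else reals t rE a b)" for a b
      using p_base_spec[of ?t a b] a U by (simp add: eqs)
    have base: "base (ints ?t iM k) v = base (move k S R) v" if "v \<in> {1..n}" for v
      by (rule base_cong) (use M that in auto)
    show "?I (Suc k) (seti iU (Suc k) (sem (?in ;; p_base) t))"
    proof (intro allI impI)
      fix u assume u: "1 \<le> u \<and> u < Suc k"
      show "(\<forall>w\<in>{1..n}. ints (seti iU (Suc k) (sem (?in ;; p_base) t)) iM u w = move u S R w) \<and>
        (\<forall>v\<in>{1..n}. reals (seti iU (Suc k) (sem (?in ;; p_base) t)) rE u v = base (move u S R) v) \<and>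
        reals (seti iU (Suc k) (sem (?in ;; p_base) t)) rE u 0 = 1"
      proof (cases "u = k")
        case True
        then show ?thesis using M E base by auto
      next
        case False
        then have "1 \<le> u \<and> u < k" using u by simp
        then show ?thesis using I M E False by auto
      qed
    qed
  qed auto
  then show "\<And>w. w \<in> {1..n} \<Longrightarrow> ints s' iM u w = move u S R w"
    and "\<And>v. v \<in> {1..n} \<Longrightarrow> reals s' rE u v = base (move u S R) v" and "reals s' rE u 0 = 1"
    using u by auto
qed

lemma p_triangular_spec:
  fixes s
  defines "i \<equiv> ints s iI 0 0" and "S \<equiv> ints s iS 0 0" and "t \<equiv> ints s iT 0 0" and "s' \<equiv> sem p_triangular s"
  assumes R: "ranking (ranks s i)" and st: "S \<in> {1..n}" "t \<in> {1..n}" "ranks s i S < ranks s i t"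
    and E: "\<And>u v. u \<in> {1..n} \<Longrightarrow> v \<in> {1..n} \<Longrightarrow> reals s rE u v = base (move u S (ranks s i)) v"
    and B: "\<And>v. v \<in> {1..n} \<Longrightarrow> reals s rB i v = base (ranks s i) v"
    and K0: "\<And>u. u \<in> {1..n} \<Longrightarrow> reals s rK u 0 = 0"
    and nondeg: "\<And>u. u \<in> {1..n} \<Longrightarrow> ranks s i S < ranks s i u \<Longrightarrow> ranks s i u \<le> ranks s i t \<Longrightarrow>
      base (ranks s i) u < base (move u S (ranks s i)) u"
  shows "triangular (ranks s i) S t (ranks s i S) (\<lambda>u. reals s' rK u 0) (\<lambda>v. reals s' rY v 0)"
proof -
  let ?R = "ranks s i"
  let ?tri = "\<lambda>r s'. triangular ?R S t r (\<lambda>u. reals s' rK u 0) (\<lambda>v. reals s' rY v 0)"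
  let ?Yloop = "PFor l1 1 1 (PR rY (IV l1) (INum 0) (RAdd (RA rY (IV l1))
         (RMul (RA rK (IV l3)) (RSub (RGet rE (IV l3) (IV l1)) (RGet rB (IV iI) (IV l1))))))"
  let ?K = "PR rK (IV l3) (INum 0) (RDiv (RSub (ROf (INum 0)) (RA rY (IV l3)))
         (RSub (RGet rE (IV l3) (IV l3)) (RGet rB (IV iI) (IV l3))))"
  let ?body = "PIf (BAnd (IEq (IAdd (IGet iR (IV iI) (IV l3)) (IV l2)) (IGet iR (IV iI) (IV iT)))
         (ILess (IGet iR (IV iI) (IV iS)) (IGet iR (IV iI) (IV l3)))) (?K ;; ?Yloop) PSkip"
  define s1 where "s1 = sem (PFor l1 1 1 (PR rY (IV l1) (INum 0) (RSub (RGet rE (IV iT) (IV l1)) (RGet rB (IV iI) (IV l1)))))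
    (sem (PR rK (IV iT) (INum 0) (ROf (INum 1))) s)"
  have Y1: "reals s1 rY a b = (if 1 \<le> (if b = 0 then a else n + 1) \<and> (if b = 0 then a else n + 1) < n + 1
      then reals s rE t a - reals s rB i a else reals s rY a b)" for a b
    unfolding s1_def
    by (subst For_reals[where own = "\<lambda>a b. if b = 0 then a else n + 1" and G = "\<lambda>a b. reals s rE t a - reals s rB i a"])
      (auto simp: update_apply t_def i_def)
  have K1: "reals s1 rK u 0 = (if u = t then 1 else reals s rK u 0)" for u
    by (simp add: s1_def update_apply t_def)
  have init: "?tri (?R t - 1) s1"
    by (rule triangular_init[OF R st nondeg]) (use st K1 K0 Y1 E B in auto)
  have st': "?R t \<le> n" using ranking_D(3)[OF R st(2)] .
  \<comment> \<open>The rank in the invariant is held at \<open>?R S\<close> from below: elimination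
    ends there although the loop runs on.\<close>
  have "?tri (max (?R t - (n + 1)) (?R S)) (sem (PFor l2 1 1 (PFor l3 1 1 ?body)) s1)"
  proof (rule sem_For_rule[where I = "\<lambda>k. ?tri (max (?R t - k) (?R S))"])
    show "?tri (max (?R t - 1) (?R S)) (seti l2 1 s1)"
      using init st(3) by (simp add: max_absorb1)
  next
    fix k :: nat and s2 :: state
    assume k: "1 \<le> k" "k < n + 1" and I: "?tri (max (?R t - k) (?R S)) s2" and l2: "ints s2 l2 0 0 = k"
      and fi: "\<And>x. x \<notin> insert l2 (imods (PFor l3 1 1 ?body)) \<Longrightarrow> ints s2 x = ints s1 x"
      and fr: "\<And>x. x \<notin> rmods (PFor l3 1 1 ?body) \<Longrightarrow> reals s2 x = reals s1 x"
    define r where "r = ?R t - k"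
    \<comment> \<open>\<open>?J w\<close> says that the element of rank \<open>r\<close> was met
      before index \<open>w\<close>, so its elimination is done.\<close>
    let ?J = "\<lambda>w. ?R S < r \<and> (\<exists>w'\<in>{1..n}. w' < w \<and> ?R w' = r)"
    have J: "?tri (if ?J (n + 1) then r - 1 else max r (?R S)) (sem (PFor l3 1 1 ?body) s2)"
    proof (rule sem_For_rule[where I = "\<lambda>w. ?tri (if ?J w then r - 1 else max r (?R S))"])
      have "\<not> ?J 1" by auto
      then show "?tri (if ?J 1 then r - 1 else max r (?R S)) (seti l3 1 s2)" using I by (simp add: r_def)
    next
      fix w :: nat and s3 :: state
      assume w: "1 \<le> w" "w < n + 1" and J: "?tri (if ?J w then r - 1 else max r (?R S)) s3"
        and l3: "ints s3 l3 0 0 = w"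
        and fi': "\<And>x. x \<notin> insert l3 (imods ?body) \<Longrightarrow> ints s3 x = ints s2 x"
        and fr': "\<And>x. x \<notin> rmods ?body \<Longrightarrow> reals s3 x = reals s2 x"
      have wn: "w \<in> {1..n}" using w by simp
      have eqs: "ints s3 iR = ints s iR" "ints s3 iI 0 0 = i" "ints s3 iT 0 0 = t" "ints s3 iS 0 0 = S"
        "ints s3 l2 0 0 = k" "reals s3 rE = reals s rE" "reals s3 rB = reals s rB"
        using fi' fr' fi fr l2 by (simp_all add: s1_def i_def t_def S_def)
      \<comment> \<open>Ranks are at least 1, so the test by addition agrees with the truncated
        difference \<open>r\<close> even when \<open>r\<close> is 0.\<close>
      have guard: "?R w + k = ?R t \<and> ?R S < ?R w \<longleftrightarrow> ?R S < r \<and> ?R w = r"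
        unfolding r_def using ranking_D(2)[OF R wn] by auto
      show "?tri (if ?J (Suc w) then r - 1 else max r (?R S)) (seti l3 (Suc w) (sem ?body s3))"
      proof (cases "?R S < r \<and> ?R w = r")
        case True
        have nJ: "\<not> ?J w" using ranking_D(1)[OF R _ wn] True by (metis less_irrefl)
        have mx: "max r (?R S) = r" using True by simp
        have tri: "?tri r s3" using J unfolding if_not_P[OF nJ] mx .
        have J': "?J (Suc w)" using True wn by auto
        let ?s = "sem ?K s3"
        have K: "reals ?s rK a 0 = (if a = w then - reals s3 rY w 0 / (reals s rE w w - reals s rB i w) else reals s3 rK a 0)" for a
          using l3 by (simp add: eqs update_apply)
        have eqs': "reals ?s rY = reals s3 rY" "ints ?s = ints s3" "reals ?s rE = reals s rE" "reals ?s rB = reals s rB"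
          using eqs by simp_all
        have Y: "reals (sem ?Yloop ?s) rY a b = (if 1 \<le> (if b = 0 then a else n + 1) \<and> (if b = 0 then a else n + 1) < n + 1
            then reals s3 rY a 0 + reals ?s rK w 0 * (reals s rE w a - reals s rB i a) else reals ?s rY a b)" for a b
        proof (rule For_reals)
          fix v a b and s4 :: state
          assume v: "ints s4 l1 0 0 = v" "v < n + 1"
            and fi4: "\<And>x. x \<notin> insert l1 (imods (PR rY (IV l1) (INum 0) (RAdd (RA rY (IV l1))
              (RMul (RA rK (IV l3)) (RSub (RGet rE (IV l3) (IV l1)) (RGet rB (IV iI) (IV l1))))))) \<Longrightarrow> ints s4 x = ints ?s x"
            and fr4: "\<And>x. x \<notin> rmods (PR rY (IV l1) (INum 0) (RAdd (RA rY (IV l1))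
              (RMul (RA rK (IV l3)) (RSub (RGet rE (IV l3) (IV l1)) (RGet rB (IV iI) (IV l1)))))) \<Longrightarrow> reals s4 x = reals ?s x"
            and un: "\<And>a b. v \<le> (if b = 0 then a else n + 1) \<Longrightarrow> reals s4 rY a b = reals ?s rY a b"
          have e4: "ints s4 l3 0 0 = w" "ints s4 iI 0 0 = i" "reals s4 rE = reals s rE" "reals s4 rB = reals s rB"
            "reals s4 rK = reals ?s rK"
            using fi4[of l3] fi4[of iI] fr4[of rE] fr4[of rB] fr4[of rK] l3 eqs eqs' by simp_all
          have "reals s4 rY v 0 = reals s3 rY v 0" using un[of 0 v] eqs' by simp
          then show "reals (sem (PR rY (IV l1) (INum 0) (RAdd (RA rY (IV l1))
              (RMul (RA rK (IV l3)) (RSub (RGet rE (IV l3) (IV l1)) (RGet rB (IV iI) (IV l1)))))) s4) rY a b =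
            (if (if b = 0 then a else n + 1) = v then reals s3 rY a 0 + reals ?s rK w 0 * (reals s rE w a - reals s rB i a)
             else reals s4 rY a b)"
            using v e4 by (simp add: update_apply)
        qed simp
        have sem: "sem ?body s3 = sem ?Yloop ?s"
          using guard True l3 by (simp add: eqs)
        have K': "reals (sem ?Yloop ?s) rK = reals ?s rK" by simp
        have "?tri (r - 1) (sem ?body s3)"
          unfolding sem
        proof (rule triangular_step[OF R st nondeg tri wn])
          show "?R w = r" "?R S < r" using True by auto
          show "r < ?R t" using k ranking_D(2)[OF R st(2)] by (simp add: r_def)
          fix u assume u: "u \<in> {1..n}"
          show "reals (sem ?Yloop ?s) rK u 0 = (if u = w then - reals s3 rY w 0 / (base (move w S ?R) w - base ?R w)
              else reals s3 rK u 0)"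
            unfolding K' K using E B wn by simp
          show "reals (sem ?Yloop ?s) rY u 0 = reals s3 rY u 0 +
              reals (sem ?Yloop ?s) rK w 0 * (base (move w S ?R) u - base ?R u)"
            unfolding K' using Y[of u 0] u E[OF wn u] B[OF u] by simp
        qed
        then show ?thesis unfolding if_P[OF J'] reals_seti .
      next
        case False
        then have "?J (Suc w) = ?J w" by (auto simp: less_Suc_eq)
        moreover have "sem ?body s3 = s3" using guard False l3 by (auto simp: eqs)
        ultimately show ?thesis using J by (simp only: reals_seti)
      qed
    qed simp
    have "?tri (max (?R t - Suc k) (?R S)) (sem (PFor l3 1 1 ?body) s2)"
    proof (cases "?R S < r")
      case True
      have "?tri (r - 1) (sem (PFor l3 1 1 ?body) s2)"
      proof (cases "?J (n + 1)")
        case True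
        show ?thesis using J unfolding if_P[OF True] .
      next
        case False
        have "?R w \<noteq> r" if "w \<in> {1..n}" for w using False that \<open>?R S < r\<close> by auto
        moreover have "?tri r (sem (PFor l3 1 1 ?body) s2)"
          using J True unfolding if_not_P[OF False] by (simp add: max_absorb1)
        ultimately show ?thesis by (intro triangular_skip)
      qed
      moreover have "max (?R t - Suc k) (?R S) = r - 1" using True by (auto simp: r_def)
      ultimately show ?thesis by (simp only:)
    next
      case False
      then have "max (?R t - Suc k) (?R S) = ?R S" "max r (?R S) = ?R S" by (auto simp: r_def)
      moreover from False have "\<not> ?J (n + 1)" by blast
      ultimately show ?thesis using J by (simp only: if_False)
    qed
    then show "?tri (max (?R t - Suc k) (?R S)) (seti l2 (Suc k) (sem (PFor l3 1 1 ?body) s2))"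
      by (simp only: reals_seti)
  qed simp
  moreover have "max (?R t - (n + 1)) (?R S) = ?R S" using st' by simp
  moreover have "s' = sem (PFor l2 1 1 (PFor l3 1 1 ?body)) s1"
    by (simp add: s'_def p_triangular_def s1_def)
  ultimately show ?thesis by (simp only:)
qed

lemma p_kappa_spec:
  fixes s
  defines "i \<equiv> ints s iI 0 0" and "S \<equiv> ints s iS 0 0" and "t \<equiv> ints s iT 0 0" and "s' \<equiv> sem p_kappa s"
  assumes R: "ranking (ranks s i)" and st: "S \<in> {1..n}" "t \<in> {1..n}" "ranks s i S < ranks s i t"
    and E: "\<And>u v. u \<in> {1..n} \<Longrightarrow> v \<in> {1..n} \<Longrightarrow> reals s rE u v = base (move u S (ranks s i)) v"
    and B: "\<And>v. v \<in> {1..n} \<Longrightarrow> reals s rB i v = base (ranks s i) v"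
  shows "\<And>u. u \<in> {1..n} \<Longrightarrow> 0 \<le> reals s' rK u 0"
    and "\<And>u. u \<in> {1..n} \<Longrightarrow> reals s' rK u 0 \<noteq> 0 \<Longrightarrow> ranks s i S < ranks s i u \<and> ranks s i u \<le> ranks s i t"
    and "0 < (\<Sum>u\<in>{1..n}. reals s' rK u 0)" and "0 \<le> reals s' rDL 0 0"
    and "\<And>v. v \<in> {1..n} \<Longrightarrow> (\<Sum>u\<in>{1..n}. reals s' rK u 0 * (reals s rE u v - reals s rB i v)) =
      reals s' rDL 0 0 * ((if v = t then 1 else 0) - (if v = S then 1 else 0))"
proof -
  let ?R = "ranks s i"
  let ?b = "BAnd (BAnd (ILess (IGet iR (IV iI) (IV iS)) (IGet iR (IV iI) (IV l1)))
         (BNot (ILess (IGet iR (IV iI) (IV iT)) (IGet iR (IV iI) (IV l1)))))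
         (BNot (RLess (RGet rB (IV iI) (IV l1)) (RGet rE (IV l1) (IV l1))))"
  define s1 where "s1 = sem (PFor l1 1 1 (PIf ?b (SetI iDG (IV l1)) PSkip)) (sem (SetI iDG (INum 0)) s)"
  define s2 where "s2 = sem (PFor l1 1 1 (PR rK (IV l1) (INum 0) (ROf (INum 0)))) s1"
  let ?P = "\<lambda>u. ?R S < ?R u \<and> ?R u \<le> ?R t \<and> reals s rE u u \<le> reals s rB i u"
  have "(\<exists>k. 1 \<le> k \<and> k < n + 1 \<and> ?P k \<and> (\<forall>j. k < j \<and> j < n + 1 \<longrightarrow> \<not> ?P j) \<and> ints s1 iDG 0 0 = k) \<or>
    (\<forall>k. 1 \<le> k \<and> k < n + 1 \<longrightarrow> \<not> ?P k) \<and> ints s1 iDG 0 0 = ints (sem (SetI iDG (INum 0)) s) iDG 0 0"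
    unfolding s1_def
    by (rule For_search) (auto simp: update_apply i_def S_def t_def not_less)
  then have dg: "ints s1 iDG 0 0 \<in> {1..n} \<and> ?P (ints s1 iDG 0 0) \<or> ints s1 iDG 0 0 = 0 \<and> (\<forall>k\<in>{1..n}. \<not> ?P k)"
    by (auto simp: update_apply)
  have K2: "reals s2 rK a b = (if 1 \<le> (if b = 0 then a else n + 1) \<and> (if b = 0 then a else n + 1) < n + 1
      then 0 else reals s1 rK a b)" for a b
    unfolding s2_def by (rule For_reals) (auto simp: update_apply)
  have fr2: "ints s2 iDG = ints s1 iDG" "ints s2 iR = ints s iR" "ints s2 iI = ints s iI" "ints s2 iS = ints s iS"
    "ints s2 iT = ints s iT" "reals s2 rE = reals s rE" "reals s2 rB = reals s rB"
    by (simp_all add: s2_def s1_def)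
  have s': "s' = sem (PIf (IPos (IV iDG))
     (PR rK (IV iDG) (INum 0) (ROf (INum 1)) ;; SetR rDL (ROf (INum 0)))
     (p_triangular ;; SetR rDL (RA rY (IV iT)))) s2"
    unfolding s'_def p_kappa_def s2_def s1_def sem.simps(5) ..
  have "(\<forall>u\<in>{1..n}. 0 \<le> reals s' rK u 0 \<and> (reals s' rK u 0 \<noteq> 0 \<longrightarrow> ?R S < ?R u \<and> ?R u \<le> ?R t)) \<and>
    0 < (\<Sum>u\<in>{1..n}. reals s' rK u 0) \<and> 0 \<le> reals s' rDL 0 0 \<and>
    (\<forall>v\<in>{1..n}. (\<Sum>u\<in>{1..n}. reals s' rK u 0 * (reals s rE u v - reals s rB i v)) =
      reals s' rDL 0 0 * ((if v = t then 1 else 0) - (if v = S then 1 else 0)))"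
    using dg
  proof
    assume *: "ints s1 iDG 0 0 \<in> {1..n} \<and> ?P (ints s1 iDG 0 0)"
    let ?u = "ints s1 iDG 0 0"
    have un: "?u \<in> {1..n}" and P: "?P ?u" using * by auto
    have eq: "s' = sem (PR rK (IV iDG) (INum 0) (ROf (INum 1)) ;; SetR rDL (ROf (INum 0))) s2"
      using un unfolding s' by (simp add: fr2)
    have K: "reals s' rK u 0 = (if u = ?u then 1 else 0)" if "u \<in> {1..n}" for u
      using that K2[of u 0] by (simp add: eq fr2 update_apply)
    have DL: "reals s' rDL 0 0 = 0" by (simp add: eq update_apply)
    \<comment> \<open>Growth at \<open>?u\<close> fails, so by \<open>base_move_degenerate\<close>
      the exchange changes no coordinate at all.\<close>
    have "base (move ?u S ?R) ?u = base ?R ?u"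
      using base_move_self[OF R un st(1)] P E[OF un un] B[OF un] by simp
    then have same: "reals s rE ?u v = reals s rB i v" if "v \<in> {1..n}" for v
      using base_move_degenerate[OF R un st(1) _ _ that] P E[OF un that] B[OF that] by simp
    have "(\<Sum>u\<in>{1..n}. reals s' rK u 0 * h u) = h ?u" for h :: "nat \<Rightarrow> real"
    proof -
      have "(\<Sum>u\<in>{1..n}. reals s' rK u 0 * h u) = (\<Sum>u\<in>{1..n}. if u = ?u then h ?u else 0)"
        by (intro sum.cong) (auto simp: K)
      then show ?thesis using un by simp
    qed
    from this[of "\<lambda>_. 1"] this show ?thesis using K DL P same by simp
  next
    assume *: "ints s1 iDG 0 0 = 0 \<and> (\<forall>k\<in>{1..n}. \<not> ?P k)"
    have eq: "s' = sem (SetR rDL (RA rY (IV iT))) (sem p_triangular s2)"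
      using * unfolding s' by (simp add: fr2)
    let ?s = "sem p_triangular s2"
    have nondeg: "base ?R u < base (move u S ?R) u" if "u \<in> {1..n}" "?R S < ?R u" "?R u \<le> ?R t" for u
      using * that E[OF that(1,1)] B[OF that(1)] by force
    have "triangular (ranks s2 (ints s2 iI 0 0)) (ints s2 iS 0 0) (ints s2 iT 0 0) (ranks s2 (ints s2 iI 0 0) (ints s2 iS 0 0))
       (\<lambda>u. reals ?s rK u 0) (\<lambda>v. reals ?s rY v 0)"
      by (rule p_triangular_spec) (use R st E B nondeg K2 in \<open>auto simp: fr2 i_def S_def t_def\<close>)
    then have tri: "triangular ?R S t (?R S) (\<lambda>u. reals ?s rK u 0) (\<lambda>v. reals ?s rY v 0)"
      by (simp add: fr2 i_def S_def t_def)
    have K: "reals s' rK = reals ?s rK" and DL: "reals s' rDL 0 0 = reals ?s rY t 0"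
      by (simp_all add: eq update_apply fr2 t_def)
    have one: "reals ?s rK t 0 = 1" and nn: "\<And>u. u \<in> {1..n} \<Longrightarrow> 0 \<le> reals ?s rK u 0"
      using tri unfolding triangular_def by blast+
    have "reals ?s rK t 0 \<le> (\<Sum>u\<in>{1..n}. reals ?s rK u 0)"
      using st nn by (intro member_le_sum) auto
    then have "0 < (\<Sum>u\<in>{1..n}. reals ?s rK u 0)" using one by linarith
    moreover have "(\<Sum>u\<in>{1..n}. reals ?s rK u 0 * (reals s rE u v - reals s rB i v)) =
        reals ?s rY t 0 * ((if v = t then 1 else 0) - (if v = S then 1 else 0))" if "v \<in> {1..n}" for v
    proof -
      have "(\<Sum>u\<in>{1..n}. reals ?s rK u 0 * (reals s rE u v - reals s rB i v)) = reals ?s rY v 0"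
        using tri that E B unfolding triangular_def by simp
      then show ?thesis using triangular_final[OF R st nondeg tri that] by simp
    qed
    ultimately show ?thesis unfolding K DL using tri unfolding triangular_def by (simp add: less_imp_le)
  qed
  then show "\<And>u. u \<in> {1..n} \<Longrightarrow> 0 \<le> reals s' rK u 0"
    and "\<And>u. u \<in> {1..n} \<Longrightarrow> reals s' rK u 0 \<noteq> 0 \<Longrightarrow> ranks s i S < ranks s i u \<and> ranks s i u \<le> ranks s i t"
    and "0 < (\<Sum>u\<in>{1..n}. reals s' rK u 0)" and "0 \<le> reals s' rDL 0 0"
    and "\<And>v. v \<in> {1..n} \<Longrightarrow> (\<Sum>u\<in>{1..n}. reals s' rK u 0 * (reals s rE u v - reals s rB i v)) =
      reals s' rDL 0 0 * ((if v = t then 1 else 0) - (if v = S then 1 else 0))"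
    by blast+
qed

end

section \<open>The push\<close>

text \<open>\<open>x\<close> is the value of \<open>t\<close> and \<open>p\<close> the full shift. A
  degenerate exchange has \<open>p = 0\<close>; then \<theta> is 1 and no division takes
  place.\<close>

lemma step_size:
  fixes x p :: real
  assumes "x < 0" "0 \<le> p" and \<theta>: "\<theta> = (if - x < p then - x / p else 1)"
  shows "0 \<le> \<theta>" "\<theta> \<le> 1" "\<theta> * p \<le> - x" "\<theta> < 1 \<Longrightarrow> \<theta> * p = - x"
proof -
  show "0 \<le> \<theta>" unfolding \<theta> using assms(1,2) by (simp only: if_split) (simp add: divide_nonpos_nonneg)
  have "- x / p \<le> 1" if "- x < p" using that assms(1) by (subst pos_divide_le_eq) auto
  then show "\<theta> \<le> 1" unfolding \<theta> by simp
  show "\<theta> * p \<le> - x" "\<theta> < 1 \<Longrightarrow> \<theta> * p = - x" using assms by (cases "- x < p"; simp)+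
qed

context oracles
begin

lemma p_inserts_spec:
  fixes s
  defines "s' \<equiv> sem (PFor iU 1 1 p_insert) s"
  assumes nn: "\<forall>r<n+2. 0 \<le> reals s rLAM r 0" and z: "reals s rLAM 0 0 = 0"
    and W: "\<forall>u\<in>{1..n}. 0 \<le> reals s rW u 0"
  shows "\<And>r. r < n + 2 \<Longrightarrow> 0 \<le> reals s' rLAM r 0" "reals s' rLAM 0 0 = 0"
    and "\<And>i. i \<le> n \<Longrightarrow> (\<Sum>r<n+2. reals s' rLAM r 0 * reals s' rB r i) =
      (\<Sum>r<n+2. reals s rLAM r 0 * reals s rB r i) + (\<Sum>u\<in>{1..n}. reals s rW u 0 * reals s rE u i)"
    and "\<And>r. r < n + 2 \<Longrightarrow> 0 < reals s' rLAM r 0 \<Longrightarrow>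
      0 < reals s rLAM r 0 \<and> (\<forall>i\<le>n. ints s' iR r i = ints s iR r i \<and> reals s' rB r i = reals s rB r i) \<or>
      (\<exists>u\<in>{1..n}. 0 < reals s rW u 0 \<and>
        (\<forall>i\<le>n. ints s' iR r i = ints s iM u i \<and> reals s' rB r i = reals s rE u i))"
proof -
  let ?I = "\<lambda>k t. (\<forall>r<n+2. 0 \<le> reals t rLAM r 0) \<and> reals t rLAM 0 0 = 0 \<and>
    (\<forall>i\<le>n. (\<Sum>r<n+2. reals t rLAM r 0 * reals t rB r i) =
      (\<Sum>r<n+2. reals s rLAM r 0 * reals s rB r i) + (\<Sum>u\<in>{1..<k}. reals s rW u 0 * reals s rE u i)) \<and>
    (\<forall>r<n+2. 0 < reals t rLAM r 0 \<longrightarrow>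
      0 < reals s rLAM r 0 \<and> (\<forall>i\<le>n. ints t iR r i = ints s iR r i \<and> reals t rB r i = reals s rB r i) \<or>
      (\<exists>u\<in>{1..<k}. 0 < reals s rW u 0 \<and>
        (\<forall>i\<le>n. ints t iR r i = ints s iM u i \<and> reals t rB r i = reals s rE u i)))"
  have "?I (n + 1) s'"
    unfolding s'_def
  proof (rule sem_For_rule[where I = ?I])
    fix k :: nat and t :: state
    assume k: "1 \<le> k" "k < n + 1" and I: "?I k t" and U: "ints t iU 0 0 = k"
      and fi: "\<And>x. x \<notin> insert iU (imods p_insert) \<Longrightarrow> ints t x = ints s x"
      and fr: "\<And>x. x \<notin> rmods p_insert \<Longrightarrow> reals t x = reals s x"
    have eqs: "ints t iM = ints s iM" "reals t rE = reals s rE" "reals t rW = reals s rW"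
      using fi fr by simp_all
    have nn': "\<forall>r<n+2. 0 \<le> reals t rLAM r 0" and z': "reals t rLAM 0 0 = 0" using I by blast+
    have W': "0 \<le> reals t rW (ints t iU 0 0) 0" using W k by (simp add: eqs U)
    note ins = p_insert_spec[OF nn' z' W', unfolded eqs U]
    show "?I (Suc k) (seti iU (Suc k) (sem p_insert t))"
    proof (intro conjI allI impI)
      fix r assume "r < n + 2"
      then show "0 \<le> reals (seti iU (Suc k) (sem p_insert t)) rLAM r 0" using ins(1) by simp
    next
      show "reals (seti iU (Suc k) (sem p_insert t)) rLAM 0 0 = 0" using ins(2) by simp
    next
      fix i assume "i \<le> n"
      then show "(\<Sum>r<n+2. reals (seti iU (Suc k) (sem p_insert t)) rLAM r 0 * reals (seti iU (Suc k) (sem p_insert t)) rB r i) =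
        (\<Sum>r<n+2. reals s rLAM r 0 * reals s rB r i) + (\<Sum>u\<in>{1..<Suc k}. reals s rW u 0 * reals s rE u i)"
        using ins(3) I k by (simp only: reals_seti sum.atLeastLessThan_Suc add.assoc)
    next
      fix r assume r: "r < n + 2" "0 < reals (seti iU (Suc k) (sem p_insert t)) rLAM r 0"
      let ?t = "seti iU (Suc k) (sem p_insert t)"
      have rr: "0 < reals (sem p_insert t) rLAM r 0" using r(2) by simp
      have eqt: "ints ?t iR = ints (sem p_insert t) iR" "reals ?t rB = reals (sem p_insert t) rB" by simp_all
      from ins(4)[OF r(1) rr]
      show "0 < reals s rLAM r 0 \<and> (\<forall>i\<le>n. ints ?t iR r i = ints s iR r i \<and> reals ?t rB r i = reals s rB r i) \<or>
        (\<exists>u\<in>{1..<Suc k}. 0 < reals s rW u 0 \<and>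
          (\<forall>i\<le>n. ints ?t iR r i = ints s iM u i \<and> reals ?t rB r i = reals s rE u i))"
        unfolding eqt
      proof
        assume *: "0 < reals t rLAM r 0 \<and> (\<forall>i\<le>n. ints (sem p_insert t) iR r i = ints t iR r i \<and>
          reals (sem p_insert t) rB r i = reals t rB r i)"
        with I r(1) have "0 < reals s rLAM r 0 \<and> (\<forall>i\<le>n. ints t iR r i = ints s iR r i \<and> reals t rB r i = reals s rB r i) \<or>
          (\<exists>u\<in>{1..<k}. 0 < reals s rW u 0 \<and> (\<forall>i\<le>n. ints t iR r i = ints s iM u i \<and> reals t rB r i = reals s rE u i))"
          by blast
        then show "0 < reals s rLAM r 0 \<and> (\<forall>i\<le>n. ints (sem p_insert t) iR r i = ints s iR r i \<and>
            reals (sem p_insert t) rB r i = reals s rB r i) \<or>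
          (\<exists>u\<in>{1..<Suc k}. 0 < reals s rW u 0 \<and> (\<forall>i\<le>n. ints (sem p_insert t) iR r i = ints s iM u i \<and>
            reals (sem p_insert t) rB r i = reals s rE u i))"
        proof
          assume "\<exists>u\<in>{1..<k}. 0 < reals s rW u 0 \<and> (\<forall>i\<le>n. ints t iR r i = ints s iM u i \<and> reals t rB r i = reals s rE u i)"
          then obtain u where u: "u \<in> {1..<k}" "0 < reals s rW u 0"
            "\<forall>i\<le>n. ints t iR r i = ints s iM u i \<and> reals t rB r i = reals s rE u i" by blast
          then show ?thesis using * by (intro disjI2 bexI[of _ u]) auto
        qed (use * in auto)
      next
        assume "0 < reals s rW k 0 \<and> (\<forall>i\<le>n. ints (sem p_insert t) iR r i = ints s iM k i \<and>
          reals (sem p_insert t) rB r i = reals s rE k i)"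
        then show "0 < reals s rLAM r 0 \<and> (\<forall>i\<le>n. ints (sem p_insert t) iR r i = ints s iR r i \<and>
            reals (sem p_insert t) rB r i = reals s rB r i) \<or>
          (\<exists>u\<in>{1..<Suc k}. 0 < reals s rW u 0 \<and> (\<forall>i\<le>n. ints (sem p_insert t) iR r i = ints s iM u i \<and>
            reals (sem p_insert t) rB r i = reals s rE u i))"
          using k by (intro disjI2 bexI[of _ k]) auto
      qed
    qed
  qed (use nn z in auto)
  then show "\<And>r. r < n + 2 \<Longrightarrow> 0 \<le> reals s' rLAM r 0" "reals s' rLAM 0 0 = 0"
    and "\<And>i. i \<le> n \<Longrightarrow> (\<Sum>r<n+2. reals s' rLAM r 0 * reals s' rB r i) =
      (\<Sum>r<n+2. reals s rLAM r 0 * reals s rB r i) + (\<Sum>u\<in>{1..n}. reals s rW u 0 * reals s rE u i)"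
    and "\<And>r. r < n + 2 \<Longrightarrow> 0 < reals s' rLAM r 0 \<Longrightarrow>
      0 < reals s rLAM r 0 \<and> (\<forall>i\<le>n. ints s' iR r i = ints s iR r i \<and> reals s' rB r i = reals s rB r i) \<or>
      (\<exists>u\<in>{1..n}. 0 < reals s rW u 0 \<and>
        (\<forall>i\<le>n. ints s' iR r i = ints s iM u i \<and> reals s' rB r i = reals s rE u i))"
    unfolding Suc_eq_plus1[symmetric] atLeastLessThanSuc_atLeastAtMost by blast+
qed

end

context contract_at
begin

text \<open>The old vector gives away \<theta> times its weight and the exchanged ones share it in
  proportion to \<open>rK\<close>, so \<open>x\<close> moves along the normalized combination of
  exchange directions; this yields the premises of \<open>push\<close>.\<close>

lemma p_push_spec:
  fixes s
  defines "t \<equiv> ints s iT 0 0" and "S \<equiv> ints s iS 0 0" and "s' \<equiv> sem p_push s"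
  assumes inv: "sfm_inv s"
    and t: "t \<in> active (labels s) (weights s) (ranks s)"
    and tmax: "\<And>v. v \<in> active (labels s) (weights s) (ranks s) \<Longrightarrow>
      labels s v < labels s t \<or> labels s v = labels s t \<and> v \<le> t"
    and S: "S \<in> tails (labels s) (weights s) (ranks s) t"
    and smax: "\<And>v. v \<in> tails (labels s) (weights s) (ranks s) t \<Longrightarrow> v \<le> S"
    and X: "reals s rX t 0 = xval (weights s) (ranks s) t"
  shows "sfm_inv s'"
    and "potential (labels s') (weights s') (ranks s') < potential (labels s) (weights s) (ranks s)"
proof -
  have a: "reals s rA 0 0 = \<alpha>" and z: "weights s 0 = 0" and ok: "rows_ok s"
    and lab: "labelling (labels s) (weights s) (ranks s)"
    using inv unfolding sfm_inv_def by blast+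
  have cc: "convex_comb (weights s) (ranks s)" using lab unfolding labelling_def by blast
  have tn: "t \<in> {1..n}" "xval (weights s) (ranks s) t < 0" using t by (auto simp: active_def)
  have Sn: "S \<in> {1..n}" using S by (auto simp: tails_def)
  define s1 where "s1 = sem p_choose_i s"
  define s2 where "s2 = sem p_moves s1"
  define s3 where "s3 = sem p_kappa s2"
  define s4 where "s4 = sem (PFor l1 1 1 (SetR rKT (RAdd (RV rKT) (RA rK (IV l1))))) (sem (SetR rKT (ROf (INum 0))) s3)"
  define s5 where "s5 = sem (SetR rPH (RDiv (RMul (RA rLAM (IV iI)) (RV rDL)) (RV rKT))) s4"
  define s6 where "s6 = sem (PIf (RLess (RSub (ROf (INum 0)) (RA rX (IV iT))) (RV rPH))
     (SetR rTH (RDiv (RSub (ROf (INum 0)) (RA rX (IV iT))) (RV rPH)))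
     (SetR rTH (ROf (INum 1)))) s5"
  define s7 where "s7 = sem (PFor l1 1 1 (PR rW (IV l1) (INum 0)
     (RDiv (RMul (RMul (RV rTH) (RA rLAM (IV iI))) (RA rK (IV l1))) (RV rKT)))) s6"
  define s8 where "s8 = sem (PR rLAM (IV iI) (INum 0) (RSub (RA rLAM (IV iI)) (RMul (RV rTH) (RA rLAM (IV iI))))) s7"
  have s': "s' = sem (PFor iU 1 1 p_insert) s8"
    unfolding s'_def p_push_def s8_def s7_def s6_def s5_def s4_def s3_def s2_def s1_def sem.simps(5) ..
  define i where "i = ints s1 iI 0 0"
  define R where "R = ranks s i"
  have ex: "\<exists>r<n+2. 0 < weights s r \<and> ranks s r S < ranks s r t"
    using S by (auto simp: tails_def)
  note ci = p_choose_i_spec[of s, folded t_def S_def s1_def, OF ex, folded i_def]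
  have Ri: "ranking R" using cc ci(1,2) unfolding convex_comb_def R_def by blast
  have st: "R S < R t" using ci(3) by (simp add: R_def)
  have fr1: "reals s1 = reals s" "ints s1 iR = ints s iR" "ints s1 iS 0 0 = S" "ints s1 iT 0 0 = t"
    unfolding s1_def S_def t_def by (auto intro!: ext)
  have mv: "\<And>w. w \<in> {1..n} \<Longrightarrow> ints s2 iM u w = move u S R w"
    "\<And>v. v \<in> {1..n} \<Longrightarrow> reals s2 rE u v = base (move u S R) v" "reals s2 rE u 0 = 1" if "u \<in> {1..n}" for u
    using p_moves_spec[of s1 u] that a unfolding s2_def fr1 i_def[symmetric] R_def by blast+
  have fr2: "ints s2 iR = ints s iR" "ints s2 iI 0 0 = i" "ints s2 iS 0 0 = S" "ints s2 iT 0 0 = t"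
    "reals s2 rB = reals s rB" "reals s2 rLAM = reals s rLAM" "reals s2 rX = reals s rX"
    by (simp_all add: s2_def fr1 i_def)
  have Bi: "reals s rB i v = base R v" if "v \<in> {1..n}" for v
    using ok ci(1,2) that unfolding rows_ok_def R_def by blast
  have Bi0: "reals s rB i 0 = 1" using ok ci(1,2) unfolding rows_ok_def by blast
  let ?K = "\<lambda>u. reals s3 rK u 0" and ?DL = "reals s3 rDL 0 0"
  have K: "\<And>u. u \<in> {1..n} \<Longrightarrow> 0 \<le> ?K u"
    "\<And>u. u \<in> {1..n} \<Longrightarrow> ?K u \<noteq> 0 \<Longrightarrow> R S < R u \<and> R u \<le> R t"
    "0 < (\<Sum>u\<in>{1..n}. ?K u)" "0 \<le> ?DL"
    "\<And>v. v \<in> {1..n} \<Longrightarrow> (\<Sum>u\<in>{1..n}. ?K u * (reals s2 rE u v - reals s rB i v)) =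
      ?DL * ((if v = t then 1 else 0) - (if v = S then 1 else 0))"
    using p_kappa_spec[of s2] Ri Sn tn(1) st mv(2) Bi
    unfolding s3_def fr2 R_def by blast+
  have fr3: "ints s3 iI 0 0 = i" "ints s3 iT 0 0 = t" "ints s3 iR = ints s iR" "ints s3 iM = ints s2 iM"
    "reals s3 rE = reals s2 rE" "reals s3 rB = reals s rB" "reals s3 rLAM = reals s rLAM" "reals s3 rX = reals s rX"
    by (simp_all add: s3_def fr2)
  let ?KT = "\<Sum>u\<in>{1..n}. ?K u"
  have "reals s4 rKT x y = (if x = 0 \<and> y = 0 then reals (sem (SetR rKT (ROf (INum 0))) s3) rKT x y +
      (\<Sum>k\<in>{1..<n + 1}. ?K k) else reals (sem (SetR rKT (ROf (INum 0))) s3) rKT x y)" for x y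
    unfolding s4_def by (rule For_sum) auto
  from this[of 0 0] have KT: "reals s4 rKT 0 0 = ?KT"
    unfolding Suc_eq_plus1[symmetric] atLeastLessThanSuc_atLeastAtMost by (simp add: update_apply)
  let ?PH = "weights s i * ?DL / ?KT"
  let ?x = "xval (weights s) (ranks s) t"
  define \<theta> where "\<theta> = (if - ?x < ?PH then - ?x / ?PH else 1)"
  have fr4: "reals s4 rLAM = reals s rLAM" "reals s4 rDL = reals s3 rDL" "reals s4 rX = reals s rX"
    "ints s4 iI 0 0 = i" "ints s4 iT 0 0 = t" "reals s4 rK = reals s3 rK"
    by (simp_all add: s4_def fr3)
  have fr5: "reals s5 rPH 0 0 = ?PH" "reals s5 rLAM = reals s rLAM" "reals s5 rX = reals s rX"
    "ints s5 iI 0 0 = i" "ints s5 iT 0 0 = t" "reals s5 rK = reals s3 rK" "reals s5 rKT 0 0 = ?KT"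
    by (simp_all add: s5_def fr4 KT update_apply)
  have fr6: "reals s6 rTH 0 0 = \<theta>" "reals s6 rLAM = reals s rLAM"
    "ints s6 iI 0 0 = i" "reals s6 rK = reals s3 rK" "reals s6 rKT 0 0 = ?KT"
    using X by (auto simp: s6_def fr5 \<theta>_def update_apply)
  have W7: "reals s7 rW x y = (if 1 \<le> (if y = 0 then x else n + 1) \<and> (if y = 0 then x else n + 1) < n + 1
      then \<theta> * weights s i * ?K x / ?KT else reals s6 rW x y)" for x y
    unfolding s7_def by (subst For_reals[where own = "\<lambda>a b. if b = 0 then a else n + 1"
      and G = "\<lambda>x y. \<theta> * weights s i * ?K x / ?KT"]) (auto simp: update_apply fr6)
  have fr7: "reals s7 rLAM = reals s rLAM" "ints s7 iI 0 0 = i" "reals s7 rTH 0 0 = \<theta>"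
    by (simp_all add: s7_def fr6)
  have W: "reals s8 rW u 0 = \<theta> * weights s i * ?K u / ?KT" if "u \<in> {1..n}" for u
    using W7[of u 0] that by (simp add: s8_def)
  have L8: "weights s8 r = (if r = i then (1 - \<theta>) * weights s i else weights s r)" for r
    by (simp add: s8_def fr7 update_apply algebra_simps)
  have fr8: "ints s8 iR = ints s iR" "ints s8 iM = ints s2 iM" "reals s8 rE = reals s2 rE" "reals s8 rB = reals s rB"
    by (simp_all add: s8_def s7_def s6_def s5_def s4_def fr3)
  have PH: "0 \<le> ?PH" using K(3,4) ci(2) by simp
  note th = step_size[OF tn(2) PH \<theta>_def]
  have nn: "0 \<le> weights s r" if "r < n + 2" for r using ok that unfolding rows_ok_def by blast
  have nn8: "\<forall>r<n+2. 0 \<le> weights s8 r" using nn th ci(2) by (simp add: L8)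
  have i0: "i \<noteq> 0" using z ci(2) by (intro notI) simp
  have z8: "weights s8 0 = 0" using i0 z by (simp add: L8)
  have W0: "\<forall>u\<in>{1..n}. 0 \<le> reals s8 rW u 0"
    using W th ci(2) K(1,3) by simp
  have Wi: "R S < R u \<and> R u \<le> R t" if "u \<in> {1..n}" "0 < reals s8 rW u 0" for u
    using W[OF that(1)] that K(2) by force
  note ins = p_inserts_spec[of s8, folded s', OF nn8 z8 W0, unfolded fr8]
  let ?c = "\<theta> * weights s i / ?KT"
  have sums: "(\<Sum>r<n+2. weights s' r * reals s' rB r v) =
      (\<Sum>r<n+2. weights s r * reals s rB r v) + ?c * (\<Sum>u\<in>{1..n}. ?K u * (reals s2 rE u v - reals s rB i v))"
    if "v \<le> n" for v
  proof -
    have "(\<Sum>r<n+2. weights s8 r * reals s rB r v) =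
      (\<Sum>r<n+2. weights s r * reals s rB r v - (if r = i then \<theta> * weights s i * reals s rB i v else 0))"
      by (intro sum.cong) (auto simp: L8 algebra_simps)
    also have "\<dots> = (\<Sum>r<n+2. weights s r * reals s rB r v) - \<theta> * weights s i * reals s rB i v"
      using ci(1) by (simp add: sum_subtractf del: sum.lessThan_Suc)
    finally have 1: "(\<Sum>r<n+2. weights s8 r * reals s rB r v) =
      (\<Sum>r<n+2. weights s r * reals s rB r v) - \<theta> * weights s i * reals s rB i v" .
    have "(\<Sum>u\<in>{1..n}. reals s8 rW u 0 * reals s2 rE u v) = (\<Sum>u\<in>{1..n}. ?c * (?K u * reals s2 rE u v))"
      by (intro sum.cong) (auto simp: W)
    also have "\<dots> = ?c * (\<Sum>u\<in>{1..n}. ?K u * reals s2 rE u v)" by (simp only: sum_distrib_left)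
    finally have 2: "(\<Sum>u\<in>{1..n}. reals s8 rW u 0 * reals s2 rE u v) = ?c * (\<Sum>u\<in>{1..n}. ?K u * reals s2 rE u v)" .
    have "(\<Sum>u\<in>{1..n}. ?K u * (reals s2 rE u v - reals s rB i v)) =
      (\<Sum>u\<in>{1..n}. ?K u * reals s2 rE u v) - ?KT * reals s rB i v"
      by (simp only: right_diff_distrib sum_subtractf sum_distrib_right)
    then have 3: "?c * (\<Sum>u\<in>{1..n}. ?K u * (reals s2 rE u v - reals s rB i v)) =
      ?c * (\<Sum>u\<in>{1..n}. ?K u * reals s2 rE u v) - \<theta> * weights s i * reals s rB i v"
      using K(3) by (simp add: right_diff_distrib)
    show ?thesis unfolding ins(3)[OF that] 1 2 3 by simp
  qed
  have rows: "\<exists>u\<in>{1..n}. R S < R u \<and> R u \<le> R t \<and> reals s' rB r 0 = 1 \<and> (\<forall>w\<in>{1..n}. ranks s' r w = move u S R w) \<and>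
      (\<forall>v\<in>{1..n}. reals s' rB r v = base (move u S R) v)"
    if r: "r < n + 2" "0 < weights s' r" and nr: "\<not> (0 < weights s8 r \<and> (\<forall>i\<le>n. ranks s' r i = ranks s r i \<and>
      reals s' rB r i = reals s rB r i))" for r
  proof -
    obtain u where u: "u \<in> {1..n}" "0 < reals s8 rW u 0"
      "\<And>i. i \<le> n \<Longrightarrow> ranks s' r i = ints s2 iM u i \<and> reals s' rB r i = reals s2 rE u i"
      using ins(4)[OF r] nr by blast
    then show ?thesis using mv[OF u(1)] Wi[OF u(1,2)] by (intro bexI[of _ u]) auto
  qed
  have pos8: "0 < weights s r" if "0 < weights s8 r" for r
    using that ci(2) by (cases "r = i") (auto simp: L8)
  have ok': "rows_ok s'"
    unfolding rows_ok_def
  proof (intro allI impI conjI)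
    fix r assume r: "r < n + 2"
    show "0 \<le> weights s' r" using ins(1)[OF r] .
    assume r': "0 < weights s' r"
    have "reals s' rB r 0 = 1 \<and> (\<forall>v\<in>{1..n}. reals s' rB r v = base (ranks s' r) v)"
    proof (cases "0 < weights s8 r \<and> (\<forall>i\<le>n. ranks s' r i = ranks s r i \<and> reals s' rB r i = reals s rB r i)")
      case True
      then have "reals s rB r 0 = 1 \<and> (\<forall>v\<in>{1..n}. reals s rB r v = base (ranks s r) v)"
        using ok r pos8 unfolding rows_ok_def by blast
      moreover have "base (ranks s' r) v = base (ranks s r) v" if "v \<in> {1..n}" for v
        using True that by (intro base_cong) auto
      ultimately show ?thesis using True by auto
    next
      case False
      then obtain u where u: "reals s' rB r 0 = 1" "\<And>w. w \<in> {1..n} \<Longrightarrow> ranks s' r w = move u S R w"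
        "\<And>v. v \<in> {1..n} \<Longrightarrow> reals s' rB r v = base (move u S R) v"
        using rows[OF r r'] by blast
      moreover have "base (ranks s' r) v = base (move u S R) v" if "v \<in> {1..n}" for v
        using u(2) that by (intro base_cong) auto
      ultimately show ?thesis by auto
    qed
    then show "reals s' rB r 0 = 1" "\<forall>v\<in>{1..n}. reals s' rB r v = base (ranks s' r) v" by blast+
  qed
  \<comment> \<open>All rows carry 1 in column 0, so the directions vanish there and the total
    weight stays 1.\<close>
  have "(\<Sum>u\<in>{1..n}. ?K u * (reals s2 rE u 0 - reals s rB i 0)) = 0"
    using mv(3) Bi0 by (intro sum.neutral) auto
  then have one: "(\<Sum>r<n+2. weights s' r) = 1"
    using sums[of 0] rows_total[OF ok] rows_total[OF ok'] cc unfolding convex_comb_def by simp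
  have x': "xval (weights s') (ranks s') v = xval (weights s) (ranks s) v +
      \<theta> * ?PH * ((if v = t then 1 else 0) - (if v = S then 1 else 0))" if v: "v \<in> {1..n}" for v
    using sums[of v] rows_xval[OF ok v] rows_xval[OF ok' v] K(5)[OF v] v by simp
  have tS: "t \<noteq> S" using st by auto
  have x't: "xval (weights s') (ranks s') t = ?x + \<theta> * ?PH" using x'[OF tn(1)] tS by simp
  have new: "0 < weights s r \<and> (r = i \<longrightarrow> 0 \<le> xval (weights s') (ranks s') t) \<and> (\<forall>v\<in>{1..n}. ranks s' r v = ranks s r v) \<or>
      (\<exists>u\<in>{1..n}. ranks s i S < ranks s i u \<and> ranks s i u \<le> ranks s i t \<and>
        (\<forall>v\<in>{1..n}. ranks s' r v = move u S (ranks s i) v))"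
    if r: "r < n + 2" "0 < weights s' r" for r
  proof (cases "0 < weights s8 r \<and> (\<forall>i\<le>n. ranks s' r i = ranks s r i \<and> reals s' rB r i = reals s rB r i)")
    case True
    \<comment> \<open>Slot \<open>i\<close> keeps its old ranking only for \<theta> < 1, that is
      when the push was cut down and the value of \<open>t\<close> reached 0.\<close>
    have "0 \<le> xval (weights s') (ranks s') t" if "r = i"
    proof -
      have "0 < (1 - \<theta>) * weights s i" using True that by (simp add: L8)
      then have "\<theta> < 1" using ci(2) by (simp add: zero_less_mult_iff)
      then show ?thesis using th(4) x't by simp
    qed
    then show ?thesis using True pos8 by auto
  next
    case False
    then show ?thesis using rows[OF r] unfolding R_def by blast
  qed
  have D: "labels s' = labels s" by (auto simp: s'_def)
  have i3: "ranks s i S < ranks s i t" using ci(3) .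
  note p = push[OF lab t tmax S smax ci(1,2) i3 ci(4) ins(1) one new x']
  have "0 \<le> \<theta> * ?PH" using th(1) PH by (rule mult_nonneg_nonneg)
  moreover have "xval (weights s') (ranks s') t \<le> 0" using x't th(3) by simp
  ultimately have "labelling (labels s) (weights s') (ranks s')"
    "potential (labels s) (weights s') (ranks s') < potential (labels s) (weights s) (ranks s)"
    by (intro p; simp)+
  then show "sfm_inv s'" "potential (labels s') (weights s') (ranks s') < potential (labels s) (weights s) (ranks s)"
    using inv ok' ins(2) unfolding sfm_inv_def D by (auto simp: s'_def)
qed

section \<open>A complete run of the minimization\<close>

text \<open>The last claim is the idling that \<open>nest_measure\<close> asks for: without an
  active element the step alters neither labels nor slots.\<close>

lemma p_step_spec:
  fixes s
  defines "s' \<equiv> sem p_step s"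
  assumes inv: "sfm_inv s"
  shows "sfm_inv s'"
    and "active (labels s') (weights s') (ranks s') = {} \<or>
      potential (labels s') (weights s') (ranks s') < potential (labels s) (weights s) (ranks s)"
    and "active (labels s) (weights s) (ranks s) = {} \<Longrightarrow> active (labels s') (weights s') (ranks s') = {}"
proof -
  let ?act = "active (labels s) (weights s) (ranks s)"
  define s1 where "s1 = sem p_xval s"
  define s2 where "s2 = sem p_select_t s1"
  define t where "t = ints s2 iT 0 0"
  have n: "ints s 0 0 0 = n" and d0: "labels s 0 = 0" and ok: "rows_ok s"
    and lab: "labelling (labels s) (weights s) (ranks s)"
    using inv unfolding sfm_inv_def by blast+
  have X1: "reals s1 rX v 0 = xval (weights s) (ranks s) v" if "v \<in> {1..n}" for v
    using p_xval_spec[of v s] rows_xval[OF ok that] that by (simp add: s1_def)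
  have fr1: "ints s1 iD = ints s iD" "ints s1 iR = ints s iR" "reals s1 rLAM = reals s rLAM" "ints s1 0 = ints s 0"
    by (simp_all add: s1_def)
  have fr2: "ints s2 iD = ints s iD" "ints s2 iR = ints s iR" "reals s2 rLAM = reals s rLAM" "ints s2 0 = ints s 0"
    "reals s2 rB = reals s rB" "reals s2 rA = reals s rA" "reals s2 rX = reals s1 rX"
    by (simp_all add: s2_def fr1) (simp_all add: s1_def)
  have inv2: "sfm_inv s2" using inv unfolding sfm_inv_def rows_ok_def fr2 .
  have t: "t = 0 \<and> ?act = {} \<or>
    t \<in> ?act \<and> (\<forall>v\<in>?act. labels s v < labels s t \<or> labels s v = labels s t \<and> v \<le> t)"
    using p_select_t_spec[of s1] X1 n d0 unfolding t_def s2_def fr1 by blast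
  have s': "s' = sem (PIf (IPos (IV iT)) (p_select_s ;;
      PIf (IPos (IV iS)) p_push (PI iD (IV iT) (INum 0) (IAdd (IA iD (IV iT)) (INum 1)))) PSkip) s2"
    unfolding s'_def p_step_def s2_def s1_def sem.simps(5) ..
  have "sfm_inv s' \<and> (active (labels s') (weights s') (ranks s') = {} \<or>
      potential (labels s') (weights s') (ranks s') < potential (labels s) (weights s) (ranks s)) \<and>
    (?act = {} \<longrightarrow> active (labels s') (weights s') (ranks s') = {})"
    using t
  proof
    assume "t = 0 \<and> ?act = {}"
    then have "s' = s2" "?act = {}" unfolding s' t_def by auto
    then show ?thesis using inv2 by (simp add: fr2)
  next
    assume *: "t \<in> ?act \<and> (\<forall>v\<in>?act. labels s v < labels s t \<or> labels s v = labels s t \<and> v \<le> t)"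
    then have tn: "t \<in> {1..n}" by (simp add: active_def)
    define s3 where "s3 = sem p_select_s s2"
    define S where "S = ints s3 iS 0 0"
    let ?T = "tails (labels s) (weights s) (ranks s) t"
    have S: "S = 0 \<and> ?T = {} \<or> S \<in> ?T \<and> (\<forall>v\<in>?T. v \<le> S)"
      using p_select_s_spec[of s2] unfolding s3_def[symmetric] S_def[symmetric] t_def[symmetric] fr2 .
    have fr3: "ints s3 iD = ints s iD" "ints s3 iR = ints s iR" "reals s3 rLAM = reals s rLAM" "ints s3 0 = ints s 0"
      "reals s3 rB = reals s rB" "reals s3 rA = reals s rA" "reals s3 rX = reals s1 rX" "ints s3 iT 0 0 = t"
      by (simp_all add: s3_def fr2 t_def)
    have inv3: "sfm_inv s3" using inv unfolding sfm_inv_def rows_ok_def fr3 .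
    have s'3: "s' = sem (PIf (IPos (IV iS)) p_push (PI iD (IV iT) (INum 0) (IAdd (IA iD (IV iT)) (INum 1)))) s3"
      using tn unfolding s' s3_def t_def by simp
    from S show ?thesis
    proof
      assume **: "S = 0 \<and> ?T = {}"
      have s4: "s' = sem (PI iD (IV iT) (INum 0) (IAdd (IA iD (IV iT)) (INum 1))) s3"
        using ** unfolding s'3 S_def by simp
      have D: "labels s' = (labels s)(t := labels s t + 1)"
        by (auto simp: s4 fr3 update_apply)
      have fr4: "ints s' iR = ints s iR" "reals s' = reals s3" "ints s' 0 = ints s 0"
        by (simp_all add: s4 fr3)
      note rel = relabel[OF lab _ _ D]
      have "labelling (labels s') (weights s) (ranks s)"
        "potential (labels s') (weights s) (ranks s) < potential (labels s) (weights s) (ranks s)"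
        using rel * ** by blast+
      moreover have "labels s' 0 = 0" using fun_cong[OF D, of 0] d0 tn by simp
      ultimately show ?thesis using inv3 * unfolding sfm_inv_def rows_ok_def fr4 fr3 by auto
    next
      assume **: "S \<in> ?T \<and> (\<forall>v\<in>?T. v \<le> S)"
      then have "S \<in> {1..n}" by (simp add: tails_def)
      then have s4: "s' = sem p_push s3" unfolding s'3 S_def by simp
      have "sfm_inv (sem p_push s3)"
        "potential (labels (sem p_push s3)) (weights (sem p_push s3)) (ranks (sem p_push s3)) <
         potential (labels s3) (weights s3) (ranks s3)"
        by (rule p_push_spec[OF inv3]; use * ** X1[OF tn] in \<open>simp add: fr3 S_def[symmetric]\<close>)+
      then show ?thesis using * unfolding s4 fr3 by blast
    qed
  qed
  then show "sfm_inv s'" "active (labels s') (weights s') (ranks s') = {} \<or>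
      potential (labels s') (weights s') (ranks s') < potential (labels s) (weights s) (ranks s)"
    "?act = {} \<Longrightarrow> active (labels s') (weights s') (ranks s') = {}"
    by blast+
qed

text \<open>The combination consists of the base vector of the identity ranking alone; labels that
  are all 0 satisfy every arc condition.\<close>

lemma p_init_spec:
  fixes s
  defines "s' \<equiv> sem p_init s"
  assumes a: "reals s rA 0 0 = \<alpha>" and n: "ints s 0 0 0 = n"
  shows "sfm_inv s'"
proof -
  let ?b1 = "PR rLAM (IV l1) (INum 0) (ROf (INum 0))"
  let ?b2 = "PI iD (IV l1) (INum 0) (INum 0) ;; PI iM (INum 0) (IV l1) (IV l1)"
  define s1 where "s1 = sem (PFor l1 0 2 ?b1) s"
  define s2 where "s2 = sem (PFor l1 0 1 ?b2) s1"
  define s3 where "s3 = sem (SetI iU (INum 0)) s2"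
  define s4 where "s4 = sem p_base s3"
  define s5 where "s5 = sem (PR rW (INum 0) (INum 0) (ROf (INum 1))) s4"
  have s': "s' = sem p_insert s5"
    unfolding s'_def p_init_def s5_def s4_def s3_def s2_def s1_def sem.simps(5) ..
  have L1: "reals s1 rLAM x y = (if 0 \<le> (if y = 0 then x else n + 2) \<and> (if y = 0 then x else n + 2) < n + 2
    then 0 else reals s rLAM x y)" for x y
    unfolding s1_def by (rule For_reals) (auto simp: update_apply)
  have D2: "ints s2 iD x y = (if 0 \<le> (if y = 0 then x else n + 1) \<and> (if y = 0 then x else n + 1) < n + 1
    then 0 else ints s1 iD x y)" for x y
    unfolding s2_def by (rule For_ints) (auto simp: update_apply)
  have M2: "ints s2 iM x y = (if 0 \<le> (if x = 0 then y else n + 1) \<and> (if x = 0 then y else n + 1) < n + 1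
    then y else ints s1 iM x y)" for x y
    unfolding s2_def by (rule For_ints) (auto simp: update_apply)
  have M: "ints s3 iM 0 v = v" if "v \<le> n" for v using M2[of 0 v] that by (simp add: s3_def)
  have fr3: "ints s3 iU 0 0 = 0" "reals s3 rA 0 0 = \<alpha>" "ints s3 0 0 0 = n"
    using a n by (simp_all add: s3_def s2_def s1_def update_apply)
  have E: "reals s4 rE 0 b = (if b = 0 then 1 else base (ints s3 iM 0) b)" if "b \<le> n" for b
    using p_base_spec[OF fr3(2), of 0 b] that fr3(1) by (simp add: s4_def)
  have L5: "reals s5 rLAM r 0 = 0" if "r < n + 2" for r
    using L1[of r 0] that by (simp add: s5_def s4_def s3_def s2_def)
  have U5: "ints s5 iU 0 0 = 0" "reals s5 rW 0 0 = 1" "reals s5 rE = reals s4 rE" "ints s5 iM = ints s3 iM"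
    by (simp_all add: s5_def s4_def fr3 update_apply)
  have nn: "\<forall>r<n+2. 0 \<le> reals s5 rLAM r 0" and z: "reals s5 rLAM 0 0 = 0"
    and W: "0 \<le> reals s5 rW (ints s5 iU 0 0) 0" using L5 U5 by simp_all
  note ins = p_insert_spec[OF nn z W, folded s', unfolded U5]
  have idr: "ranking (ints s3 iM 0)"
    unfolding ranking_def using M by (auto intro!: inj_onI)
  have row: "reals s' rB r 0 = 1 \<and> (\<forall>v\<in>{1..n}. ranks s' r v = ints s3 iM 0 v \<and>
      reals s' rB r v = base (ints s3 iM 0) v)" if "r < n + 2" "0 < weights s' r" for r
    using ins(4)[OF that] L5[OF that(1)] E by auto
  have rk: "ranking (ranks s' r)" if "r < n + 2" "0 < weights s' r" for r
    using row[OF that] idr ranking_cong[of "ranks s' r" "ints s3 iM 0"] by blast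
  have ok: "rows_ok s'"
    unfolding rows_ok_def
  proof (intro allI impI conjI ballI)
    fix r v assume r: "r < n + 2" "0 < weights s' r" and v: "v \<in> {1..n}"
    have "base (ranks s' r) v = base (ints s3 iM 0) v" using row[OF r] v by (intro base_cong) auto
    then show "reals s' rB r v = base (ranks s' r) v" using row[OF r] v by simp
  qed (use ins(1) row in auto)
  have "(\<Sum>r<n+2. weights s' r * reals s' rB r 0) = 1"
    using ins(3)[of 0] L5 E[of 0] by simp
  then have "(\<Sum>r<n+2. weights s' r) = 1" using rows_total[OF ok] by (simp only:)
  then have cc: "convex_comb (weights s') (ranks s')"
    using ins(1) rk unfolding convex_comb_def by blast
  have D: "labels s' v = 0" if "v \<le> n" for v
    using D2[of v 0] that by (simp add: s' s5_def s4_def s3_def)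
  have "labelling (labels s') (weights s') (ranks s')"
    unfolding labelling_def using cc D by auto
  then show ?thesis
    unfolding sfm_inv_def using ok ins(2) D[of 0] a n
    by (simp add: s' s5_def s4_def fr3)
qed

lemma p_extract_spec:
  fixes s
  defines "s' \<equiv> sem p_extract s" and "X \<equiv> \<lambda>l. {v \<in> {1..n}. l < labels s v}"
  assumes a: "reals s rA 0 0 = \<alpha>"
  shows "\<exists>l\<le>n. reals s' rFV 0 0 = f (X l) \<and> reals s' rCV 0 0 = c (X l) \<and>
    (\<forall>l'\<le>n. \<alpha> * f (X l') - c (X l') \<le> \<alpha> * f (X l) - c (X l))"
proof -
  let ?ch = "PFor l2 1 1 (PI iCH (INum 0) (IV l2) (ISub (IA iD (IV l2)) (IV l1)))"
  let ?q = "PQ Cost rQ1 (INum 0) (INum 0) iCH (INum 0) ;;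
     PQ Reward rQ2 (INum 0) (INum 0) iCH (INum 0) ;;
     PIf (BAnd (IPos (IV l1)) (BNot (RLess (RSub (RMul (RV rA) (RV rFV)) (RV rCV))
         (RSub (RMul (RV rA) (RV rQ2)) (RV rQ1)))))
       PSkip (SetR rFV (RV rQ2) ;; SetR rCV (RV rQ1))"
  let ?I = "\<lambda>k t. k = 0 \<or> (\<exists>l<k. reals t rFV 0 0 = f (X l) \<and> reals t rCV 0 0 = c (X l) \<and>
    (\<forall>l'<k. \<alpha> * f (X l') - c (X l') \<le> \<alpha> * f (X l) - c (X l)))"
  have "?I (n + 1) s'"
    unfolding s'_def p_extract_def
  proof (rule sem_For_rule[where I = ?I])
    fix k :: nat and t :: state
    assume I: "?I k t" and k: "ints t l1 0 0 = k"
      and fi: "\<And>x. x \<notin> insert l1 (imods (?ch ;; ?q)) \<Longrightarrow> ints t x = ints s x"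
      and fr: "\<And>x. x \<notin> rmods (?ch ;; ?q) \<Longrightarrow> reals t x = reals s x"
    have eqs: "ints t iD = ints s iD" "reals t rA = reals s rA" using fi fr by simp_all
    let ?t = "sem ?ch t"
    have CH: "ints ?t iCH x y = (if 1 \<le> (if x = 0 then y else n + 1) \<and> (if x = 0 then y else n + 1) < n + 1
        then labels s y - k else ints t iCH x y)" for x y
      by (rule For_ints) (use k in \<open>auto simp: update_apply eqs\<close>)
    have st: "stored_set n iCH 0 ?t = X k"
      unfolding stored_set_def X_def by (auto simp: CH)
    have st': "stored_set n iCH 0 (?t\<lparr>reals := Y\<rparr>) = X k" for Y
      using st by (simp add: stored_set_def)
    let ?u = "seti l1 (Suc k) (sem (?ch ;; ?q) t)"
    let ?b = "0 < k \<and> \<not> \<alpha> * reals t rFV 0 0 - reals t rCV 0 0 < \<alpha> * f (X k) - c (X k)"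
    have FV: "reals ?u rFV 0 0 = (if ?b then reals t rFV 0 0 else f (X k))"
      and CV: "reals ?u rCV 0 0 = (if ?b then reals t rCV 0 0 else c (X k))"
      using k a by (auto simp: st st' update_apply eqs)
    show "?I (Suc k) ?u"
    proof (cases ?b)
      case True
      then obtain l where "l < k" "reals t rFV 0 0 = f (X l)" "reals t rCV 0 0 = c (X l)"
        "\<forall>l'<k. \<alpha> * f (X l') - c (X l') \<le> \<alpha> * f (X l) - c (X l)" using I by auto
      then show ?thesis unfolding FV CV using True by (intro disjI2 exI[of _ l]) (auto simp: less_Suc_eq)
    next
      case False
      have "\<alpha> * f (X l') - c (X l') \<le> \<alpha> * f (X k) - c (X k)" if "l' < Suc k" for l'
      proof (cases "l' = k")
        case nk: False
        then have "l' < k" using that by simp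
        then show ?thesis using I False by fastforce
      qed simp
      then show ?thesis unfolding FV CV using False by (intro disjI2 exI[of _ k]) auto
    qed
  qed auto
  then show ?thesis unfolding Suc_eq_plus1[symmetric] less_Suc_eq_le by blast
qed

text \<open>Some level set is a minimizer by \<open>minimizer_level_set\<close>, hence so is the
  best of all level sets.\<close>

lemma p_sfm_spec:
  assumes "reals s rA 0 0 = \<alpha>" "ints s 0 0 0 = n"
  shows "response \<alpha> (reals (sem p_sfm s) rFV 0 0) (reals (sem p_sfm s) rCV 0 0)"
proof -
  define s1 where "s1 = sem p_init s"
  define s2 where "s2 = sem (nest 30 10 p_step) s1"
  have s': "sem p_sfm s = sem p_extract s2"
    unfolding p_sfm_def s2_def s1_def sem.simps(5) ..
  have inv1: "sfm_inv s1" unfolding s1_def by (rule p_init_spec[OF assms])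
  let ?\<mu> = "\<lambda>s. potential (labels s) (weights s) (ranks s)"
  let ?halt = "\<lambda>s. active (labels s) (weights s) (ranks s) = {}"
  have seti: "sfm_inv (seti i k t) = sfm_inv t" "?halt (seti i k t) = ?halt t" "?\<mu> (seti i k t) = ?\<mu> t"
    if "30 \<le> i" for i k t
    using that unfolding sfm_inv_def rows_ok_def by simp_all
  have "sfm_inv t \<Longrightarrow> sfm_inv (sem p_step t) \<and> (?halt (sem p_step t) \<or> ?\<mu> (sem p_step t) < ?\<mu> t)" for t
    using p_step_spec(1,2) by blast
  note nest = nest_measure[where Inv = sfm_inv and halt = ?halt and \<mu> = ?\<mu> and b = 30 and K = 10,
      OF this p_step_spec(3) seti inv1 potential_bound]
  have "sfm_inv s2" "?halt s2"
    unfolding s2_def by (rule nest; assumption)+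
  then have lab: "labelling (labels s2) (weights s2) (ranks s2)" and "?halt s2" and a: "reals s2 rA 0 0 = \<alpha>"
    unfolding sfm_inv_def by blast+
  let ?X = "\<lambda>l. {v \<in> {1..n}. l < labels s2 v}"
  obtain l0 where l0: "l0 \<le> n" "\<And>Y. Y \<subseteq> {1..n} \<Longrightarrow> c (?X l0) - \<alpha> * f (?X l0) \<le> c Y - \<alpha> * f Y"
    using minimizer_level_set[OF lab \<open>?halt s2\<close>] by blast
  obtain l where l: "reals (sem p_extract s2) rFV 0 0 = f (?X l)" "reals (sem p_extract s2) rCV 0 0 = c (?X l)"
    "\<And>l'. l' \<le> n \<Longrightarrow> \<alpha> * f (?X l') - c (?X l') \<le> \<alpha> * f (?X l) - c (?X l)"
    using p_extract_spec[OF a] by blast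
  have "optimal_for \<alpha> (?X l)"
    unfolding optimal_for_iff
  proof (intro conjI allI impI)
    fix T assume "T \<subseteq> {1..n}"
    then show "\<alpha> * f T - c T \<le> \<alpha> * f (?X l) - c (?X l)" using l0(2)[of T] l(3)[OF l0(1)] by linarith
  qed blast
  then show ?thesis unfolding s' response_def l(1,2) by (intro exI[of _ "?X l"]) simp
qed

end

section \<open>The search for the optimal contract\<close>

abbreviation (input) "ra \<equiv> 22 :: name"
abbreviation (input) "rk \<equiv> 23 :: name"
abbreviation (input) "ra0 \<equiv> 24 :: name"
abbreviation (input) "rk0 \<equiv> 25 :: name"
abbreviation (input) "ra1 \<equiv> 26 :: name"
abbreviation (input) "rk1 \<equiv> 27 :: name"
abbreviation (input) "rbest \<equiv> 28 :: name"
abbreviation (input) "rOUT \<equiv> 0 :: name"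

definition p_newton :: prog where
  "p_newton =
   SetR rA (RDiv (RSub (RV rk) (RV rk1)) (RSub (RV ra) (RV ra1))) ;;
   p_sfm ;;
   PIf (RLess (RSub (RMul (RV rA) (RV ra)) (RV rk)) (RSub (RMul (RV rA) (RV rFV)) (RV rCV)))
     (SetR ra1 (RV rFV) ;; SetR rk1 (RV rCV))
     (PIf (RLess (RV rbest) (RMul (RSub (ROf (INum 1)) (RV rA)) (RV ra)))
        (SetR rbest (RMul (RSub (ROf (INum 1)) (RV rA)) (RV ra)) ;; SetR rOUT (RV rA)) PSkip ;;
      SetR ra (RV ra1) ;; SetR rk (RV rk1) ;; SetR ra1 (RV ra0) ;; SetR rk1 (RV rk0))"

definition p_search_init :: prog where
  "p_search_init =
   SetR rA (ROf (INum 1)) ;; p_sfm ;; SetR ra (RV rFV) ;; SetR rk (RV rCV) ;;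
   SetR rA (ROf (INum 0)) ;; p_sfm ;; SetR ra0 (RV rFV) ;; SetR rk0 (RV rCV) ;;
   SetR ra1 (RV ra0) ;; SetR rk1 (RV rk0) ;; SetR rbest (RV ra0) ;; SetR rOUT (ROf (INum 0))"

definition p_main :: prog where
  "p_main = p_search_init ;; nest 50 4 (PIf (RLess (RV ra1) (RV ra)) p_newton PSkip)"

lemma mods_p_sfm [simp]:
  "imods p_sfm = {2, 3, 4, 5, 6, 7, 8, 9, 10, 11, 12, 13, 14, 20, 21, 22} \<union> {30..<40}"
  "rmods p_sfm = {2, 3, 4, 5, 6, 7, 8, 9, 10, 11, 12, 13, 14, 15, 16, 17, 18, 19, 20}"
  by (auto simp: p_sfm_def)

lemma wf_p_main: "wf_prog p_main"
proof -
  have "wf_prog (nest 50 4 (PIf (RLess (RV ra1) (RV ra)) p_newton PSkip))"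
    by (rule wf_nest) (auto simp: p_newton_def wf_p_sfm)
  then show ?thesis by (simp add: p_main_def p_search_init_def wf_p_sfm)
qed

context contract
begin

section \<open>Correctness of the search\<close>

lemma sfm_response:
  assumes "0 \<le> \<alpha>" "reals s rA 0 0 = \<alpha>" "ints s 0 0 0 = n"
  shows "response \<alpha> (reals (sem p_sfm s) rFV 0 0) (reals (sem p_sfm s) rCV 0 0)"
proof -
  interpret contract_at n f c \<alpha> by unfold_locales (rule assms(1))
  show ?thesis by (rule p_sfm_spec[OF assms(2,3)])
qed

definition state_inv :: "state \<Rightarrow> bool" where
  "state_inv s \<longleftrightarrow> ints s 0 0 0 = n \<and>
     search_inv (reals s ra0 0 0) (reals s rk0 0 0) (reals s ra 0 0) (reals s rk 0 0)
       (reals s ra1 0 0) (reals s rk1 0 0) (reals s rbest 0 0) (reals s rOUT 0 0)"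

lemma p_search_init_spec:
  assumes n: "ints s 0 0 0 = n"
  shows "state_inv (sem p_search_init s)"
proof -
  define s1 where "s1 = sem (SetR rA (ROf (INum 1))) s"
  define s2 where "s2 = sem p_sfm s1"
  define s3 where "s3 = sem (SetR ra (RV rFV) ;; SetR rk (RV rCV) ;; SetR rA (ROf (INum 0))) s2"
  define s4 where "s4 = sem p_sfm s3"
  have s': "sem p_search_init s = sem (SetR ra0 (RV rFV) ;; SetR rk0 (RV rCV) ;; SetR ra1 (RV ra0) ;;
      SetR rk1 (RV rk0) ;; SetR rbest (RV ra0) ;; SetR rOUT (ROf (INum 0))) s4"
    unfolding p_search_init_def s4_def s3_def s2_def s1_def sem.simps(5) ..
  have 1: "response 1 (reals s2 rFV 0 0) (reals s2 rCV 0 0)"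
    unfolding s2_def by (rule sfm_response) (simp_all add: s1_def update_apply n)
  have n2: "ints s2 0 0 0 = n" by (simp add: s2_def s1_def n)
  have 0: "response 0 (reals s4 rFV 0 0) (reals s4 rCV 0 0)"
    unfolding s4_def by (rule sfm_response) (simp_all add: s3_def update_apply n2)
  have "reals s4 ra 0 0 = reals s2 rFV 0 0" "reals s4 rk 0 0 = reals s2 rCV 0 0" "ints s4 0 0 0 = n"
    by (simp_all add: s4_def s3_def update_apply n2)
  then show ?thesis
    unfolding state_inv_def s' using search_init[OF 0 1] by (simp add: update_apply)
qed

lemma p_newton_spec:
  assumes inv: "state_inv s" and less: "reals s ra1 0 0 < reals s ra 0 0"
  shows "state_inv (sem p_newton s)"
    and "search_measure (reals (sem p_newton s) ra 0 0) (reals (sem p_newton s) ra1 0 0) <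
      search_measure (reals s ra 0 0) (reals s ra1 0 0)"
proof -
  let ?a = "reals s ra 0 0" and ?k = "reals s rk 0 0" and ?at = "reals s ra1 0 0" and ?kt = "reals s rk1 0 0"
  let ?az = "reals s ra0 0 0" and ?kz = "reals s rk0 0 0" and ?b = "reals s rbest 0 0" and ?o = "reals s rOUT 0 0"
  define \<alpha> where "\<alpha> = (?k - ?kt) / (?a - ?at)"
  define s1 where "s1 = sem (SetR rA (RDiv (RSub (RV rk) (RV rk1)) (RSub (RV ra) (RV ra1)))) s"
  define s2 where "s2 = sem p_sfm s1"
  let ?f = "reals s2 rFV 0 0" and ?c = "reals s2 rCV 0 0"
  have n: "ints s 0 0 0 = n" and si: "search_inv ?az ?kz ?a ?k ?at ?kt ?b ?o"
    using inv unfolding state_inv_def by blast+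
  \<comment> \<open>\<open>sfm_response\<close> asks for 0 \<le> \<alpha>, and
    \<open>search_newton\<close> supplies it given a response at \<alpha>; an arbitrary one breaks
    the circle.\<close>
  obtain a' k' where "response \<alpha> a' k'" using optimal_for_exists unfolding response_def by blast
  then have "0 \<le> \<alpha>" using search_newton(1)[OF si less \<alpha>_def] by blast
  then have r: "response \<alpha> ?f ?c"
    unfolding s2_def by (rule sfm_response) (simp_all add: s1_def update_apply \<alpha>_def n)
  note step = search_newton[OF si less \<alpha>_def r]
  have fr: "reals s2 rA 0 0 = \<alpha>" "reals s2 ra 0 0 = ?a" "reals s2 rk 0 0 = ?k" "reals s2 ra1 0 0 = ?at"
    "reals s2 rk1 0 0 = ?kt" "reals s2 ra0 0 0 = ?az" "reals s2 rk0 0 0 = ?kz" "reals s2 rbest 0 0 = ?b"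
    "reals s2 rOUT 0 0 = ?o" "ints s2 0 0 0 = n"
    by (simp_all add: s2_def s1_def update_apply \<alpha>_def n)
  have s': "sem p_newton s = sem (PIf (RLess (RSub (RMul (RV rA) (RV ra)) (RV rk)) (RSub (RMul (RV rA) (RV rFV)) (RV rCV)))
     (SetR ra1 (RV rFV) ;; SetR rk1 (RV rCV))
     (PIf (RLess (RV rbest) (RMul (RSub (ROf (INum 1)) (RV rA)) (RV ra)))
        (SetR rbest (RMul (RSub (ROf (INum 1)) (RV rA)) (RV ra)) ;; SetR rOUT (RV rA)) PSkip ;;
      SetR ra (RV ra1) ;; SetR rk (RV rk1) ;; SetR ra1 (RV ra0) ;; SetR rk1 (RV rk0))) s2"
    unfolding p_newton_def s2_def s1_def sem.simps(5) ..
  show "state_inv (sem p_newton s)"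
    using step(3,5,6) unfolding state_inv_def s' by (simp add: fr update_apply)
  show "search_measure (reals (sem p_newton s) ra 0 0) (reals (sem p_newton s) ra1 0 0) < search_measure ?a ?at"
    using step(4,7) unfolding s' by (simp add: fr update_apply)
qed

lemma p_main_spec:
  assumes "ints s 0 0 0 = n" "tie_breaking_rule {1..n} \<tau>"
  shows "optimal_contract \<tau> {1..n} f c (result (sem p_main s))"
proof -
  let ?p = "PIf (RLess (RV ra1) (RV ra)) p_newton PSkip"
  let ?halt = "\<lambda>s. \<not> reals s ra1 0 0 < reals s ra 0 0"
  let ?\<mu> = "\<lambda>s. search_measure (reals s ra 0 0) (reals s ra1 0 0)"
  define s1 where "s1 = sem p_search_init s"
  define s2 where "s2 = sem (nest 50 4 ?p) s1"
  have step: "state_inv (sem ?p t) \<and> (?halt (sem ?p t) \<or> ?\<mu> (sem ?p t) < ?\<mu> t)" if "state_inv t" for t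
    using p_newton_spec[OF that] that by simp
  have halt: "?halt (sem ?p t)" if "?halt t" for t using that by simp
  have seti: "state_inv (seti i k t) = state_inv t" "?halt (seti i k t) = ?halt t" "?\<mu> (seti i k t) = ?\<mu> t"
    if "50 \<le> i" for i k t
    using that unfolding state_inv_def by simp_all
  have inv1: "state_inv s1" unfolding s1_def by (rule p_search_init_spec[OF assms(1)])
  note nest = nest_measure[where Inv = state_inv and halt = ?halt and \<mu> = ?\<mu> and b = 50 and K = 4,
      OF step halt seti inv1 search_measure_bound]
  have "state_inv s2" "?halt s2"
    unfolding s2_def by (rule nest; assumption)+
  moreover have eq: "sem p_main s = s2" unfolding p_main_def s2_def s1_def by simp
  ultimately show ?thesis
    using search_final[OF _ _ assms(2)] unfolding state_inv_def result_def eq by blast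
qed

end

text \<open>One result serves every rule \<tau>, because all sets in \<open>best_responses\<close>
  share the same reward and so give the principal the same utility.\<close>

theorem theorem1:
  shows "\<exists>(p :: com) (q :: nat poly). \<forall>(n :: nat) (f :: nat set \<Rightarrow> real) (c :: nat set \<Rightarrow> real).
    mono_on (Pow {1..n}) c \<and> submodular_on {1..n} c \<and>
    f ` Pow {1..n} \<subseteq> {0..1} \<and> mono_on (Pow {1..n}) f \<and> supermodular_on {1..n} f \<longrightarrow>
    (\<exists>t s. exec n f c p (initial_state n) t s \<and> t \<le> poly q n \<and>
       (\<forall>\<tau>. tie_breaking_rule {1..n} \<tau> \<longrightarrow> optimal_contract \<tau> {1..n} f c (result s)))"
proof (intro exI[of _ "compile p_main"] exI[of _ "time p_main"] allI impI)
  fix n :: nat and f c :: "nat set \<Rightarrow> real"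
  assume "mono_on (Pow {1..n}) c \<and> submodular_on {1..n} c \<and>
    f ` Pow {1..n} \<subseteq> {0..1} \<and> mono_on (Pow {1..n}) f \<and> supermodular_on {1..n} f"
  then interpret contract n f c by unfold_locales blast+
  have n: "ints (initial_state n) 0 0 0 = n" by (simp add: initial_state_def update_apply)
  obtain t where "t \<le> poly (time p_main) n" "exec n f c (compile p_main) (initial_state n) t (sem p_main (initial_state n))"
    using exec_sem[OF wf_p_main n] by blast
  then show "\<exists>t s. exec n f c (compile p_main) (initial_state n) t s \<and> t \<le> poly (time p_main) n \<and>
       (\<forall>\<tau>. tie_breaking_rule {1..n} \<tau> \<longrightarrow> optimal_contract \<tau> {1..n} f c (result s))"
    using p_main_spec[OF n] by blast
qed

end
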